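(* Let $P\subset\mathbb{R}^n$ be a Delzant polytope with vertices in $\mathbb{Z}^n$, $\varphi\in C^\infty_{g_P}(P)$, $\psi\in C^\infty(P)$ with positive definite Hessian on $P$, and let $a_m\in\mathbb{C}^*$, $v(m)\in\mathbb{R}$ for $m\in P\cap\mathbb{Z}^n$. Let $Y_s\subset(X_P,J_s)$ be the associated hypersurfaces, where $J_s$ is defined by $g_s=g_P+\varphi+s\psi$. Then the Hausdorff limit $\mathcal{A}_{\rm lim}=\lim_{s\to\infty}\mu_P(Y_s)\subset P$ exists and is given by $$\mathcal{L}_\psi\,\mathcal{A}_{\rm lim}=\pi\,\mathcal{A}_{\rm trop}.$$
   Context: **Toric manifold.** $P=\{x\in\mathbb{R}^n:\ell_r(x)={}^t\nu_r x-\lambda_r\ge 0,\ r=1,\dots,d\}$ is a (compact) Delzant polytope with vertices in $\mathbb{Z}^n$: $\lambda_r\in\mathbb{Z}$, $\nu_r\in\mathbb{Z}^n$ is the primitive inward-pointing normal of the $r$-th facet, and at each vertex exactly $n$ facets meet and their normals form a $\mathbb{Z}$-basis of $\mathbb{Z}^n$. $\breve P$ is the interior of $P$. $(X_P,\omega,\mathbb{T}^n,\mu_P)$ is the associated compact symplectic toric manifold with moment map $\mu_P:X_P\to P$. On $\breve X_P=\mu_P^{-1}(\breve P)\cong\breve P\times\mathbb{T}^n$ one has coordinates $(x,\theta)$ with $\omega=\sum_i dx_i\wedge d\theta_i$ and $\mu_P(x,\theta)=x$. **Symplectic potentials and charts.** $g_P(x)=\frac12\sum_{r=1}^d\ell_r(x)\log\ell_r(x)$.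 $C^\infty_{g_P}(P)$ is the set of $\varphi\in C^\infty(P)$ such that $\mathrm{Hess}_x(g_P+\varphi)$ is positive definite on $\breve P$ and $\det\mathrm{Hess}_x(g_P+\varphi)=[\alpha(x)\prod_{r=1}^d\ell_r(x)]^{-1}$ with $\alpha$ smooth and strictly positive on $P$. The potential $g_s=g_P+\varphi+s\psi$ ($s>0$) defines an $\omega$-compatible complex structure $J_s$ on $X_P$. For a vertex $q$ of $P$, with an ordering of the $n$ facets containing $q$, let $A$ be the matrix whose rows are their normals, $\lambda$ the vector of the corresponding $\lambda_r$, $l=\ell_q(x)=Ax-\lambda$, $\vartheta={}^tA^{-1}\theta$; let $V_q=\mu_P^{-1}(\breve P_q)$ with $\breve P_q$ the union of the relative interiors of all faces of $P$ containing $q$ (including $\{q\}$ and $\breve P$). The functions $w_j=e^{\partial g_s/\partial l_j+i\vartheta_j}$ extend to a $J_s$-holomorphic chart $w_q:V_q\to\mathbb{C}^n$; the sets $V_q$ cover $X_P$. **Hypersurfaces.** $Y_s=\{p\in X_P:\sum_{m\in P\cap\mathbb{Z}^n}a_me^{-sv(m)}\sigma^m_s(p)=0\}$, where $\sigma_s^m$ are the canonical monomial $J_s$-holomorphic sections of the line bundle associated with $P$; explicitly, in the local holomorphic trivialization over $V_q$, $\sigma_s^m$ is given by the monomial $w_q^{\ell_q(m)}$, and on the open orbit by $w^m$ with $w=e^{\partial g_s/\partial x+i\theta}$. The limit amoeba $\mathcal{A}_{\rm lim}:=\lim_{s\to\infty}\mu_P(Y_s)$ is the limit in the Hausdorff metric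 on closed subsets of $P$. **Legendre transform, tropical amoeba, projection.** $\mathcal{L}_\psi:P\to\mathcal{L}_\psi P\subset\mathbb{R}^n$, $\mathcal{L}_\psi(x)=\frac{\partial\psi}{\partial x}(x)$. $\mathcal{A}_{\rm trop}\subset\mathbb{R}^n$ is the locus of non-differentiability of $u\mapsto\max_{m\in P\cap\mathbb{Z}^n}\{{}^tm\,u-v(m)\}$. For $p\in P$, $\mathcal{C}_p(P)=\{c\in\mathbb{R}^n:{}^tc(p-p')\ge0\ \forall p'\in P\}$. The space $\mathbb{R}^n$ is the disjoint union of the sets $\mathcal{L}_\psi(p)+\mathcal{C}_p(P)$, $p\in P$, and $\pi:\mathbb{R}^n\to\mathcal{L}_\psi P$ is the continuous projection with $\pi(\mathcal{L}_\psi(p)+\mathcal{C}_p(P))=\{\mathcal{L}_\psi(p)\}$. *)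

theory Defs
  imports "HOL-Analysis.Analysis"
begin

section \<open>Calculus on \<open>\<real>\<^sup>n\<close>\<close>

definition partial :: "'n::finite \<Rightarrow> (real^'n \<Rightarrow> real) \<Rightarrow> real^'n \<Rightarrow> real" where
  "partial i f x = frechet_derivative f (at x) (axis i 1)"

definition gradient :: "(real^'n::finite \<Rightarrow> real) \<Rightarrow> real^'n \<Rightarrow> real^'n" where
  "gradient f x = (\<chi> i. partial i f x)"

definition hessian :: "(real^'n::finite \<Rightarrow> real) \<Rightarrow> real^'n \<Rightarrow> real^'n^'n" where
  "hessian f x = (\<chi> i j. partial i (partial j f) x)"

definition positive_definite :: "real^'n::finite^'n \<Rightarrow> bool" where
  "positive_definite M \<longleftrightarrow> transpose M = M \<and> (\<forall>v. v \<noteq> 0 \<longrightarrow> v \<bullet> (M *v v) > 0)"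

primrec C_k :: "nat \<Rightarrow> (real^'n::finite) set \<Rightarrow> (real^'n \<Rightarrow> real) \<Rightarrow> bool" where
  "C_k 0 U f = continuous_on U f"
| "C_k (Suc k) U f = (f differentiable_on U \<and> (\<forall>i. C_k k U (partial i f)))"

text \<open>A smooth function on a closed set is one that extends smoothly to an open neighbourhood.
  A total function represents such an element by being itself one of these extensions; for a
  full-dimensional polytope, its values and all its derivatives at points of \<open>P\<close> do not
  depend on the choice of extension.\<close>

definition smooth_on_closed :: "(real^'n::finite) set \<Rightarrow> (real^'n \<Rightarrow> real) \<Rightarrow> bool" where
  "smooth_on_closed P f \<longleftrightarrow> (\<exists>U. open U \<and> P \<subseteq> U \<and> (\<forall>k. C_k k U f))"

section \<open>Delzant polytopes\<close>

text \<open>A polytope is presented by the number \<open>d\<close> of its facets, their normals \<open>\<nu> r\<close> and the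
  integers \<open>lam r\<close>, where \<open>r\<close> runs through \<open>1, \<dots>, d\<close>.\<close>

definition real_vec :: "int^'n::finite \<Rightarrow> real^'n" where
  "real_vec m = (\<chi> i. of_int (m $ i))"

definition ell :: "(nat \<Rightarrow> int^'n::finite) \<Rightarrow> (nat \<Rightarrow> int) \<Rightarrow> nat \<Rightarrow> real^'n \<Rightarrow> real" where
  "ell \<nu> lam r x = real_vec (\<nu> r) \<bullet> x - of_int (lam r)"

definition polytope_of :: "nat \<Rightarrow> (nat \<Rightarrow> int^'n::finite) \<Rightarrow> (nat \<Rightarrow> int) \<Rightarrow> (real^'n) set" where
  "polytope_of d \<nu> lam = {x. \<forall>r\<in>{1..d}. ell \<nu> lam r x \<ge> 0}"

definition active :: "nat \<Rightarrow> (nat \<Rightarrow> int^'n::finite) \<Rightarrow> (nat \<Rightarrow> int) \<Rightarrow> real^'n \<Rightarrow> nat set" where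
  "active d \<nu> lam x = {r\<in>{1..d}. ell \<nu> lam r x = 0}"

definition Z_basis :: "nat set \<Rightarrow> (nat \<Rightarrow> int^'n::finite) \<Rightarrow> bool" where
  "Z_basis R \<nu> \<longleftrightarrow>
     (\<forall>z :: int^'n. \<exists>!c :: nat \<Rightarrow> int. (\<forall>r. r \<notin> R \<longrightarrow> c r = 0) \<and> z = (\<Sum>r\<in>R. c r *s \<nu> r))"

definition delzant :: "nat \<Rightarrow> (nat \<Rightarrow> int^'n::finite) \<Rightarrow> (nat \<Rightarrow> int) \<Rightarrow> bool" where
  "delzant d \<nu> lam \<longleftrightarrow>
     (let P = polytope_of d \<nu> lam in
        compact P \<and>
        bij_betw (\<lambda>r. {x\<in>P. ell \<nu> lam r x = 0}) {1..d} {F. F facet_of P} \<and>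
        (\<forall>r\<in>{1..d}. Gcd (range (\<lambda>i. \<nu> r $ i)) = 1) \<and>
        (\<forall>q. q extreme_point_of P \<longrightarrow>
           q \<in> range real_vec \<and>
           card (active d \<nu> lam q) = CARD('n) \<and> Z_basis (active d \<nu> lam q) \<nu>))"

definition lattice_points :: "(real^'n::finite) set \<Rightarrow> (int^'n) set" where
  "lattice_points P = {m. real_vec m \<in> P}"

section \<open>Symplectic potentials\<close>

definition g_P :: "nat \<Rightarrow> (nat \<Rightarrow> int^'n::finite) \<Rightarrow> (nat \<Rightarrow> int) \<Rightarrow> real^'n \<Rightarrow> real" where
  "g_P d \<nu> lam x = 1/2 * (\<Sum>r=1..d. ell \<nu> lam r x * ln (ell \<nu> lam r x))"

definition C_inf_gP ::
  "nat \<Rightarrow> (nat \<Rightarrow> int^'n::finite) \<Rightarrow> (nat \<Rightarrow> int) \<Rightarrow> (real^'n \<Rightarrow> real) set" where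
  "C_inf_gP d \<nu> lam =
     (let P = polytope_of d \<nu> lam; H = (\<lambda>\<phi>. hessian (\<lambda>x. g_P d \<nu> lam x + \<phi> x)) in
      {\<phi>. smooth_on_closed P \<phi> \<and>
          (\<forall>x\<in>interior P. positive_definite (H \<phi> x)) \<and>
          (\<exists>\<alpha>. smooth_on_closed P \<alpha> \<and> (\<forall>x\<in>P. \<alpha> x > 0) \<and>
             (\<forall>x\<in>interior P. det (H \<phi> x) = inverse (\<alpha> x * (\<Prod>r=1..d. ell \<nu> lam r x))))})"

definition g_s :: "nat \<Rightarrow> (nat \<Rightarrow> int^'n::finite) \<Rightarrow> (nat \<Rightarrow> int) \<Rightarrow>
    (real^'n \<Rightarrow> real) \<Rightarrow> (real^'n \<Rightarrow> real) \<Rightarrow> real \<Rightarrow> real^'n \<Rightarrow> real" where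
  "g_s d \<nu> lam \<phi> \<psi> s x = g_P d \<nu> lam x + \<phi> x + s * \<psi> x"

section \<open>The toric manifold\<close>

text \<open>\<open>X\<^sub>P\<close> is realised as the quotient of \<open>P \<times> \<real>\<^sup>n\<close>, with action-angle coordinates
  \<open>(x, \<theta>)\<close>, by the lattice \<open>2\<pi>\<int>\<^sup>n\<close> and, over a point \<open>x\<close>, by the Lie algebra of its
  stabiliser, which is spanned by the normals of the facets containing \<open>x\<close>. Over the interior of
  \<open>P\<close> this is \<open>interior P \<times> \<real>\<^sup>n / 2\<pi>\<int>\<^sup>n\<close>.\<close>

definition toric_rel :: "nat \<Rightarrow> (nat \<Rightarrow> int^'n::finite) \<Rightarrow> (nat \<Rightarrow> int) \<Rightarrow>
    (((real^'n) \<times> (real^'n)) \<times> ((real^'n) \<times> (real^'n))) set" where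
  "toric_rel d \<nu> lam =
     {((x, \<theta>), (x', \<theta>')). x \<in> polytope_of d \<nu> lam \<and> x' = x \<and>
        (\<exists>k :: int^'n. \<theta>' - \<theta> - (2 * pi) *\<^sub>R real_vec k
           \<in> span ((\<lambda>r. real_vec (\<nu> r)) ` active d \<nu> lam x))}"

definition X_P :: "nat \<Rightarrow> (nat \<Rightarrow> int^'n::finite) \<Rightarrow> (nat \<Rightarrow> int) \<Rightarrow>
    ((real^'n) \<times> (real^'n)) set set" where
  "X_P d \<nu> lam = (polytope_of d \<nu> lam \<times> UNIV) // toric_rel d \<nu> lam"

definition moment_map :: "((real^'n::finite) \<times> (real^'n)) set \<Rightarrow> real^'n" where
  "moment_map p = (THE x. \<exists>\<theta>. (x, \<theta>) \<in> p)"

section \<open>Vertex charts\<close>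

text \<open>A vertex chart is given by a vertex \<open>q\<close> and an ordering \<open>\<rho>\<close> of the facets containing it.\<close>

definition vertex_ordering :: "nat \<Rightarrow> (nat \<Rightarrow> int^'n::finite) \<Rightarrow> (nat \<Rightarrow> int) \<Rightarrow>
    real^'n \<Rightarrow> ('n \<Rightarrow> nat) \<Rightarrow> bool" where
  "vertex_ordering d \<nu> lam q \<rho> \<longleftrightarrow>
     q extreme_point_of polytope_of d \<nu> lam \<and> bij_betw \<rho> UNIV (active d \<nu> lam q)"

definition normal_matrix :: "(nat \<Rightarrow> int^'n::finite) \<Rightarrow> ('n \<Rightarrow> nat) \<Rightarrow> real^'n^'n" where
  "normal_matrix \<nu> \<rho> = (\<chi> j. real_vec (\<nu> (\<rho> j)))"

definition P_q :: "(real^'n::finite) set \<Rightarrow> real^'n \<Rightarrow> (real^'n) set" where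
  "P_q P q = \<Union> {rel_interior F | F. F face_of P \<and> q \<in> F}"

definition V_q :: "nat \<Rightarrow> (nat \<Rightarrow> int^'n::finite) \<Rightarrow> (nat \<Rightarrow> int) \<Rightarrow> real^'n \<Rightarrow>
    ((real^'n) \<times> (real^'n)) set set" where
  "V_q d \<nu> lam q = {p \<in> X_P d \<nu> lam. moment_map p \<in> P_q (polytope_of d \<nu> lam) q}"

text \<open>The functions \<open>w\<^sub>j\<close> on the open orbit. In the coordinates \<open>l = A x - \<lambda>\<close> the vector field
  \<open>\<partial>/\<partial>l\<^sub>j\<close> is the \<open>j\<close>-th column of the inverse of \<open>A\<close>.\<close>

definition w_open :: "real^'n::finite^'n \<Rightarrow> (real^'n \<Rightarrow> real) \<Rightarrow>
    (real^'n) \<times> (real^'n) \<Rightarrow> complex^'n" where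
  "w_open A g = (\<lambda>(x, \<theta>). \<chi> j.
     exp (complex_of_real (frechet_derivative g (at x) (matrix_inv A *v axis j 1))
          + \<i> * complex_of_real ((transpose (matrix_inv A) *v \<theta>) $ j)))"

text \<open>The chart \<open>w\<^sub>q\<close> is the continuous extension of these functions to \<open>V\<^sub>q\<close>, computed in
  \<open>P \<times> \<real>\<^sup>n\<close>: the limit must be the same at all representatives of the point of \<open>X\<^sub>P\<close>.
  These charts determine the complex structure \<open>J\<^sub>s\<close>.\<close>

definition w_chart :: "nat \<Rightarrow> (nat \<Rightarrow> int^'n::finite) \<Rightarrow> (nat \<Rightarrow> int) \<Rightarrow> (real^'n \<Rightarrow> real) \<Rightarrow>
    ('n \<Rightarrow> nat) \<Rightarrow> ((real^'n) \<times> (real^'n)) set \<Rightarrow> complex^'n" where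
  "w_chart d \<nu> lam g \<rho> p =
     (THE c. \<forall>z\<in>p. (w_open (normal_matrix \<nu> \<rho>) g \<longlongrightarrow> c)
                       (at z within interior (polytope_of d \<nu> lam) \<times> UNIV))"

section \<open>Monomial sections and hypersurfaces\<close>

definition ell_int :: "(nat \<Rightarrow> int^'n::finite) \<Rightarrow> (nat \<Rightarrow> int) \<Rightarrow> nat \<Rightarrow> int^'n \<Rightarrow> int" where
  "ell_int \<nu> lam r m = (\<Sum>i\<in>UNIV. \<nu> r $ i * m $ i) - lam r"

text \<open>The canonical section \<open>\<sigma>\<^sup>m\<close> of the line bundle of \<open>P\<close>, read in its trivialisation over
  \<open>V\<^sub>q\<close>. On the open orbit this is \<open>w\<close> to the power \<open>m - q\<close>, so the transition function from
  \<open>q\<close> to \<open>q'\<close> is \<open>w\<close> to the power \<open>q - q'\<close>, the same for all \<open>m\<close>.\<close>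

definition sigma :: "nat \<Rightarrow> (nat \<Rightarrow> int^'n::finite) \<Rightarrow> (nat \<Rightarrow> int) \<Rightarrow> (real^'n \<Rightarrow> real) \<Rightarrow>
    int^'n \<Rightarrow> ('n \<Rightarrow> nat) \<Rightarrow> ((real^'n) \<times> (real^'n)) set \<Rightarrow> complex" where
  "sigma d \<nu> lam g m \<rho> p = (\<Prod>j\<in>UNIV. w_chart d \<nu> lam g \<rho> p $ j powi ell_int \<nu> lam (\<rho> j) m)"

text \<open>A section vanishes at \<open>p\<close> if its representative in a trivialisation around \<open>p\<close> does;
  since the trivialisations differ by nowhere vanishing factors, any one of them will do.\<close>

definition Y_s :: "nat \<Rightarrow> (nat \<Rightarrow> int^'n::finite) \<Rightarrow> (nat \<Rightarrow> int) \<Rightarrow>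
    (real^'n \<Rightarrow> real) \<Rightarrow> (real^'n \<Rightarrow> real) \<Rightarrow> (int^'n \<Rightarrow> complex) \<Rightarrow> (int^'n \<Rightarrow> real) \<Rightarrow>
    real \<Rightarrow> ((real^'n) \<times> (real^'n)) set set" where
  "Y_s d \<nu> lam \<phi> \<psi> a v s =
     {p \<in> X_P d \<nu> lam. \<exists>q \<rho>. vertex_ordering d \<nu> lam q \<rho> \<and> p \<in> V_q d \<nu> lam q \<and>
        (\<Sum>m\<in>lattice_points (polytope_of d \<nu> lam).
            a m * complex_of_real (exp (- s * v m)) *
            sigma d \<nu> lam (g_s d \<nu> lam \<phi> \<psi> s) m \<rho> p) = 0}"

section \<open>Hausdorff limits\<close>

definition hausdorff_dist :: "'a::metric_space set \<Rightarrow> 'a set \<Rightarrow> real" where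
  "hausdorff_dist A B = max (SUP a\<in>A. infdist a B) (SUP b\<in>B. infdist b A)"

definition hausdorff_limit :: "'a::metric_space set \<Rightarrow> (real \<Rightarrow> 'a set) \<Rightarrow> 'a set \<Rightarrow> bool" where
  "hausdorff_limit P F A \<longleftrightarrow>
     closed A \<and> A \<subseteq> P \<and> A \<noteq> {} \<and>
     (\<forall>\<^sub>F s in at_top. closed (F s) \<and> F s \<subseteq> P \<and> F s \<noteq> {}) \<and>
     ((\<lambda>s. hausdorff_dist (F s) A) \<longlongrightarrow> 0) at_top"

section \<open>Tropical amoeba and projection\<close>

abbreviation legendre :: "(real^'n::finite \<Rightarrow> real) \<Rightarrow> real^'n \<Rightarrow> real^'n" where
  "legendre \<equiv> gradient"

definition tropical_amoeba :: "(real^'n::finite) set \<Rightarrow> (int^'n \<Rightarrow> real) \<Rightarrow> (real^'n) set" where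
  "tropical_amoeba P v =
     {u. \<not> (\<lambda>u. Max ((\<lambda>m. real_vec m \<bullet> u - v m) ` lattice_points P)) differentiable (at u)}"

definition cone_at :: "(real^'n::finite) set \<Rightarrow> real^'n \<Rightarrow> (real^'n) set" where
  "cone_at P p = {c. \<forall>p'\<in>P. c \<bullet> (p - p') \<ge> 0}"

definition proj :: "(real^'n::finite) set \<Rightarrow> (real^'n \<Rightarrow> real) \<Rightarrow> real^'n \<Rightarrow> real^'n" where
  "proj P \<psi> u = (THE y. \<exists>p\<in>P. y = legendre \<psi> p \<and> (\<exists>c\<in>cone_at P p. u = legendre \<psi> p + c))"

end

theory Submission
  imports Defs "HOL-Complex_Analysis.Great_Picard" "HOL-Computational_Algebra.Fundamental_Theorem_Algebra"
begin

text \<open>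
  Put \<open>u = (\<partial>g\<^sub>s/\<partial>x) / s\<close> on the interior of \<open>P\<close>. On the open orbit the section cutting out the
  hypersurface is, up to a nowhere vanishing factor, the exponential sum of the terms
  \<open>a\<^sub>m exp (s (m \<bullet> u - v m) + \<i> m \<bullet> \<theta>)\<close>. So its zeros lie over those \<open>u\<close> at which two of the numbers
  \<open>m \<bullet> u - v m\<close> are almost maximal, and as \<open>s\<close> grows these \<open>u\<close> fill out the tropical amoeba. What
  remains is to go back from \<open>u\<close> to \<open>x\<close>, uniformly up to the boundary of \<open>P\<close>.

  Here convexity replaces any local analysis near the faces. Since \<open>g\<^sub>s\<close> is convex, \<open>x\<close> maximises
  \<open>u \<bullet> y - \<psi> y - (g\<^sub>P + \<phi>) y / s\<close> over \<open>y \<in> P\<close>. The last summand is bounded by a constant over \<open>s\<close>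
  on the whole of \<open>P\<close>, and \<open>\<psi>\<close> is strongly convex, so \<open>x\<close> is within \<open>O(s\<^sup>-\<^sup>1\<^sup>/\<^sup>2)\<close> of the point
  \<open>maximiser u\<close> where \<open>u \<bullet> y - \<psi> y\<close> is largest (\<open>maximiser_rescaled_log\<close>). The first-order condition at
  that point says that \<open>u\<close> is the sum of its Legendre transform and an element of the normal cone, so the
  Legendre transform of \<open>maximiser u\<close> is the projection of \<open>u\<close> (\<open>proj_eq\<close>). The map \<open>maximiser\<close> is Lipschitz.
  The limit is therefore the image of the tropical amoeba under \<open>maximiser\<close>.

  Four points need an argument of their own.

  \<^item> The limit set is closed although the tropical amoeba is unbounded. The tropical amoeba is a finite union
    of polyhedra, normal cones are generated by the outward normals of the active facets, and the sum of a polyhedron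
    and such a cone is again a polyhedron, by Fourier--Motzkin elimination (\<open>closed_maximiser_image\<close>).
  \<^item> Zeros over the boundary of \<open>P\<close>. The monomial sections extend continuously to \<open>P \<times> \<real>\<^sup>n\<close>, and in a vertex
    chart the section of the vertex does not vanish. At interior points close to a zero the full sum is thus small
    compared with a single term, which is enough for two terms to be almost maximal (\<open>zero_imp_near_tie\<close>).
  \<^item> Every point of the limit is attained. At a point \<open>u\<close> of the tropical amoeba choose an integral
    direction that separates the exponents. Along it the exponential sum is a polynomial in one variable which
    converges, after rescaling, to one with at least two terms. The limit has a nonzero root, and by Hurwitz' theorem
    this root persists; it moves \<open>u\<close> by only \<open>O(1/s)\<close> (\<open>limit_near_amoeba\<close>).
  \<^item> Every \<open>u\<close> comes from some \<open>x\<close>, because the infinite slope of \<open>t ln t\<close> at \<open>0\<close> keeps the maximum away from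
    the boundary of \<open>P\<close> (\<open>rescaled_log_surj\<close>).
\<close>

section \<open>Convexity from positive Hessians\<close>

lemma frechet_derivative_eq_gradient:
  fixes f :: "real^'n::finite \<Rightarrow> real"
  assumes "f differentiable (at x)"
  shows "frechet_derivative f (at x) w = gradient f x \<bullet> w"
proof -
  have lin: "linear (frechet_derivative f (at x))"
    by (rule linear_frechet_derivative [OF assms])
  have "frechet_derivative f (at x) w = frechet_derivative f (at x) (\<Sum>i\<in>UNIV. (w $ i) *\<^sub>R axis i 1)"
    by (simp add: basis_expansion flip: scalar_mult_eq_scaleR)
  also have "\<dots> = (\<Sum>i\<in>UNIV. (w $ i) * partial i f x)"
    by (simp add: linear_sum [OF lin] linear_cmul [OF lin] partial_def)
  also have "\<dots> = gradient f x \<bullet> w"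
    by (simp add: gradient_def inner_vec_def mult.commute)
  finally show ?thesis .
qed

lemma has_derivative_gradient:
  fixes f :: "real^'n::finite \<Rightarrow> real"
  assumes "f differentiable (at x)"
  shows "(f has_derivative (\<lambda>w. gradient f x \<bullet> w)) (at x)"
proof -
  have "frechet_derivative f (at x) = (\<lambda>w. gradient f x \<bullet> w)"
    by (rule ext) (rule frechet_derivative_eq_gradient [OF assms])
  then show ?thesis
    using frechet_derivative_works [THEN iffD1, OF assms] by simp
qed

lemma gradient_unique:
  fixes f :: "real^'n::finite \<Rightarrow> real"
  assumes "(f has_derivative (\<lambda>w. z \<bullet> w)) (at x)"
  shows "gradient f x = z"
proof -
  have "partial i f x = z $ i" for i
    using fun_cong [OF frechet_derivative_at [OF assms], of "axis i 1"]
    by (simp add: partial_def inner_axis)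
  then show ?thesis by (simp add: gradient_def vec_eq_iff)
qed

lemma has_real_derivative_along_line:
  fixes f :: "real^'n::finite \<Rightarrow> real"
  assumes "f differentiable (at (x + t *\<^sub>R w))"
  shows "((\<lambda>t. f (x + t *\<^sub>R w)) has_real_derivative gradient f (x + t *\<^sub>R w) \<bullet> w) (at t)"
proof -
  have "((\<lambda>t. f (x + t *\<^sub>R w)) has_derivative (\<lambda>h. gradient f (x + t *\<^sub>R w) \<bullet> (h *\<^sub>R w))) (at t)"
    by (rule has_derivative_compose [where g = f and f = "\<lambda>t. x + t *\<^sub>R w", OF _ has_derivative_gradient[OF assms]])
       (auto intro!: derivative_eq_intros)
  then show ?thesis
    by (simp add: has_field_derivative_def mult.commute[of _ "gradient f _ \<bullet> w"])
qed

text \<open>Along the segment from \<open>x\<close> to \<open>y\<close> the second derivative of \<open>f\<close> is at least \<open>c |y - x|\<^sup>2\<close>; integrating twice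
  gives the bound. Differentiability is required at the points of \<open>S\<close>, which need not be open, so that the
  lemma covers both \<open>\<psi>\<close> on the closed polytope and \<open>g\<^sub>P + \<phi>\<close> on its interior.\<close>

lemma second_order_lower_bound:
  fixes f :: "real^'n::finite \<Rightarrow> real"
  assumes S: "convex S" "x \<in> S" "y \<in> S"
    and f: "\<And>z. z \<in> S \<Longrightarrow> f differentiable (at z)"
    and pf: "\<And>z j. z \<in> S \<Longrightarrow> partial j f differentiable (at z)"
    and H: "\<And>z w. z \<in> S \<Longrightarrow> c * (w \<bullet> w) \<le> w \<bullet> (hessian f z *v w)"
  shows "f x + gradient f x \<bullet> (y - x) + c / 2 * ((y - x) \<bullet> (y - x)) \<le> f y"
proof -
  define w where "w = y - x"
  have inS: "x + t *\<^sub>R w \<in> S" if "0 \<le> t" "t \<le> 1" for t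
  proof -
    have "x + t *\<^sub>R w = (1 - t) *\<^sub>R x + t *\<^sub>R y" by (simp add: w_def algebra_simps)
    then show ?thesis using S that by (simp add: convexD_alt)
  qed
  define D where "D t = gradient f (x + t *\<^sub>R w) \<bullet> w" for t
  have D1: "((\<lambda>t. f (x + t *\<^sub>R w)) has_real_derivative D t) (at t)" if "0 \<le> t" "t \<le> 1" for t
    unfolding D_def by (rule has_real_derivative_along_line[OF f[OF inS[OF that]]])
  have D2: "(D has_real_derivative w \<bullet> (hessian f (x + t *\<^sub>R w) *v w)) (at t)"
    if "0 \<le> t" "t \<le> 1" for t
  proof -
    have "D = (\<lambda>t. \<Sum>j\<in>UNIV. partial j f (x + t *\<^sub>R w) * w $ j)"
      by (auto simp: D_def gradient_def inner_vec_def)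
    moreover have "((\<lambda>t. \<Sum>j\<in>UNIV. partial j f (x + t *\<^sub>R w) * w $ j) has_real_derivative
        (\<Sum>j\<in>UNIV. (gradient (partial j f) (x + t *\<^sub>R w) \<bullet> w) * w $ j)) (at t)"
      by (intro DERIV_sum DERIV_cmult_right has_real_derivative_along_line pf inS that)
    moreover have "(\<Sum>j\<in>UNIV. (gradient (partial j f) (x + t *\<^sub>R w) \<bullet> w) * w $ j)
       = w \<bullet> (hessian f (x + t *\<^sub>R w) *v w)"
      unfolding gradient_def hessian_def inner_vec_def matrix_vector_mult_def
      by (simp add: sum_distrib_left sum_distrib_right, subst sum.swap) (simp add: mult_ac)
    ultimately show ?thesis by simp
  qed
  define C where "C = c * (w \<bullet> w)"
  have le: "D 0 + C * t \<le> D t" if "0 \<le> t" "t \<le> 1" for t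
  proof -
    have "D 0 - C * 0 \<le> D t - C * t"
    proof (rule DERIV_nonneg_imp_nondecreasing[OF that(1)])
      fix u assume u: "0 \<le> u" "u \<le> t"
      then have "u \<le> 1" using that by simp
      then show "\<exists>y. ((\<lambda>t. D t - C * t) has_real_derivative y) (at u) \<and> 0 \<le> y"
        using H[OF inS[OF u(1)], of w] unfolding C_def
        by (intro exI[of _ "w \<bullet> (hessian f (x + u *\<^sub>R w) *v w) - c * (w \<bullet> w)"])
           (auto intro!: derivative_eq_intros D2 u)
    qed
    then show ?thesis by simp
  qed
  have "f (x + 0 *\<^sub>R w) - D 0 * 0 - C / 2 * 0\<^sup>2 \<le> f (x + 1 *\<^sub>R w) - D 0 * 1 - C / 2 * 1\<^sup>2"
  proof (rule DERIV_nonneg_imp_nondecreasing[where f = "\<lambda>t. f (x + t *\<^sub>R w) - D 0 * t - C / 2 * t\<^sup>2"])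
    fix u :: real assume u: "0 \<le> u" "u \<le> 1"
    show "\<exists>y. ((\<lambda>t. f (x + t *\<^sub>R w) - D 0 * t - C / 2 * t\<^sup>2) has_real_derivative y) (at u) \<and> 0 \<le> y"
      using le[OF u]
      by (intro exI[of _ "D u - D 0 - C * u"]) (auto intro!: derivative_eq_intros D1 u)
  qed simp
  then show ?thesis
    by (simp add: D_def C_def w_def)
qed

lemma smooth_on_closedD:
  assumes "smooth_on_closed P f" "x \<in> P"
  shows "f differentiable (at x)" "partial j f differentiable (at x)"
proof -
  obtain U where U: "open U" "P \<subseteq> U" "\<And>k. C_k k U f"
    using assms(1) unfolding smooth_on_closed_def by blast
  have "x \<in> U" using U(2) assms(2) by blast
  moreover have "C_k (Suc (Suc 0)) U f" by (rule U(3))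
  then have "f differentiable_on U" "partial j f differentiable_on U" by simp_all
  ultimately show "f differentiable (at x)" "partial j f differentiable (at x)"
    using U(1) by (simp_all add: differentiable_on_eq_differentiable_at)
qed

lemma smooth_on_closed_continuous_partial2:
  assumes "smooth_on_closed P f"
  shows "continuous_on P (partial i (partial j f))"
proof -
  obtain U where U: "P \<subseteq> U" "\<And>k. C_k k U f"
    using assms unfolding smooth_on_closed_def by blast
  have "C_k (Suc (Suc 0)) U f" by (rule U(2))
  then have "continuous_on U (partial i (partial j f))" by simp
  then show ?thesis using U(1) by (rule continuous_on_subset)
qed

text \<open>The quadratic form of the Hessian is continuous on the compact set of pairs of a point of \<open>P\<close> and a unit
  vector; its minimum there is the constant.\<close>

lemma hessian_uniformly_positive:
  fixes f :: "real^'n::finite \<Rightarrow> real"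
  assumes "compact P" "smooth_on_closed P f" "\<And>x. x \<in> P \<Longrightarrow> positive_definite (hessian f x)"
  obtains c where "c > 0" "\<And>x w. x \<in> P \<Longrightarrow> c * (w \<bullet> w) \<le> w \<bullet> (hessian f x *v w)"
proof (cases "P = {}")
  case True
  then show thesis by (intro that[of 1]) auto
next
  case False
  define K where "K = P \<times> sphere (0::real^'n) 1"
  define q where "q = (\<lambda>z. snd z \<bullet> (hessian f (fst z) *v snd z))"
  have q_eq: "q = (\<lambda>z. \<Sum>i\<in>UNIV. snd z $ i * (\<Sum>j\<in>UNIV. partial i (partial j f) (fst z) * snd z $ j))"
    by (simp add: q_def inner_vec_def matrix_vector_mult_def hessian_def)
  have "continuous_on K (\<lambda>z. partial i (partial j f) (fst z))" for i j
    by (rule continuous_on_compose2[OF smooth_on_closed_continuous_partial2[OF assms(2)]])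
       (auto simp: K_def intro: continuous_intros)
  then have "continuous_on K q"
    unfolding q_eq by (intro continuous_intros)
  moreover have "compact K" unfolding K_def using assms(1) by (intro compact_Times) auto
  moreover have "K \<noteq> {}" using False by (simp add: K_def)
  ultimately obtain z where z: "z \<in> K" "\<And>z'. z' \<in> K \<Longrightarrow> q z \<le> q z'"
    using continuous_attains_inf by metis
  have "q z > 0"
    using z(1) assms(3)[of "fst z"] unfolding q_def K_def positive_definite_def
    by (metis mem_Times_iff norm_zero zero_neq_one mem_sphere_0)
  moreover have "q z * (w \<bullet> w) \<le> w \<bullet> (hessian f x *v w)" if "x \<in> P" for x w
  proof (cases "w = 0")
    case False
    define e where "e = w /\<^sub>R norm w"
    have w: "w = norm w *\<^sub>R e" and "norm e = 1" using False by (auto simp: e_def)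
    then have "q z \<le> e \<bullet> (hessian f x *v e)"
      using z(2)[of "(x, e)"] that by (simp add: K_def q_def)
    then have "q z * (norm w)\<^sup>2 \<le> (norm w)\<^sup>2 * (e \<bullet> (hessian f x *v e))"
      by (subst mult.commute) (rule mult_left_mono, simp_all)
    also have "\<dots> = w \<bullet> (hessian f x *v w)"
    proof -
      have "hessian f x *v w = norm w *\<^sub>R (hessian f x *v e)"
        by (subst w) (rule matrix_vector_mult_scaleR)
      then have "w \<bullet> (hessian f x *v w) = norm w * (w \<bullet> (hessian f x *v e))"
        by simp
      also have "w \<bullet> (hessian f x *v e) = norm w * (e \<bullet> (hessian f x *v e))"
        by (subst (1) w) simp
      finally show ?thesis by (simp add: power2_eq_square)
    qed
    finally show ?thesis by (simp add: power2_norm_eq_inner)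
  qed simp
  ultimately show thesis by (rule that)
qed

section \<open>Maximisers of a linear form minus a strongly convex potential\<close>

locale strongly_convex_potential =
  fixes P :: "(real^'n::finite) set" and \<psi> :: "real^'n \<Rightarrow> real" and c :: real
  assumes compact_domain: "compact P" and convex_domain: "convex P" and domain_nonempty: "P \<noteq> {}"
    and differentiable_\<psi>: "x \<in> P \<Longrightarrow> \<psi> differentiable (at x)"
    and continuous_gradient_\<psi>: "continuous_on P (gradient \<psi>)"
    and c_pos: "c > 0"
    and strong_convexity: "x \<in> P \<Longrightarrow> y \<in> P \<Longrightarrow>
      \<psi> x + gradient \<psi> x \<bullet> (y - x) + c / 2 * (norm (y - x))\<^sup>2 \<le> \<psi> y"
begin

lemma continuous_\<psi>: "continuous_on P \<psi>"
  by (rule differentiable_imp_continuous_on) (simp add: differentiable_at_imp_differentiable_on differentiable_\<psi>)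

lemma gradient_\<psi>_monotone:
  assumes "x \<in> P" "y \<in> P"
  shows "c * (norm (x - y))\<^sup>2 \<le> (gradient \<psi> x - gradient \<psi> y) \<bullet> (x - y)"
  using strong_convexity[OF assms] strong_convexity[OF assms(2,1)]
  by (simp add: norm_minus_commute[of y x] inner_diff_left inner_diff_right)

text \<open>A point where \<open>u \<bullet> y - \<psi> y\<close> is largest on \<open>P\<close> will do: if \<open>u - gradient \<psi> y\<close> were not in the normal cone, moving
  into \<open>P\<close> along some segment would increase the value.\<close>

lemma exists_cone_decomposition: "\<exists>y\<in>P. u - gradient \<psi> y \<in> cone_at P y"
proof -
  have "continuous_on P (\<lambda>y. u \<bullet> y - \<psi> y)"
    by (intro continuous_intros continuous_\<psi>)
  from continuous_attains_sup[OF compact_domain domain_nonempty this]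
  obtain y where y: "y \<in> P" "\<And>z. z \<in> P \<Longrightarrow> u \<bullet> z - \<psi> z \<le> u \<bullet> y - \<psi> y"
    by blast
  have "0 \<le> (u - gradient \<psi> y) \<bullet> (y - z)" if "z \<in> P" for z
  proof (rule ccontr)
    assume "\<not> ?thesis"
    then have pos: "0 < (u - gradient \<psi> y) \<bullet> (z - y)"
      by (simp add: inner_diff_right)
    have "((\<lambda>t. u \<bullet> (y + t *\<^sub>R (z - y)) - \<psi> (y + t *\<^sub>R (z - y))) has_real_derivative
        u \<bullet> (z - y) - gradient \<psi> (y + 0 *\<^sub>R (z - y)) \<bullet> (z - y)) (at 0)"
      by (intro DERIV_diff has_real_derivative_along_line)
         (auto intro!: derivative_eq_intros differentiable_\<psi> y(1) simp: inner_add_right)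
    from DERIV_pos_inc_right[OF this] pos
    obtain d where d: "d > 0" "\<And>t. 0 < t \<Longrightarrow> t < d \<Longrightarrow>
        u \<bullet> y - \<psi> y < u \<bullet> (y + t *\<^sub>R (z - y)) - \<psi> (y + t *\<^sub>R (z - y))"
      by (auto simp: inner_diff_left)
    define t where "t = min (d / 2) 1"
    have t: "0 < t" "t < d" "t \<le> 1" using d(1) by (auto simp: t_def)
    have "y + t *\<^sub>R (z - y) = (1 - t) *\<^sub>R y + t *\<^sub>R z" by (simp add: algebra_simps)
    then have "y + t *\<^sub>R (z - y) \<in> P"
      using convex_domain y(1) that t by (simp add: convexD_alt)
    from y(2)[OF this] d(2)[OF t(1,2)] show False by simp
  qed
  then show ?thesis using y(1) by (auto simp: cone_at_def)
qed

text \<open>The normal cone condition makes the assignment \<open>u \<mapsto> y\<close> monotone, and strong monotonicity of the gradient turns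
  this into a Lipschitz bound. For \<open>u = u'\<close> it gives uniqueness of the decomposition.\<close>

lemma cone_decomposition_lipschitz:
  assumes "y \<in> P" "u - gradient \<psi> y \<in> cone_at P y"
    and "y' \<in> P" "u' - gradient \<psi> y' \<in> cone_at P y'"
  shows "c * norm (y - y') \<le> norm (u - u')"
proof -
  have "0 \<le> (u - gradient \<psi> y) \<bullet> (y - y')" "0 \<le> (u' - gradient \<psi> y') \<bullet> (y' - y)"
    using assms by (auto simp: cone_at_def)
  then have "(gradient \<psi> y - gradient \<psi> y') \<bullet> (y - y') \<le> (u - u') \<bullet> (y - y')"
    by (simp add: inner_diff_left inner_diff_right)
  also have "\<dots> \<le> norm (u - u') * norm (y - y')"
    by (rule norm_cauchy_schwarz)
  finally have "c * (norm (y - y'))\<^sup>2 \<le> norm (u - u') * norm (y - y')"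
    using gradient_\<psi>_monotone[OF assms(1,3)] by linarith
  then have "(c * norm (y - y')) * norm (y - y') \<le> norm (u - u') * norm (y - y')"
    by (simp add: power2_eq_square mult.assoc)
  then show ?thesis
    by (cases "y = y'") (auto simp: mult_le_cancel_right)
qed

text \<open>The maximiser of \<open>u \<bullet> y - \<psi> y\<close> over \<open>P\<close>, encoded by the first-order condition, which for a strongly convex \<open>\<psi>\<close>
  determines it.\<close>

definition maximiser :: "real^'n \<Rightarrow> real^'n" where
  "maximiser u = (SOME y. y \<in> P \<and> u - gradient \<psi> y \<in> cone_at P y)"

lemma maximiser: "maximiser u \<in> P" "u - gradient \<psi> (maximiser u) \<in> cone_at P (maximiser u)"
proof -
  have "\<exists>y. y \<in> P \<and> u - gradient \<psi> y \<in> cone_at P y"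
    using exists_cone_decomposition[of u] by blast
  then have "maximiser u \<in> P \<and> u - gradient \<psi> (maximiser u) \<in> cone_at P (maximiser u)"
    unfolding maximiser_def by (rule someI_ex)
  then show "maximiser u \<in> P" "u - gradient \<psi> (maximiser u) \<in> cone_at P (maximiser u)"
    by simp_all
qed

lemma maximiser_lipschitz: "c * norm (maximiser u - maximiser u') \<le> norm (u - u')"
  by (intro cone_decomposition_lipschitz maximiser)

lemma maximiser_unique:
  assumes "y \<in> P" "u - gradient \<psi> y \<in> cone_at P y"
  shows "maximiser u = y"
  using cone_decomposition_lipschitz[OF maximiser assms(1,2), of u] c_pos
  by (simp add: mult_le_0_iff)

lemma dist_maximiser: "dist (maximiser u) (maximiser u') \<le> dist u u' / c"
  using maximiser_lipschitz[of u u'] c_pos by (simp add: dist_norm pos_le_divide_eq mult.commute)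

lemma proj_eq: "proj P \<psi> u = gradient \<psi> (maximiser u)"
  unfolding proj_def
proof (rule the_equality)
  show "\<exists>p\<in>P. gradient \<psi> (maximiser u) = gradient \<psi> p \<and> (\<exists>c\<in>cone_at P p. u = gradient \<psi> p + c)"
    using maximiser[of u] by (intro bexI[of _ "maximiser u"] conjI bexI[of _ "u - gradient \<psi> (maximiser u)"]) auto
next
  fix y assume "\<exists>p\<in>P. y = gradient \<psi> p \<and> (\<exists>c\<in>cone_at P p. u = gradient \<psi> p + c)"
  then obtain p e where p: "p \<in> P" "y = gradient \<psi> p" "e \<in> cone_at P p" "u = gradient \<psi> p + e"
    by blast
  then have "maximiser u = p"
    by (intro maximiser_unique) simp_all
  with p show "y = gradient \<psi> (maximiser u)" by simp
qed

text \<open>The hypothesis \<open>sub\<close> says that \<open>x\<close> maximises \<open>u \<bullet> y - (\<psi> y + g y / s)\<close>. Comparing this at \<open>maximiser u\<close> with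
  the strong maximality of \<open>maximiser u\<close> for the unperturbed function, the terms in \<open>u\<close> and \<open>\<psi>\<close> cancel, and
  only the oscillation of \<open>g / s\<close> is left. The bound does not depend on \<open>u\<close>, which is what makes all later
  estimates uniform up to the boundary of \<open>P\<close>.\<close>

lemma dist_maximiser_perturbed:
  assumes x: "x \<in> P" and g: "\<And>y. y \<in> P \<Longrightarrow> \<bar>g y\<bar> \<le> K" and s: "s > 0"
    and sub: "\<And>y. y \<in> P \<Longrightarrow> \<psi> x + g x / s + u \<bullet> (y - x) \<le> \<psi> y + g y / s"
  shows "(dist x (maximiser u))\<^sup>2 \<le> 4 * K / (c * s)"
proof -
  define y where "y = maximiser u"
  have y: "y \<in> P" "u - gradient \<psi> y \<in> cone_at P y"
    using maximiser unfolding y_def by auto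
  have "0 \<le> (u - gradient \<psi> y) \<bullet> (y - x)"
    using y x by (auto simp: cone_at_def)
  then have "\<psi> y + u \<bullet> (x - y) + c / 2 * (norm (x - y))\<^sup>2 \<le> \<psi> x"
    using strong_convexity[OF y(1) x] by (simp add: inner_diff_left inner_diff_right)
  with sub[OF y(1)] have "c / 2 * (norm (x - y))\<^sup>2 \<le> g y / s - g x / s"
    unfolding inner_diff_right by linarith
  also have "\<dots> = (g y - g x) / s" by (simp add: diff_divide_distrib)
  also have "\<dots> \<le> (2 * K) / s"
    using g[OF x] g[OF y(1)] s by (intro divide_right_mono) linarith+
  finally show ?thesis
    using c_pos s unfolding y_def[symmetric] dist_norm by (simp add: field_simps)
qed

end

section \<open>Tropical amoebas\<close>

lemma inj_real_vec: "inj real_vec"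
  by (auto simp: inj_def real_vec_def vec_eq_iff)

lemma real_vec_diff: "real_vec (m - m') = real_vec m - real_vec m'"
  by (simp add: real_vec_def vec_eq_iff)

definition pairing :: "int^'n::finite \<Rightarrow> int^'n \<Rightarrow> int" where
  "pairing m m' = (\<Sum>i\<in>UNIV. m $ i * m' $ i)"

lemma of_int_pairing: "of_int (pairing m m') = real_vec m \<bullet> real_vec m'"
  by (simp add: pairing_def real_vec_def inner_vec_def)

lemma inner_real_vec_self_ge_1:
  assumes "m \<noteq> 0"
  shows "1 \<le> real_vec m \<bullet> real_vec m"
proof -
  obtain i where "m $ i \<noteq> 0" using assms by (auto simp: vec_eq_iff)
  then have "0 < m $ i * m $ i" by (auto simp: zero_less_mult_iff neq_iff)
  then have "1 \<le> m $ i * m $ i" by simp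
  also have "m $ i * m $ i \<le> (\<Sum>i\<in>UNIV. m $ i * m $ i)"
    by (rule member_le_sum) auto
  finally have "1 \<le> pairing m m" by (simp add: pairing_def)
  then show ?thesis
    unfolding of_int_pairing[symmetric] by linarith
qed

definition maximal_at :: "(int^'n::finite) set \<Rightarrow> (int^'n \<Rightarrow> real) \<Rightarrow> real^'n \<Rightarrow> int^'n \<Rightarrow> bool" where
  "maximal_at M v u m \<longleftrightarrow>
     m \<in> M \<and> (\<forall>m'\<in>M. real_vec m' \<bullet> u - v m' \<le> real_vec m \<bullet> u - v m)"

lemma maximal_at_imp_Max_eq:
  assumes "finite M" "maximal_at M v u m"
  shows "Max ((\<lambda>m. real_vec m \<bullet> u - v m) ` M) = real_vec m \<bullet> u - v m"
  using assms by (intro Max_eqI) (auto simp: maximal_at_def)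

lemma exists_maximal_at:
  assumes "finite M" "M \<noteq> {}"
  obtains m where "maximal_at M v u m"
proof -
  have "Max ((\<lambda>m. real_vec m \<bullet> u - v m) ` M) \<in> (\<lambda>m. real_vec m \<bullet> u - v m) ` M"
    using assms by (intro Max_in) auto
  then obtain m where "m \<in> M" "Max ((\<lambda>m. real_vec m \<bullet> u - v m) ` M) = real_vec m \<bullet> u - v m"
    by auto
  then have "maximal_at M v u m"
    using assms by (auto simp: maximal_at_def intro!: Max_ge simp flip: \<open>Max _ = _\<close>)
  then show thesis by (rule that)
qed

text \<open>The maximum minus one of its maximal affine functions is smallest at \<open>u\<close>, so its derivative vanishes there.
  Two distinct maximal exponents thus contradict differentiability.\<close>

lemma has_derivative_Max_at_maximal:
  assumes "finite M" "maximal_at M v u m"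
    and D: "((\<lambda>u. Max ((\<lambda>m. real_vec m \<bullet> u - v m) ` M)) has_derivative D) (at u)"
  shows "D = (\<lambda>w. real_vec m \<bullet> w)"
proof
  fix w
  define F where "F = (\<lambda>u. Max ((\<lambda>m. real_vec m \<bullet> u - v m) ` M))"
  define G where "G = (\<lambda>u. F u - (real_vec m \<bullet> u - v m))"
  have "(G has_derivative (\<lambda>w. D w - real_vec m \<bullet> w)) (at u)"
    unfolding G_def F_def by (auto intro!: derivative_eq_intros D)
  moreover have "G u \<le> G u'" for u'
  proof -
    have "G u = 0" unfolding G_def F_def maximal_at_imp_Max_eq[OF assms(1,2)] by simp
    moreover have "real_vec m \<bullet> u' - v m \<le> F u'"
      unfolding F_def using assms(1,2) by (intro Max_ge) (auto simp: maximal_at_def)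
    ultimately show ?thesis by (simp add: G_def)
  qed
  ultimately have "(\<lambda>w. D w - real_vec m \<bullet> w) = (\<lambda>w. 0)"
    by (intro differential_zero_maxmin[of u UNIV G]) auto
  then show "D w = real_vec m \<bullet> w"
    by (metis eq_iff_diff_eq_0)
qed

lemma mem_tropical_amoeba_iff:
  assumes fin: "finite (lattice_points P)" and ne: "lattice_points P \<noteq> {}"
  shows "u \<in> tropical_amoeba P v \<longleftrightarrow>
     (\<exists>m m'. m \<noteq> m' \<and> maximal_at (lattice_points P) v u m \<and> maximal_at (lattice_points P) v u m')"
proof
  define M where "M = lattice_points P"
  define F where "F = (\<lambda>u. Max ((\<lambda>m. real_vec m \<bullet> u - v m) ` M))"
  {
    assume *: "u \<in> tropical_amoeba P v"
    show "\<exists>m m'. m \<noteq> m' \<and> maximal_at (lattice_points P) v u m \<and> maximal_at (lattice_points P) v u m'"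
    proof (rule ccontr)
      assume unique: "\<not> ?thesis"
      obtain m where m: "maximal_at M v u m" using exists_maximal_at fin ne M_def by metis
      have "\<forall>\<^sub>F u' in nhds u. real_vec m' \<bullet> u' - v m' \<le> real_vec m \<bullet> u' - v m" if "m' \<in> M" for m'
      proof (cases "m' = m")
        case False
        then have "real_vec m' \<bullet> u - v m' < real_vec m \<bullet> u - v m"
          using unique m that unfolding M_def[symmetric] maximal_at_def
          by (smt (verit))
        moreover have "((\<lambda>u'. (real_vec m \<bullet> u' - v m) - (real_vec m' \<bullet> u' - v m')) \<longlongrightarrow>
            (real_vec m \<bullet> u - v m) - (real_vec m' \<bullet> u - v m')) (nhds u)"
          by (intro tendsto_intros filterlim_ident)
        ultimately have "\<forall>\<^sub>F u' in nhds u. 0 < (real_vec m \<bullet> u' - v m) - (real_vec m' \<bullet> u' - v m')"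
          by (intro order_tendstoD) auto
        then show ?thesis by eventually_elim simp
      qed simp
      then have "\<forall>\<^sub>F u' in nhds u. \<forall>m'\<in>M. real_vec m' \<bullet> u' - v m' \<le> real_vec m \<bullet> u' - v m"
        using fin by (intro eventually_ball_finite) (auto simp: M_def)
      then have "\<forall>\<^sub>F u' in nhds u. F u' = real_vec m \<bullet> u' - v m"
        unfolding F_def
        by eventually_elim (rule maximal_at_imp_Max_eq, use fin m in \<open>auto simp: M_def maximal_at_def\<close>)
      then obtain S where S: "open S" "u \<in> S" "\<And>u'. u' \<in> S \<Longrightarrow> F u' = real_vec m \<bullet> u' - v m"
        unfolding eventually_nhds by blast
      have "((\<lambda>u'. real_vec m \<bullet> u' - v m) has_derivative (\<lambda>w. real_vec m \<bullet> w)) (at u)"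
        by (auto intro!: derivative_eq_intros)
      then have "(F has_derivative (\<lambda>w. real_vec m \<bullet> w)) (at u)"
        by (rule has_derivative_transform_within_open[OF _ S(1,2)]) (simp add: S(3))
      then show False
        using * unfolding tropical_amoeba_def F_def M_def differentiable_def by blast
    qed
  }
  {
    assume "\<exists>m m'. m \<noteq> m' \<and> maximal_at (lattice_points P) v u m \<and> maximal_at (lattice_points P) v u m'"
    then obtain m m' where m: "m \<noteq> m'" "maximal_at M v u m" "maximal_at M v u m'"
      by (auto simp: M_def)
    have "False" if diff: "F differentiable (at u)"
    proof -
      obtain D where D: "(F has_derivative D) (at u)"
        using diff by (auto simp: differentiable_def)
      have "D = (\<lambda>w. real_vec m \<bullet> w)" "D = (\<lambda>w. real_vec m' \<bullet> w)"
        using has_derivative_Max_at_maximal[OF _ _ D[unfolded F_def]] m fin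
        by (auto simp: M_def)
      then have "real_vec m \<bullet> w = real_vec m' \<bullet> w" for w by metis
      then have "real_vec m = real_vec m'" by (metis vector_eq_rdot)
      then show False using m(1) inj_real_vec by (auto dest: injD)
    qed
    then show "u \<in> tropical_amoeba P v"
      by (auto simp: tropical_amoeba_def F_def M_def)
  }
qed

text \<open>Moving from \<open>u\<close> in the direction \<open>m' - m\<close> raises the term of \<open>m'\<close> relative to that of \<open>m\<close> at the rate
  \<open>|m' - m|\<^sup>2 \<ge> 1\<close>. After time \<open>\<epsilon>\<close> the exponent \<open>m\<close> no longer beats all others strictly, so there is a
  tie before that.\<close>

lemma near_tie_imp_near_tropical:
  assumes fin: "finite M" and m: "maximal_at M v u m" and m': "m' \<in> M" "m' \<noteq> m"
    and gap: "(real_vec m \<bullet> u - v m) - (real_vec m' \<bullet> u - v m') \<le> \<epsilon>"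
  obtains u' m1 m2 where "m1 \<noteq> m2" "maximal_at M v u' m1" "maximal_at M v u' m2"
    "dist u u' \<le> \<epsilon> * norm (real_vec m' - real_vec m)"
proof -
  define w where "w = real_vec m' - real_vec m"
  define h where "h = (\<lambda>k u. real_vec k \<bullet> u - v k)"
  define N where "N = M - {m}"
  \<comment> \<open>The lead of the best competitor over \<open>m\<close>; the first tie is a zero of \<open>G\<close>.\<close>
  define G where "G t = Max ((\<lambda>k. h k (u + t *\<^sub>R w)) ` N) - h m (u + t *\<^sub>R w)" for t
  have N: "finite N" "N \<noteq> {}" using fin m' by (auto simp: N_def)
  have cont: "continuous_on {0..\<epsilon>} G"
  proof -
    have "continuous_on {0..\<epsilon>} (\<lambda>t. Max ((\<lambda>k. h k (u + t *\<^sub>R w)) ` K))" if "finite K" "K \<noteq> {}" for K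
      using that
    proof (induction rule: finite_ne_induct)
      case (insert k K)
      then have "(\<lambda>t. Max ((\<lambda>k. h k (u + t *\<^sub>R w)) ` insert k K)) =
          (\<lambda>t. max (h k (u + t *\<^sub>R w)) (Max ((\<lambda>k. h k (u + t *\<^sub>R w)) ` K)))"
        by simp
      then show ?case
        using insert.IH by (simp only:) (intro continuous_intros, auto simp: h_def intro!: continuous_intros)
    qed (auto simp: h_def intro!: continuous_intros)
    from this[OF N] show ?thesis
      unfolding G_def h_def by (intro continuous_intros) simp
  qed
  have eps: "0 \<le> \<epsilon>" using gap m m' by (auto simp: maximal_at_def) 
  have "G 0 \<le> 0"
    using m N unfolding G_def h_def by (auto simp: maximal_at_def N_def)
  moreover have "0 \<le> G \<epsilon>"
  proof -
    have "1 \<le> w \<bullet> w"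
      using inner_real_vec_self_ge_1[of "m' - m"] m'(2) by (simp add: w_def real_vec_diff)
    then have "\<epsilon> \<le> \<epsilon> * (w \<bullet> w)" using eps by (simp add: mult_le_cancel_left1)
    then have "h m (u + \<epsilon> *\<^sub>R w) \<le> h m' (u + \<epsilon> *\<^sub>R w)"
      using gap by (simp add: h_def w_def inner_add_right inner_diff_left inner_diff_right inner_commute algebra_simps)
    also have "\<dots> \<le> Max ((\<lambda>k. h k (u + \<epsilon> *\<^sub>R w)) ` N)"
      using N m' by (intro Max_ge) (auto simp: N_def)
    finally show ?thesis by (simp add: G_def)
  qed
  ultimately obtain t where t: "0 \<le> t" "t \<le> \<epsilon>" "G t = 0"
    using IVT'[of G 0 0 \<epsilon>] cont eps by blast
  define u' where "u' = u + t *\<^sub>R w"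
  have "Max ((\<lambda>k. h k u') ` N) \<in> (\<lambda>k. h k u') ` N" using N by (intro Max_in) auto
  then obtain k where k: "k \<in> N" "h k u' = h m u'"
    using t(3) by (auto simp: G_def u'_def)
  have le: "h k' u' \<le> h m u'" if "k' \<in> M" for k'
  proof (cases "k' = m")
    case False
    then have "h k' u' \<le> Max ((\<lambda>k. h k u') ` N)"
      using N that by (intro Max_ge) (auto simp: N_def)
    then show ?thesis using t(3) by (simp add: G_def u'_def)
  qed simp
  have "m \<in> M" using m by (simp add: maximal_at_def)
  then have "maximal_at M v u' m" "maximal_at M v u' k"
    using le k by (auto simp: maximal_at_def N_def h_def)
  moreover have "dist u u' \<le> \<epsilon> * norm w"
    using t by (simp add: u'_def dist_norm mult_right_mono)
  moreover have "k \<noteq> m" using k by (simp add: N_def)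
  ultimately show thesis using that w_def by metis
qed

lemma tropical_amoeba_nonempty:
  assumes "finite (lattice_points P)" "m \<in> lattice_points P" "m' \<in> lattice_points P" "m \<noteq> m'"
  shows "tropical_amoeba P v \<noteq> {}"
proof -
  obtain k where k: "maximal_at (lattice_points P) v 0 k"
    using exists_maximal_at[OF assms(1)] assms(2) by blast
  obtain k' where k': "k' \<in> lattice_points P" "k' \<noteq> k"
    using assms by metis
  from near_tie_imp_near_tropical[OF assms(1) k k' order_refl]
  obtain u m1 m2 where "m1 \<noteq> m2" "maximal_at (lattice_points P) v u m1" "maximal_at (lattice_points P) v u m2"
    by metis
  then show ?thesis
    using mem_tropical_amoeba_iff[OF assms(1)] assms(2) by blast
qed

section \<open>Adding a finitely generated cone to a polyhedron\<close>

text \<open>One step of Fourier--Motzkin elimination. Each inequality of \<open>S\<close> bounds \<open>t\<close> from above, bounds it from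
  below, or does not involve it; an admissible \<open>t\<close> exists if and only if every lower bound, including \<open>0\<close>, is at most
  every upper bound, and these conditions are again affine inequalities on \<open>x\<close>.\<close>

lemma polyhedron_Minkowski_ray:
  fixes S :: "'a::euclidean_space set"
  assumes "polyhedron S"
  shows "polyhedron {x. \<exists>t\<ge>0. x + t *\<^sub>R e \<in> S}"
proof -
  obtain H where H: "finite H" "S = \<Inter>H" "\<forall>h\<in>H. \<exists>a b. a \<noteq> 0 \<and> h = {x. a \<bullet> x \<le> b}"
    using assms unfolding polyhedron_def by auto
  from H(3) obtain a b where ab: "\<And>h. h \<in> H \<Longrightarrow> h = {x. a h \<bullet> x \<le> b h}"
    by metis
  have S: "x \<in> S \<longleftrightarrow> (\<forall>h\<in>H. a h \<bullet> x \<le> b h)" for x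
    unfolding H(2) using ab by auto
  define U where "U = {h \<in> H. a h \<bullet> e > 0}"
  define L where "L = {h \<in> H. a h \<bullet> e < 0}"
  define Z where "Z = {h \<in> H. a h \<bullet> e = 0}"
  \<comment> \<open>The value of \<open>t\<close> at which the inequality \<open>h\<close> becomes an equality.\<close>
  define up where "up h x = (b h - a h \<bullet> x) / (a h \<bullet> e)" for h x
  have fin: "finite U" "finite L" "finite Z" using H(1) by (auto simp: U_def L_def Z_def)
  have iff: "(\<exists>t\<ge>0. x + t *\<^sub>R e \<in> S) \<longleftrightarrow>
     (\<forall>h\<in>Z. a h \<bullet> x \<le> b h) \<and> (\<forall>h\<in>U. a h \<bullet> x \<le> b h) \<and> (\<forall>l\<in>L. \<forall>h\<in>U. up l x \<le> up h x)" for x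
  proof -
    have "a h \<bullet> (x + t *\<^sub>R e) \<le> b h \<longleftrightarrow>
        (if h \<in> U then t \<le> up h x else if h \<in> L then up h x \<le> t else a h \<bullet> x \<le> b h)"
      if "h \<in> H" for h t
      using that by (auto simp: U_def L_def up_def inner_add_right pos_le_divide_eq neg_divide_le_eq)
    then have "x + t *\<^sub>R e \<in> S \<longleftrightarrow>
        (\<forall>h\<in>U. t \<le> up h x) \<and> (\<forall>h\<in>L. up h x \<le> t) \<and> (\<forall>h\<in>Z. a h \<bullet> x \<le> b h)" for t
      unfolding S by (auto simp: U_def L_def Z_def)
    moreover have "(0 \<le> up h x) = (a h \<bullet> x \<le> b h)" if "h \<in> U" for h
      using that by (auto simp: U_def up_def zero_le_divide_iff)
    moreover have "(\<exists>t\<ge>0. (\<forall>h\<in>U. t \<le> up h x) \<and> (\<forall>h\<in>L. up h x \<le> t)) \<longleftrightarrow>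
       (\<forall>h\<in>U. 0 \<le> up h x) \<and> (\<forall>l\<in>L. \<forall>h\<in>U. up l x \<le> up h x)"
    proof
      assume R: "(\<forall>h\<in>U. 0 \<le> up h x) \<and> (\<forall>l\<in>L. \<forall>h\<in>U. up l x \<le> up h x)"
      define t where "t = Max (insert 0 ((\<lambda>l. up l x) ` L))"
      have "t \<in> insert 0 ((\<lambda>l. up l x) ` L)" unfolding t_def using fin by (intro Max_in) auto
      moreover have "\<And>y. y \<in> insert 0 ((\<lambda>l. up l x) ` L) \<Longrightarrow> y \<le> t"
        unfolding t_def using fin by (intro Max_ge) auto
      ultimately show "\<exists>t\<ge>0. (\<forall>h\<in>U. t \<le> up h x) \<and> (\<forall>h\<in>L. up h x \<le> t)"
        using R by (intro exI[of _ t]) auto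
    qed (meson order_trans)
    moreover have "(\<exists>t\<ge>0. x + t *\<^sub>R e \<in> S) \<longleftrightarrow> (\<forall>h\<in>Z. a h \<bullet> x \<le> b h) \<and>
        (\<exists>t\<ge>0. (\<forall>h\<in>U. t \<le> up h x) \<and> (\<forall>h\<in>L. up h x \<le> t))"
      by (auto simp: calculation(1))
    ultimately show ?thesis by simp
  qed
  have half: "polyhedron {x. up l x \<le> up h x}" for l h
  proof -
    have "{x. up l x \<le> up h x} =
        {x. (inverse (a h \<bullet> e) *\<^sub>R a h - inverse (a l \<bullet> e) *\<^sub>R a l) \<bullet> x \<le> b h / (a h \<bullet> e) - b l / (a l \<bullet> e)}"
      by (auto simp: up_def inner_diff_left diff_divide_distrib divide_inverse algebra_simps)
    then show ?thesis by (simp add: polyhedron_halfspace_le)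
  qed
  have "{x. \<exists>t\<ge>0. x + t *\<^sub>R e \<in> S} =
     \<Inter>((\<lambda>h. {x. a h \<bullet> x \<le> b h}) ` Z) \<inter> \<Inter>((\<lambda>h. {x. a h \<bullet> x \<le> b h}) ` U) \<inter>
     \<Inter>((\<lambda>(l, h). {x. up l x \<le> up h x}) ` (L \<times> U))"
    by (auto simp: iff)
  moreover have "polyhedron \<dots>"
    using fin half
    by (intro polyhedron_Int polyhedron_Inter) (auto simp: polyhedron_halfspace_le)
  ultimately show ?thesis by simp
qed

text \<open>Adding the generators one at a time. The point of this lemma is closedness of the sum, which for general
  closed convex sets may fail.\<close>

lemma polyhedron_Minkowski_cone:
  fixes S :: "'a::euclidean_space set"
  assumes "finite R" "polyhedron S"
  shows "polyhedron {x. \<exists>t. (\<forall>r\<in>R. 0 \<le> t r) \<and> x + (\<Sum>r\<in>R. t r *\<^sub>R e r) \<in> S}"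
  using assms
proof (induction R rule: finite_induct)
  case empty
  then show ?case by simp
next
  case (insert r R)
  have "{x. \<exists>t. (\<forall>r\<in>insert r R. 0 \<le> t r) \<and> x + (\<Sum>r\<in>insert r R. t r *\<^sub>R e r) \<in> S} =
     {x. \<exists>\<tau>\<ge>0. x + \<tau> *\<^sub>R e r \<in> {x. \<exists>t. (\<forall>r\<in>R. 0 \<le> t r) \<and> x + (\<Sum>r\<in>R. t r *\<^sub>R e r) \<in> S}}"
    (is "?L = ?R")
  proof (intro equalityI subsetI)
    fix x assume "x \<in> ?L"
    then show "x \<in> ?R"
      using insert.hyps by (auto simp: add.assoc)
  next
    fix x assume "x \<in> ?R"
    then obtain \<tau> t where t: "\<tau> \<ge> 0" "\<forall>r\<in>R. 0 \<le> t r" "x + \<tau> *\<^sub>R e r + (\<Sum>r\<in>R. t r *\<^sub>R e r) \<in> S"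
      by auto
    have "(\<Sum>i\<in>R. (t(r := \<tau>)) i *\<^sub>R e i) = (\<Sum>i\<in>R. t i *\<^sub>R e i)"
      using insert.hyps by (intro sum.cong) auto
    then show "x \<in> ?L"
      using insert.hyps t by (auto intro!: exI[of _ "t(r := \<tau>)"] simp: add.assoc)
  qed
  moreover have "polyhedron ?R"
    by (rule polyhedron_Minkowski_ray) (use insert in auto)
  ultimately show ?case by simp
qed

section \<open>Hausdorff limits\<close>

text \<open>Since \<open>A\<close> is compact, it suffices to approach each of its points separately: a finite net of \<open>A\<close> makes the
  last condition uniform.\<close>

lemma hausdorff_limitI:
  fixes A P :: "'a::metric_space set"
  assumes A: "compact A" "A \<subseteq> P" "A \<noteq> {}"
    and F: "\<And>s. s > 0 \<Longrightarrow> closed (F s)" "\<And>s. F s \<subseteq> P"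
    and upper: "\<And>e. e > 0 \<Longrightarrow> \<forall>\<^sub>F s in at_top. \<forall>x\<in>F s. infdist x A < e"
    and lower: "\<And>y e. y \<in> A \<Longrightarrow> e > 0 \<Longrightarrow> \<forall>\<^sub>F s in at_top. \<exists>x\<in>F s. dist x y < e"
  shows "hausdorff_limit P F A"
proof -
  have lower_unif: "\<forall>\<^sub>F s in at_top. \<forall>y\<in>A. infdist y (F s) \<le> e" if "e > 0" for e
  proof -
    have "A \<subseteq> (\<Union>y\<in>A. ball y (e / 2))" using that by auto
    then obtain N where N: "N \<subseteq> A" "finite N" "A \<subseteq> (\<Union>y\<in>N. ball y (e / 2))"
      using compactE_image[OF A(1), of A "\<lambda>y. ball y (e / 2)"] by auto
    have "\<forall>\<^sub>F s in at_top. \<forall>y\<in>N. \<exists>x\<in>F s. dist x y < e / 2"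
      using N(1,2) that by (intro eventually_ball_finite ballI lower) auto
    then show ?thesis
    proof eventually_elim
      case (elim s)
      show ?case
      proof
        fix y assume "y \<in> A"
        then obtain z where z: "z \<in> N" "dist z y < e / 2" using N by auto
        with elim obtain x where x: "x \<in> F s" "dist x z < e / 2" by auto
        have "infdist y (F s) \<le> dist y x" by (rule infdist_le[OF x(1)])
        also have "\<dots> \<le> dist y z + dist z x" by (rule dist_triangle)
        finally show "infdist y (F s) \<le> e" using x z by (simp add: dist_commute)
      qed
    qed
  qed
  have ne: "\<forall>\<^sub>F s in at_top. F s \<noteq> {}"
  proof -
    obtain y where "y \<in> A" using A by auto
    from lower[OF this, of 1] show ?thesis by (auto elim: eventually_mono)
  qed
  have "((\<lambda>s. hausdorff_dist (F s) A) \<longlongrightarrow> 0) at_top"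
  proof (rule tendstoI)
    fix e :: real assume e: "e > 0"
    then have "e / 2 > 0" by simp
    from upper[OF this] lower_unif[OF this] ne
    show "\<forall>\<^sub>F s in at_top. dist (hausdorff_dist (F s) A) 0 < e"
    proof eventually_elim
      case (elim s)
      have 1: "(SUP x\<in>F s. infdist x A) \<le> e / 2"
        using elim(1,3) by (intro cSUP_least) (auto intro: less_imp_le)
      have 2: "(SUP y\<in>A. infdist y (F s)) \<le> e / 2"
        using elim(2) A(3) by (intro cSUP_least) auto
      obtain x where x: "x \<in> F s" using elim by auto
      have "infdist x A \<le> (SUP x\<in>F s. infdist x A)"
        by (rule cSUP_upper[OF x]) (use elim(1) in \<open>auto intro!: bdd_aboveI[of _ "e/2"] dest: less_imp_le\<close>)
      then have "0 \<le> (SUP x\<in>F s. infdist x A)"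
        using infdist_nonneg[of x A] by linarith
      then show ?case
        using 1 2 e unfolding hausdorff_dist_def by (auto simp: dist_real_def)
    qed
  qed
  moreover have "\<forall>\<^sub>F s in at_top. closed (F s) \<and> F s \<subseteq> P \<and> F s \<noteq> {}"
    using ne eventually_gt_at_top[of 0] by eventually_elim (use F in auto)
  ultimately show ?thesis
    using A compact_imp_closed unfolding hausdorff_limit_def by blast
qed

section \<open>Roots of polynomials with varying coefficients\<close>

text \<open>A vector of distinct powers of an integer \<open>t\<close> turns the pairing with \<open>m\<close> into the value at \<open>t\<close> of a polynomial
  with the entries of \<open>m\<close> as coefficients; different \<open>m\<close> agree at finitely many \<open>t\<close> only.\<close>

lemma exists_separating_direction:
  fixes M :: "(int^'n::finite) set"
  assumes "finite M"
  obtains k :: "int^'n" where "inj_on (\<lambda>m. pairing m k) M"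
proof -
  obtain f :: "'n \<Rightarrow> nat" where f: "inj f"
    using ex_bij_betw_finite_nat[of "UNIV :: 'n set"] by (auto simp: bij_betw_def)
  define p :: "int^'n \<Rightarrow> int poly" where "p m = (\<Sum>i\<in>UNIV. monom (m $ i) (f i))" for m
  have coeff: "coeff (p m) (f i) = m $ i" for m i
    using f by (simp add: p_def coeff_sum inj_eq)
  define Z where "Z = (\<Union>m\<in>M. \<Union>m'\<in>M - {m}. {t. poly (p m - p m') t = 0})"
  have "finite Z"
    unfolding Z_def
  proof (intro finite_UN_I assms finite_Diff poly_roots_finite)
    fix m m' assume "m' \<in> M - {m}"
    then obtain i where "m $ i \<noteq> m' $ i" by (metis Diff_iff insertI1 vec_eq_iff)
    then have "coeff (p m - p m') (f i) \<noteq> 0" by (simp add: coeff)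
    then show "p m - p m' \<noteq> 0" by force
  qed
  then obtain t where t: "t \<notin> Z" using ex_new_if_finite infinite_UNIV_int by blast
  have "pairing m (\<chi> i. t ^ f i) = poly (p m) t" for m
    by (simp add: pairing_def p_def poly_sum poly_monom)
  moreover have "inj_on (\<lambda>m. poly (p m) t) M"
  proof (rule inj_onI, rule ccontr)
    fix m m' assume "m \<in> M" "m' \<in> M" "poly (p m) t = poly (p m') t" "m \<noteq> m'"
    then have "t \<in> Z"
      unfolding Z_def by (intro UN_I[of m] UN_I[of m']) auto
    with t show False by simp
  qed
  ultimately show thesis by (intro that[of "\<chi> i. t ^ f i"]) simp
qed

text \<open>After the largest power of the variable is divided out, a polynomial without nonzero roots has no root at all,
  hence is constant; so it was a single monomial.\<close>

lemma fewnomial_nonzero_root: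
  fixes c :: "'a \<Rightarrow> complex" and e :: "'a \<Rightarrow> nat"
  assumes fin: "finite I" and inj: "inj_on e I" and ij: "i \<in> I" "j \<in> I" "i \<noteq> j" "c i \<noteq> 0" "c j \<noteq> 0"
  obtains z where "z \<noteq> 0" "(\<Sum>i\<in>I. c i * z ^ e i) = 0"
proof -
  define p where "p = (\<Sum>i\<in>I. monom (c i) (e i))"
  have poly_p: "poly p z = (\<Sum>i\<in>I. c i * z ^ e i)" for z
    by (simp add: p_def poly_sum poly_monom)
  have coeff: "coeff p (e k) = c k" if "k \<in> I" for k
  proof -
    have "coeff p (e k) = (\<Sum>i\<in>I. if i = k then c i else 0)"
      unfolding p_def coeff_sum using inj that by (intro sum.cong) (auto simp: inj_on_def)
    then show ?thesis using fin that by simp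
  qed
  have "p \<noteq> 0" using coeff ij by force
  have "\<exists>z. z \<noteq> 0 \<and> poly p z = 0"
  proof (rule ccontr)
    assume nz: "\<not> ?thesis"
    define n where "n = order 0 p"
    obtain q where q: "p = [:-0, 1:] ^ n * q" "\<not> [:-0, 1:] dvd q"
      using order_decomp[OF \<open>p \<noteq> 0\<close>, of 0] unfolding n_def by metis
    have "poly q z \<noteq> 0" for z
    proof (cases "z = 0")
      case True
      then show ?thesis using q(2) by (simp add: poly_eq_0_iff_dvd)
    next
      case False
      then show ?thesis using nz q(1) by (auto simp: poly_power)
    qed
    then obtain a where "q = [:a:]"
      using fundamental_theorem_of_algebra_alt[of q] by blast
    then have "p = monom a n" using q(1) by (simp add: monom_altdef)
    then have "e i = n" "e j = n"
      using coeff[OF ij(1)] coeff[OF ij(2)] ij(4,5) by (auto split: if_splits)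
    then show False using inj ij by (auto simp: inj_on_def)
  qed
  then show thesis using that poly_p by metis
qed

lemma uniform_limit_finite_sum:
  fixes f :: "'i \<Rightarrow> 'a \<Rightarrow> 'b \<Rightarrow> 'c::real_normed_vector"
  assumes "finite I" "\<And>i. i \<in> I \<Longrightarrow> uniform_limit S (f i) (l i) F"
  shows "uniform_limit S (\<lambda>n x. \<Sum>i\<in>I. f i n x) (\<lambda>x. \<Sum>i\<in>I. l i x) F"
  using assms by (induction I rule: finite_induct) (auto intro!: uniform_limit_intros)

text \<open>Hurwitz' theorem on a disc around \<open>z0\<close>: convergence of the finitely many coefficients is locally uniform convergence of
  the polynomials. Since the theorem is about sequences, a failure is first turned into a sequence of parameters
  tending to infinity without roots in the disc.\<close>

lemma root_persists:
  fixes c :: "'a \<Rightarrow> complex" and e :: "'a \<Rightarrow> nat" and b :: "real \<Rightarrow> 'a \<Rightarrow> complex"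
  assumes fin: "finite I" and inj: "inj_on e I" and j: "j \<in> I" "c j \<noteq> 0"
    and root: "(\<Sum>i\<in>I. c i * z0 ^ e i) = 0"
    and lim: "\<And>i. i \<in> I \<Longrightarrow> ((\<lambda>s. b s i) \<longlongrightarrow> c i) at_top"
    and r: "r > 0"
  shows "\<forall>\<^sub>F s in at_top. \<exists>z. dist z0 z < r \<and> (\<Sum>i\<in>I. b s i * z ^ e i) = 0"
proof (rule ccontr)
  assume "\<not> ?thesis"
  then have "\<forall>n::nat. \<exists>s\<ge>real n. \<forall>z. dist z0 z < r \<longrightarrow> (\<Sum>i\<in>I. b s i * z ^ e i) \<noteq> 0"
    unfolding eventually_at_top_linorder by blast
  then obtain s where s: "\<And>n::nat. real n \<le> s n"
    "\<And>n z. z \<in> ball z0 r \<Longrightarrow> (\<Sum>i\<in>I. b (s n) i * z ^ e i) \<noteq> 0"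
    by (metis mem_ball)
  have s_top: "filterlim s at_top sequentially"
    using s(1) by (intro filterlim_at_top_mono[OF filterlim_real_sequentially]) auto
  have "(\<Sum>i\<in>I. c i * z0 ^ e i) \<noteq> 0"
  proof (rule Hurwitz_no_zeros[where S = "ball z0 r" and g = "\<lambda>z. \<Sum>i\<in>I. c i * z ^ e i" and \<F> = "\<lambda>n z. \<Sum>i\<in>I. b (s n) i * z ^ e i"])
    show "\<not> (\<lambda>z. \<Sum>i\<in>I. c i * z ^ e i) constant_on ball z0 r"
    proof
      assume "(\<lambda>z. \<Sum>i\<in>I. c i * z ^ e i) constant_on ball z0 r"
      then have zero: "(\<Sum>i\<in>I. c i * z ^ e i) = 0" if "z \<in> ball z0 r" for z
        using root that r unfolding constant_on_def by (metis centre_in_ball)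
      define p where "p = (\<Sum>i\<in>I. monom (c i) (e i))"
      have "coeff p (e j) = (\<Sum>i\<in>I. if i = j then c i else 0)"
        unfolding p_def coeff_sum using inj j by (intro sum.cong) (auto simp: inj_on_def)
      then have "p \<noteq> 0" using fin j by auto
      then have "finite {z. poly p z = 0}" by (rule poly_roots_finite)
      moreover have "ball z0 r \<subseteq> {z. poly p z = 0}"
        using zero by (auto simp: p_def poly_sum poly_monom)
      ultimately have "finite (ball z0 r)" by (rule rev_finite_subset)
      then show False using finite_imp_not_open[of "ball z0 r"] r by auto
    qed
    fix K assume K: "compact K" "K \<subseteq> ball z0 r"
    show "uniform_limit K (\<lambda>n z. \<Sum>i\<in>I. b (s n) i * z ^ e i) (\<lambda>z. \<Sum>i\<in>I. c i * z ^ e i) sequentially"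
    proof (intro uniform_limit_finite_sum fin uniform_lim_mult)
      fix i assume "i \<in> I"
      have "(\<lambda>n. b (s n) i) \<longlonglongrightarrow> c i"
        by (rule filterlim_compose[OF lim[OF \<open>i \<in> I\<close>] s_top])
      then show "uniform_limit K (\<lambda>n z. b (s n) i) (\<lambda>z. c i) sequentially"
        unfolding uniform_limit_iff tendsto_iff by simp
      show "bounded ((\<lambda>z. z ^ e i) ` K)"
        using K by (intro compact_imp_bounded compact_continuous_image continuous_intros)
    qed (auto simp: uniform_limit_const image_constant_conv)
  qed (use s r in \<open>auto intro!: holomorphic_intros\<close>)
  then show False using root by simp
qed

section \<open>Delzant polytopes\<close>

lemma finite_bounded_int_vectors:
  fixes S :: "(real^'n::finite) set"
  assumes "bounded S"
  shows "finite {m. real_vec m \<in> S}"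
proof -
  obtain B where B: "\<And>x. x \<in> S \<Longrightarrow> norm x \<le> B"
    using assms unfolding bounded_iff by blast
  have "(\<lambda>m. vec_nth m) ` {m. real_vec m \<in> S} \<subseteq> (\<Pi>\<^sub>E i\<in>UNIV. {- \<lceil>B\<rceil>..\<lceil>B\<rceil>})"
  proof clarify
    fix m :: "int^'n" assume m: "real_vec m \<in> S"
    have "m $ i \<in> {- \<lceil>B\<rceil>..\<lceil>B\<rceil>}" for i
    proof -
      have "\<bar>real_vec m $ i\<bar> \<le> norm (real_vec m)" by (rule component_le_norm_cart)
      then have "of_int \<bar>m $ i\<bar> \<le> B" using B[OF m] by (simp add: real_vec_def)
      then have "\<bar>m $ i\<bar> \<le> \<lceil>B\<rceil>" by linarith
      then show ?thesis by auto
    qed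
    then show "vec_nth m \<in> (\<Pi>\<^sub>E i\<in>UNIV. {- \<lceil>B\<rceil>..\<lceil>B\<rceil>})" by auto
  qed
  then have "finite ((\<lambda>m. vec_nth m) ` {m. real_vec m \<in> S})"
    by (rule finite_subset) (auto intro: finite_PiE)
  then show ?thesis
    by (rule finite_imageD) (simp add: vec_nth_inject inj_on_def)
qed

text \<open>The coefficients of the standard basis with respect to the \<open>\<int>\<close>-basis form an integral left inverse of the
  normal matrix. It is also a right inverse, and its columns \<open>k j\<close> are the dual basis. For a vertex they are the
  directions of its edges, and they turn the coordinates \<open>w\<^sub>j\<close> into monomials with integral exponents.\<close>

lemma Z_basis_dual_vectors:
  fixes \<nu> :: "nat \<Rightarrow> int^'n::finite"
  assumes "Z_basis R \<nu>" "bij_betw \<rho> UNIV R"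
  obtains k :: "'n \<Rightarrow> int^'n" where
    "\<forall>i j. real_vec (\<nu> (\<rho> i)) \<bullet> real_vec (k j) = (if i = j then 1 else 0)"
    "\<forall>x. x = (\<Sum>j\<in>UNIV. (real_vec (\<nu> (\<rho> j)) \<bullet> x) *\<^sub>R real_vec (k j))"
    "\<forall>j. matrix_inv (normal_matrix \<nu> \<rho>) *v axis j 1 = real_vec (k j)"
proof -
  have "\<exists>c. axis i 1 = (\<Sum>r\<in>R. c r *s \<nu> r)" for i
    using assms(1) unfolding Z_basis_def by blast
  then obtain c where c: "\<And>i. axis i 1 = (\<Sum>r\<in>R. c i r *s \<nu> r)" by metis
  have sum_\<rho>: "(\<Sum>r\<in>R. f r) = (\<Sum>j\<in>UNIV. f (\<rho> j))" for f :: "nat \<Rightarrow> int"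
    using sum.reindex_bij_betw[OF assms(2), of f] by simp
  define k :: "'n \<Rightarrow> int^'n" where "k j = (\<chi> i. c i (\<rho> j))" for j
  define A :: "real^'n^'n" where "A = normal_matrix \<nu> \<rho>"
  define C :: "real^'n^'n" where "C = (\<chi> i j. of_int (c i (\<rho> j)))"
  have CA: "C ** A = mat 1"
  proof -
    have "(\<Sum>j\<in>UNIV. c i (\<rho> j) * \<nu> (\<rho> j) $ l) = (if i = l then 1 else 0)" for i l
    proof -
      have "(axis i 1 :: int^'n) $ l = (\<Sum>r\<in>R. c i r * \<nu> r $ l)"
        using c[of i] by (simp add: vec_eq_iff)
      then show ?thesis by (simp add: sum_\<rho> axis_def eq_commute)
    qed
    from arg_cong[OF this, of "of_int :: int \<Rightarrow> real"] show ?thesis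
      by (simp add: matrix_matrix_mult_def C_def A_def normal_matrix_def real_vec_def mat_def vec_eq_iff)
  qed
  then have AC: "A ** C = mat 1" using matrix_left_right_inverse by blast
  have colC: "C *v axis j 1 = real_vec (k j)" for j
    by (simp add: matrix_vector_mul_component C_def k_def real_vec_def matrix_vector_mult_basis column_def)
  have row: "(A *v x) $ j = real_vec (\<nu> (\<rho> j)) \<bullet> x" for x j
    by (simp add: A_def normal_matrix_def matrix_vector_mul_component)
  show thesis
  proof (rule that[of k]; intro allI)
    show "real_vec (\<nu> (\<rho> i)) \<bullet> real_vec (k j) = (if i = j then 1 else 0)" for i j
    proof -
      have "real_vec (\<nu> (\<rho> i)) \<bullet> real_vec (k j) = (A *v (C *v axis j 1)) $ i"
        unfolding row colC ..
      also have "\<dots> = (axis j 1 :: real^'n) $ i" by (simp add: matrix_vector_mul_assoc AC)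
      finally show ?thesis by (simp add: axis_def)
    qed
    show "x = (\<Sum>j\<in>UNIV. (real_vec (\<nu> (\<rho> j)) \<bullet> x) *\<^sub>R real_vec (k j))" for x
    proof -
      have "x = C *v (A *v x)" by (simp add: matrix_vector_mul_assoc CA)
      also have "\<dots> = (\<Sum>j\<in>UNIV. (A *v x) $ j *\<^sub>R real_vec (k j))"
        by (simp add: vec_eq_iff matrix_vector_mult_def C_def k_def real_vec_def mult.commute)
      finally show ?thesis unfolding row .
    qed
    have "\<exists>B. A ** B = mat 1 \<and> B ** A = mat 1" using AC CA by blast
    then have "matrix_inv A ** A = mat 1"
      unfolding matrix_inv_def by (rule someI2_ex) simp
    then have "matrix_inv A = C"
      by (metis AC matrix_mul_assoc matrix_mul_lid matrix_mul_rid)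
    then show "matrix_inv (normal_matrix \<nu> \<rho>) *v axis j 1 = real_vec (k j)" for j
      using colC by (simp add: A_def)
  qed
qed

locale delzant_polytope =
  fixes d :: nat and \<nu> :: "nat \<Rightarrow> int^'n::finite" and lam :: "nat \<Rightarrow> int"
  assumes delzant: "delzant d \<nu> lam"
begin

abbreviation P :: "(real^'n) set" where "P \<equiv> polytope_of d \<nu> lam"
abbreviation l :: "nat \<Rightarrow> real^'n \<Rightarrow> real" where "l \<equiv> ell \<nu> lam"

lemma mem_P: "x \<in> P \<longleftrightarrow> (\<forall>r\<in>{1..d}. 0 \<le> l r x)"
  by (simp add: polytope_of_def)

lemma compact_P: "compact P"
  using delzant by (simp add: delzant_def Let_def)

lemma l_convex_combination: "l r ((1 - t) *\<^sub>R x + t *\<^sub>R y) = (1 - t) * l r x + t * l r y"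
  by (simp add: ell_def inner_add_right algebra_simps)

lemma l_add: "l r (x + w) = l r x + real_vec (\<nu> r) \<bullet> w"
  by (simp add: ell_def inner_add_right)

lemma continuous_l [continuous_intros]: "continuous_on S (l r)"
  unfolding ell_def by (intro continuous_intros)

lemma convex_P: "convex P"
  unfolding convex_alt by (auto simp: mem_P l_convex_combination)

lemma P_nonempty: "P \<noteq> {}"
proof
  assume *: "P = {}"
  have "bij_betw (\<lambda>r. {x\<in>P. l r x = 0}) {1..d} {F. F facet_of P}"
    using delzant by (simp add: delzant_def Let_def)
  moreover have "{F. F facet_of P} = {}" unfolding * by simp
  ultimately have "{1..d} = {}" by (simp add: bij_betw_def)
  then have "P = UNIV" by (auto simp: polytope_of_def)
  then show False using * by simp
qed

lemma \<nu>_nonzero: "r \<in> {1..d} \<Longrightarrow> real_vec (\<nu> r) \<noteq> 0"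
proof
  assume r: "r \<in> {1..d}" and "real_vec (\<nu> r) = 0"
  then have "\<nu> r $ i = 0" for i by (simp add: real_vec_def vec_eq_iff)
  then have "range (\<lambda>i. \<nu> r $ i) = {0}" by auto
  moreover have "Gcd (range (\<lambda>i. \<nu> r $ i)) = 1"
    using delzant r by (auto simp: delzant_def Let_def)
  ultimately show False by simp
qed

lemma mem_active: "r \<in> active d \<nu> lam x \<longleftrightarrow> r \<in> {1..d} \<and> l r x = 0"
  by (simp add: active_def)

lemma interior_P: "interior P = {x. \<forall>r\<in>{1..d}. 0 < l r x}"
proof (intro equalityI subsetI CollectI ballI)
  fix x r assume x: "x \<in> interior P" and r: "r \<in> {1..d}"
  then obtain e where e: "e > 0" "ball x e \<subseteq> P" using mem_interior by blast
  define w where "w = real_vec (\<nu> r)"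
  have w: "w \<noteq> 0" using \<nu>_nonzero[OF r] by (simp add: w_def)
  define y where "y = x + (- (e / (2 * norm w))) *\<^sub>R w"
  have "y \<in> P" using e w by (intro subsetD[OF e(2)]) (simp add: y_def dist_norm)
  then have "0 \<le> l r y" using r by (simp add: mem_P)
  then have "0 \<le> l r x - e / (2 * norm w) * (w \<bullet> w)"
    unfolding y_def l_add w_def[symmetric] by simp
  moreover have "0 < e / (2 * norm w) * (w \<bullet> w)" using e w by simp
  ultimately show "0 < l r x" by linarith
next
  fix x assume x: "x \<in> {x. \<forall>r\<in>{1..d}. 0 < l r x}"
  have "{x. \<forall>r\<in>{1..d}. 0 < l r x} = (\<Inter>r\<in>{1..d}. {x. 0 < l r x})" by auto
  moreover have "open \<dots>"
    by (intro open_INT ballI open_Collect_less continuous_intros finite_atLeastAtMost)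
  ultimately show "x \<in> interior P"
    using x by (intro interiorI[of "{x. \<forall>r\<in>{1..d}. 0 < l r x}"]) (auto simp: mem_P less_imp_le)
qed

text \<open>Inactive inequalities tolerate any sufficiently small step, so only the active ones restrict the directions that
  lead into \<open>P\<close>.\<close>

lemma exists_small_step:
  assumes "x \<in> P" "\<And>r. r \<in> active d \<nu> lam x \<Longrightarrow> 0 \<le> real_vec (\<nu> r) \<bullet> w"
  obtains \<epsilon> where "\<epsilon> > 0" "x + \<epsilon> *\<^sub>R w \<in> P"
    "\<forall>r\<in>{1..d}. l r x > 0 \<or> real_vec (\<nu> r) \<bullet> w > 0 \<longrightarrow> l r (x + \<epsilon> *\<^sub>R w) > 0"
proof -
  have "\<forall>\<^sub>F \<epsilon> in at_right 0. \<epsilon> > 0 \<and> 0 \<le> l r (x + \<epsilon> *\<^sub>R w) \<and>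
      (l r x > 0 \<or> real_vec (\<nu> r) \<bullet> w > 0 \<longrightarrow> 0 < l r (x + \<epsilon> *\<^sub>R w))" if r: "r \<in> {1..d}" for r
  proof (cases "l r x = 0")
    case True
    then have "0 \<le> real_vec (\<nu> r) \<bullet> w" using assms(2) r by (simp add: mem_active)
    then show ?thesis
      using True eventually_at_right_less[of "0::real"] by (auto simp: l_add elim!: eventually_mono)
  next
    case False
    then have "0 < l r x" using assms(1) r by (force simp: mem_P)
    moreover have "((\<lambda>\<epsilon>. l r (x + \<epsilon> *\<^sub>R w)) \<longlongrightarrow> l r (x + 0 *\<^sub>R w)) (at_right 0)"
      unfolding l_add by (intro tendsto_intros)
    ultimately have "\<forall>\<^sub>F \<epsilon> in at_right 0. 0 < l r (x + \<epsilon> *\<^sub>R w)"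
      by (intro order_tendstoD) auto
    then show ?thesis
      using eventually_at_right_less[of "0::real"] by eventually_elim auto
  qed
  then have "\<forall>\<^sub>F \<epsilon> in at_right 0. \<forall>r\<in>{1..d}. \<epsilon> > 0 \<and> 0 \<le> l r (x + \<epsilon> *\<^sub>R w) \<and>
      (l r x > 0 \<or> real_vec (\<nu> r) \<bullet> w > 0 \<longrightarrow> 0 < l r (x + \<epsilon> *\<^sub>R w))"
    by (intro eventually_ball_finite) auto
  then have "\<forall>\<^sub>F \<epsilon> in at_right 0. \<epsilon> > 0 \<and> (\<forall>r\<in>{1..d}. 0 \<le> l r (x + \<epsilon> *\<^sub>R w) \<and>
      (l r x > 0 \<or> real_vec (\<nu> r) \<bullet> w > 0 \<longrightarrow> 0 < l r (x + \<epsilon> *\<^sub>R w)))"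
    using eventually_at_right_less[of "0::real"] by eventually_elim auto
  then obtain \<epsilon> where "\<epsilon> > 0" "\<forall>r\<in>{1..d}. 0 \<le> l r (x + \<epsilon> *\<^sub>R w) \<and>
      (l r x > 0 \<or> real_vec (\<nu> r) \<bullet> w > 0 \<longrightarrow> 0 < l r (x + \<epsilon> *\<^sub>R w))"
    using eventually_happens'[OF trivial_limit_at_right_real] by blast
  then show thesis by (intro that[of \<epsilon>]) (auto simp: mem_P)
qed

lemma vertex_active:
  assumes "q extreme_point_of P"
  shows "q \<in> range real_vec" "card (active d \<nu> lam q) = CARD('n)" "Z_basis (active d \<nu> lam q) \<nu>"
  using delzant assms by (auto simp: delzant_def Let_def)

lemma exists_vertex_ordering:
  assumes "q extreme_point_of P"
  obtains \<rho> where "vertex_ordering d \<nu> lam q \<rho>"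
proof -
  have "finite (active d \<nu> lam q)" by (simp add: active_def)
  then obtain \<rho> where "bij_betw \<rho> (UNIV :: 'n set) (active d \<nu> lam q)"
    using finite_same_card_bij[OF finite_class.finite_UNIV _ vertex_active(2)[OF assms, symmetric]] by blast
  then show thesis using that assms by (simp add: vertex_ordering_def)
qed

lemma vertex_ordering_surj:
  assumes "vertex_ordering d \<nu> lam q \<rho>" "r \<in> active d \<nu> lam q"
  obtains i where "r = \<rho> i"
proof -
  have "r \<in> range \<rho>" using assms by (simp add: vertex_ordering_def bij_betw_def)
  then show thesis using that by (rule rangeE)
qed

lemma dual_vectors:
  assumes "vertex_ordering d \<nu> lam q \<rho>"
  obtains k :: "'n \<Rightarrow> int^'n" where
    "\<forall>i j. real_vec (\<nu> (\<rho> i)) \<bullet> real_vec (k j) = (if i = j then 1 else 0)"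
    "\<forall>x. x = (\<Sum>j\<in>UNIV. (real_vec (\<nu> (\<rho> j)) \<bullet> x) *\<^sub>R real_vec (k j))"
    "\<forall>j. matrix_inv (normal_matrix \<nu> \<rho>) *v axis j 1 = real_vec (k j)"
proof -
  have "q extreme_point_of P" "bij_betw \<rho> UNIV (active d \<nu> lam q)"
    using assms by (auto simp: vertex_ordering_def)
  from Z_basis_dual_vectors[OF vertex_active(3)[OF this(1)] this(2)] that show thesis by blast
qed

lemma exists_vertex: "\<exists>q. q extreme_point_of P"
  using extreme_point_exists_convex[OF compact_P convex_P P_nonempty] by metis

lemma interior_P_nonempty: "interior P \<noteq> {}"
proof -
  obtain q where q: "q extreme_point_of P" using exists_vertex by blast
  obtain \<rho> where \<rho>: "vertex_ordering d \<nu> lam q \<rho>" using exists_vertex_ordering[OF q] .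
  obtain k where k: "\<forall>i j. real_vec (\<nu> (\<rho> i)) \<bullet> real_vec (k j) = (if i = j then 1 else 0)"
    "\<forall>x. x = (\<Sum>j\<in>UNIV. (real_vec (\<nu> (\<rho> j)) \<bullet> x) *\<^sub>R real_vec (k j))"
    "\<forall>j. matrix_inv (normal_matrix \<nu> \<rho>) *v axis j 1 = real_vec (k j)"
    using \<rho> by (rule dual_vectors)
  \<comment> \<open>The sum of the edge directions at a vertex points into the interior.\<close>
  define w where "w = (\<Sum>j\<in>UNIV. real_vec (k j))"
  have w: "real_vec (\<nu> r) \<bullet> w = 1" if "r \<in> active d \<nu> lam q" for r
  proof -
    obtain i where "r = \<rho> i" using \<rho> \<open>r \<in> _\<close> by (rule vertex_ordering_surj)
    then show ?thesis by (simp add: w_def inner_sum_right k(1))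
  qed
  have "q \<in> P" using q by (simp add: extreme_point_of_def)
  moreover have "\<And>r. r \<in> active d \<nu> lam q \<Longrightarrow> 0 \<le> real_vec (\<nu> r) \<bullet> w" using w by simp
  ultimately obtain \<epsilon> where \<epsilon>: "\<epsilon> > 0" "q + \<epsilon> *\<^sub>R w \<in> P"
    "\<forall>r\<in>{1..d}. l r q > 0 \<or> real_vec (\<nu> r) \<bullet> w > 0 \<longrightarrow> l r (q + \<epsilon> *\<^sub>R w) > 0"
    by (rule exists_small_step)
  have "0 < l r (q + \<epsilon> *\<^sub>R w)" if r: "r \<in> {1..d}" for r
  proof (cases "l r q = 0")
    case True
    then show ?thesis using \<epsilon>(3) w[of r] r by (simp add: mem_active)
  next
    case False
    then show ?thesis using \<epsilon>(3) r \<open>q \<in> P\<close> by (force simp: mem_P)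
  qed
  then show ?thesis unfolding interior_P by blast
qed

lemma P_subset_closure_interior: "P \<subseteq> closure (interior P)"
  using convex_closure_interior[OF convex_P interior_P_nonempty] closure_subset by blast

text \<open>A facet inequality that is tight at a relative interior point of a face is tight on the whole face, because the
  segment from \<open>q\<close> to \<open>x\<close> can be prolonged beyond \<open>x\<close> inside the face.\<close>

lemma mem_P_q_imp:
  assumes "x \<in> P_q P q"
  shows "x \<in> P" "active d \<nu> lam x \<subseteq> active d \<nu> lam q"
proof -
  obtain F where F: "F face_of P" "q \<in> F" "x \<in> rel_interior F"
    using assms unfolding P_q_def by blast
  have FP: "F \<subseteq> P" using F(1) by (rule face_of_imp_subset)
  then show "x \<in> P" using F(3) rel_interior_subset by blast
  have "convex F" using F(1) by (rule face_of_imp_convex)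
  then obtain e where e: "e > 1" "(1 - e) *\<^sub>R q + e *\<^sub>R x \<in> F"
    using convex_rel_interior_iff[of F x] F by blast
  show "active d \<nu> lam x \<subseteq> active d \<nu> lam q"
  proof
    fix r assume "r \<in> active d \<nu> lam x"
    then have r: "r \<in> {1..d}" "l r x = 0" by (auto simp: mem_active)
    have "0 \<le> l r ((1 - e) *\<^sub>R q + e *\<^sub>R x)" using e(2) FP r(1) by (auto simp: mem_P)
    then have "0 \<le> (1 - e) * l r q" by (simp add: l_convex_combination r(2))
    then have "l r q \<le> 0" using e(1) by (simp add: zero_le_mult_iff)
    moreover have "0 \<le> l r q" using F(2) FP r(1) by (auto simp: mem_P)
    ultimately show "r \<in> active d \<nu> lam q" using r(1) by (simp add: mem_active)
  qed
qed

text \<open>The points where all inequalities active at \<open>x\<close> are tight form a face with \<open>x\<close> in its relative interior, and any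
  vertex of this face will do. This shows that the vertex charts cover the toric manifold.\<close>

lemma exists_chart_vertex:
  assumes x: "x \<in> P"
  obtains q where "q extreme_point_of P" "x \<in> P_q P q"
proof -
  define F where "F = {y\<in>P. \<forall>r\<in>active d \<nu> lam x. l r y = 0}"
  have aff: "affine {y. \<forall>r\<in>active d \<nu> lam x. l r y = 0}"
    unfolding affine_alt by (auto simp: l_convex_combination)
  have F_eq: "F = P \<inter> {y. \<forall>r\<in>active d \<nu> lam x. l r y = 0}" by (auto simp: F_def)
  have face: "F face_of P"
    unfolding face_of_def
  proof (intro conjI ballI impI)
    show "F \<subseteq> P" by (auto simp: F_def)
    show "convex F" unfolding F_eq by (intro convex_Int convex_P affine_imp_convex aff)
    fix a b y assume ab: "a \<in> P" "b \<in> P" "y \<in> F" "y \<in> open_segment a b"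
    then obtain u where u: "0 < u" "u < 1" "y = (1 - u) *\<^sub>R a + u *\<^sub>R b"
      by (auto simp: in_segment)
    have "l r a = 0 \<and> l r b = 0" if r: "r \<in> active d \<nu> lam x" for r
    proof -
      have "0 \<le> l r a" "0 \<le> l r b" using ab r by (auto simp: mem_P mem_active)
      moreover have "(1 - u) * l r a + u * l r b = 0"
        using ab(3) r u(3) by (simp add: F_def l_convex_combination)
      ultimately show ?thesis
        using u by (smt (verit) mult_pos_pos mult_nonneg_nonneg)
    qed
    then show "a \<in> F" "b \<in> F" using ab by (auto simp: F_def)
  qed
  have "x \<in> F" using x by (auto simp: F_def mem_active)
  have "x \<in> rel_interior F"
  proof -
    have "open (\<Inter>r\<in>{1..d} - active d \<nu> lam x. {y. 0 < l r y})"
      by (intro open_INT ballI open_Collect_less continuous_intros) auto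
    moreover have "x \<in> (\<Inter>r\<in>{1..d} - active d \<nu> lam x. {y. 0 < l r y})"
      using x by (force simp: mem_P mem_active)
    moreover have "(\<Inter>r\<in>{1..d} - active d \<nu> lam x. {y. 0 < l r y}) \<inter> affine hull F \<subseteq> F"
    proof -
      have "affine hull F \<subseteq> {y. \<forall>r\<in>active d \<nu> lam x. l r y = 0}"
        by (rule hull_minimal) (use aff in \<open>auto simp: F_def\<close>)
      moreover have "y \<in> F" if "\<forall>r\<in>active d \<nu> lam x. l r y = 0"
          "\<forall>r\<in>{1..d} - active d \<nu> lam x. 0 < l r y" for y
      proof -
        have "0 \<le> l r y" if "r \<in> {1..d}" for r
          using that \<open>\<forall>r\<in>active d \<nu> lam x. l r y = 0\<close> \<open>\<forall>r\<in>{1..d} - active d \<nu> lam x. 0 < l r y\<close>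
          by (cases "r \<in> active d \<nu> lam x") (auto intro: less_imp_le)
        with that(1) show ?thesis by (simp add: F_def mem_P)
      qed
      ultimately show ?thesis by (intro subsetI) (simp add: subset_iff)
    qed
    ultimately show ?thesis using \<open>x \<in> F\<close> unfolding mem_rel_interior by blast
  qed
  moreover have "compact F"
  proof -
    have "closed {y. \<forall>r\<in>active d \<nu> lam x. l r y = 0}"
      unfolding Ball_def
      by (intro closed_Collect_all closed_Collect_imp closed_Collect_eq continuous_intros open_Collect_const)
    then show ?thesis unfolding F_eq by (rule compact_Int_closed[OF compact_P])
  qed
  ultimately obtain q where "q extreme_point_of F"
    using extreme_point_exists_convex[of F] face_of_imp_convex[OF face] \<open>x \<in> F\<close> by auto
  then have "q extreme_point_of P" "q \<in> F"
    using extreme_point_of_face[OF face] by auto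
  then show thesis using that face \<open>x \<in> rel_interior F\<close> unfolding P_q_def by blast
qed

text \<open>For a Delzant polytope Farkas' lemma is elementary. The normals at a vertex \<open>q\<close> form a basis with dual basis
  \<open>k j\<close>, so the coefficients of \<open>c\<close> are its products with the \<open>k j\<close>. Testing \<open>c\<close> against a small step along
  \<open>k j\<close> gives the sign of a coefficient; when the facet is not active at \<open>x\<close> the step may be taken in both directions,
  and the coefficient vanishes.\<close>

lemma cone_at_eq_normals:
  assumes "x \<in> P"
  shows "cone_at P x =
    {- (\<Sum>r\<in>active d \<nu> lam x. t r *\<^sub>R real_vec (\<nu> r)) | t. \<forall>r\<in>active d \<nu> lam x. 0 \<le> t r}"
proof (intro equalityI subsetI)
  fix c assume c: "c \<in> cone_at P x"
  obtain q where q: "q extreme_point_of P" "x \<in> P_q P q" using exists_chart_vertex[OF assms] .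
  obtain \<rho> where \<rho>: "vertex_ordering d \<nu> lam q \<rho>" using exists_vertex_ordering[OF q(1)] .
  obtain k where k: "\<forall>i j. real_vec (\<nu> (\<rho> i)) \<bullet> real_vec (k j) = (if i = j then 1 else 0)"
    "\<forall>x. x = (\<Sum>j\<in>UNIV. (real_vec (\<nu> (\<rho> j)) \<bullet> x) *\<^sub>R real_vec (k j))"
    "\<forall>j. matrix_inv (normal_matrix \<nu> \<rho>) *v axis j 1 = real_vec (k j)"
    using \<rho> by (rule dual_vectors)
  have bij: "bij_betw \<rho> UNIV (active d \<nu> lam q)" using \<rho> by (simp add: vertex_ordering_def)
  have sub: "active d \<nu> lam x \<subseteq> active d \<nu> lam q" by (rule mem_P_q_imp[OF q(2)])
  have le: "c \<bullet> w \<le> 0" if w: "\<And>r. r \<in> active d \<nu> lam x \<Longrightarrow> 0 \<le> real_vec (\<nu> r) \<bullet> w" for w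
  proof -
    obtain \<epsilon> where \<epsilon>: "\<epsilon> > 0" "x + \<epsilon> *\<^sub>R w \<in> P"
      "\<forall>r\<in>{1..d}. l r x > 0 \<or> real_vec (\<nu> r) \<bullet> w > 0 \<longrightarrow> l r (x + \<epsilon> *\<^sub>R w) > 0"
      using assms w by (rule exists_small_step)
    then have "0 \<le> c \<bullet> (x - (x + \<epsilon> *\<^sub>R w))" using c by (auto simp: cone_at_def)
    then show ?thesis using \<epsilon>(1) by (simp add: zero_le_mult_iff mult_le_0_iff)
  qed
  define t where "t r = - (c \<bullet> real_vec (k (the_inv \<rho> r)))" for r
  have t: "t (\<rho> j) = - (c \<bullet> real_vec (k j))" for j
    using bij by (simp add: t_def the_inv_f_f bij_betw_def)
  have nonneg: "0 \<le> t r" if r: "r \<in> active d \<nu> lam x" for r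
  proof -
    obtain j where j: "r = \<rho> j" using \<rho> subsetD[OF sub r] by (rule vertex_ordering_surj)
    have "c \<bullet> real_vec (k j) \<le> 0"
    proof (rule le)
      fix r' assume "r' \<in> active d \<nu> lam x"
      then have "r' \<in> active d \<nu> lam q" using sub by blast
      with \<rho> obtain i where "r' = \<rho> i" by (rule vertex_ordering_surj)
      then show "0 \<le> real_vec (\<nu> r') \<bullet> real_vec (k j)" by (simp add: k(1))
    qed
    then show ?thesis by (simp add: j t)
  qed
  have zero: "t r = 0" if r: "r \<in> active d \<nu> lam q - active d \<nu> lam x" for r
  proof -
    have "r \<in> active d \<nu> lam q" using that by blast
    with \<rho> obtain j where j: "r = \<rho> j" by (rule vertex_ordering_surj)
    have 0: "real_vec (\<nu> r') \<bullet> real_vec (k j) = 0" if r': "r' \<in> active d \<nu> lam x" for r'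
    proof -
      obtain i where "r' = \<rho> i" using \<rho> subsetD[OF sub r'] by (rule vertex_ordering_surj)
      then show ?thesis using r' r j by (auto simp: k(1))
    qed
    have "c \<bullet> real_vec (k j) \<le> 0" "c \<bullet> (- real_vec (k j)) \<le> 0"
      by (rule le; simp add: 0)+
    then show ?thesis by (simp add: j t)
  qed
  have "c = - (\<Sum>j\<in>UNIV. t (\<rho> j) *\<^sub>R real_vec (\<nu> (\<rho> j)))"
  proof (rule vector_eq_rdot[THEN iffD1], rule allI)
    fix y
    have "c \<bullet> y = (\<Sum>j\<in>UNIV. (real_vec (\<nu> (\<rho> j)) \<bullet> y) * (c \<bullet> real_vec (k j)))"
      by (subst k(2)[rule_format, of y]) (simp add: inner_sum_right)
    also have "\<dots> = - (\<Sum>j\<in>UNIV. t (\<rho> j) *\<^sub>R real_vec (\<nu> (\<rho> j))) \<bullet> y"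
      by (simp add: t inner_sum_left sum_negf mult.commute)
    finally show "c \<bullet> y = - (\<Sum>j\<in>UNIV. t (\<rho> j) *\<^sub>R real_vec (\<nu> (\<rho> j))) \<bullet> y" .
  qed
  also have "(\<Sum>j\<in>UNIV. t (\<rho> j) *\<^sub>R real_vec (\<nu> (\<rho> j))) = (\<Sum>r\<in>active d \<nu> lam q. t r *\<^sub>R real_vec (\<nu> r))"
    by (rule sum.reindex_bij_betw[OF bij])
  also have "\<dots> = (\<Sum>r\<in>active d \<nu> lam x. t r *\<^sub>R real_vec (\<nu> r))"
    using zero sub by (intro sum.mono_neutral_right) (auto simp: active_def)
  finally show "c \<in> {- (\<Sum>r\<in>active d \<nu> lam x. t r *\<^sub>R real_vec (\<nu> r)) | t. \<forall>r\<in>active d \<nu> lam x. 0 \<le> t r}"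
    using nonneg by blast
next
  fix c assume "c \<in> {- (\<Sum>r\<in>active d \<nu> lam x. t r *\<^sub>R real_vec (\<nu> r)) | t. \<forall>r\<in>active d \<nu> lam x. 0 \<le> t r}"
  then obtain t where t: "c = - (\<Sum>r\<in>active d \<nu> lam x. t r *\<^sub>R real_vec (\<nu> r))"
    "\<forall>r\<in>active d \<nu> lam x. 0 \<le> t r" by blast
  have "0 \<le> c \<bullet> (x - y)" if "y \<in> P" for y
  proof -
    have "c \<bullet> (x - y) = (\<Sum>r\<in>active d \<nu> lam x. t r * (l r y - l r x))"
      unfolding t(1) by (simp add: inner_sum_left ell_def inner_diff_right sum_negf sum_subtractf right_diff_distrib)
    also have "0 \<le> \<dots>"
      using t(2) that by (intro sum_nonneg) (auto simp: mem_active mem_P)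
    finally show ?thesis .
  qed
  then show "c \<in> cone_at P x" by (simp add: cone_at_def)
qed

lemma finite_lattice_points: "finite (lattice_points P)"
  unfolding lattice_points_def
  by (rule finite_bounded_int_vectors[OF compact_imp_bounded[OF compact_P]])

lemma two_lattice_points:
  obtains m m' where "m \<in> lattice_points P" "m' \<in> lattice_points P" "m \<noteq> m'"
proof -
  obtain q where q: "q extreme_point_of P" using exists_vertex by blast
  have "\<exists>q'. q' extreme_point_of P \<and> q' \<noteq> q"
  proof (rule ccontr)
    assume no: "\<not> ?thesis"
    have "{x. x extreme_point_of P} = {q}"
    proof (intro equalityI subsetI)
      fix x assume "x \<in> {x. x extreme_point_of P}"
      then have "x extreme_point_of P" by simp
      with no have "x = q" by blast
      then show "x \<in> {q}" by simp
    qed (use q in simp)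
    then have "P = {q}" using Krein_Milman_Minkowski[OF compact_P convex_P] by simp
    then show False using interior_P_nonempty by simp
  qed
  then obtain q' where q': "q' extreme_point_of P" "q' \<noteq> q" by blast
  obtain m where m: "q = real_vec m" using vertex_active(1)[OF q] by (rule rangeE)
  obtain m' where m': "q' = real_vec m'" using vertex_active(1)[OF q'(1)] by (rule rangeE)
  have "q \<in> P" "q' \<in> P" using q q'(1) by (auto simp: extreme_point_of_def)
  then show thesis
    using that[of m m'] q'(2) m m' by (auto simp: lattice_points_def)
qed

end

section \<open>The limit set\<close>

lemma continuous_on_x_ln_x: "continuous_on {0..} (\<lambda>t::real. t * ln t)"
proof (rule continuous_on_eq_continuous_within[THEN iffD2], rule ballI)
  fix t :: real assume "t \<in> {0..}"
  show "continuous (at t within {0..}) (\<lambda>t. t * ln t)"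
  proof (cases "t = 0")
    case False
    then show ?thesis by (intro continuous_intros) auto
  next
    case True
    have bound: "norm (t * ln t) \<le> 2 * sqrt t" if "0 < t" "t < 1" for t :: real
    proof -
      have "- ln t = 2 * ln (1 / sqrt t)" using that by (simp add: ln_div ln_sqrt)
      also have "\<dots> \<le> 2 * (1 / sqrt t)"
        using ln_le_minus_one[of "1 / sqrt t"] that by simp
      finally have "t * - ln t \<le> t * (2 * (1 / sqrt t))"
        using that by (intro mult_left_mono) auto
      also have "\<dots> = 2 * (t / sqrt t)" by simp
      also have "\<dots> = 2 * sqrt t" using that by (simp only: real_div_sqrt less_imp_le)
      finally show ?thesis using that by (simp add: abs_mult)
    qed
    have "((\<lambda>t::real. t * ln t) \<longlongrightarrow> 0) (at_right 0)"
    proof (rule Lim_null_comparison)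
      show "\<forall>\<^sub>F t in at_right 0. norm (t * ln t) \<le> 2 * sqrt (t::real)"
        using eventually_at_right_less[of "0::real"] eventually_at_right_real[OF zero_less_one]
        by eventually_elim (rule bound, auto)
      have "((\<lambda>t. 2 * sqrt t) \<longlongrightarrow> 2 * sqrt 0) (at_right (0::real))"
        by (intro tendsto_intros)
      then show "((\<lambda>t. 2 * sqrt t) \<longlongrightarrow> 0) (at_right (0::real))" by simp
    qed
    then show ?thesis
      by (simp add: continuous_within True at_within_Ici_at_right)
  qed
qed

text \<open>The number \<open>c\<close> is a modulus of strong convexity of \<open>\<psi>\<close> on \<open>P\<close>.\<close>

locale toric_degeneration =
  delzant_polytope d \<nu> lam + strongly_convex_potential "polytope_of d \<nu> lam" \<psi> c
  for d :: nat and \<nu> :: "nat \<Rightarrow> int^'n::finite" and lam :: "nat \<Rightarrow> int"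
    and \<psi> :: "real^'n \<Rightarrow> real" and c :: real +
  fixes \<phi> :: "real^'n \<Rightarrow> real"
  assumes \<phi>: "\<phi> \<in> C_inf_gP d \<nu> lam"
begin

lemma tropical_amoeba_eq_Union:
  "tropical_amoeba P v =
    (\<Union>(m, m')\<in>{(m, m'). m \<in> lattice_points P \<and> m' \<in> lattice_points P \<and> m \<noteq> m'}.
       {u. maximal_at (lattice_points P) v u m} \<inter> {u. maximal_at (lattice_points P) v u m'})"
proof -
  have "lattice_points P \<noteq> {}" by (rule two_lattice_points) blast
  note iff = mem_tropical_amoeba_iff[OF finite_lattice_points this]
  show ?thesis (is "_ = ?R")
  proof (intro equalityI subsetI)
    fix u assume "u \<in> tropical_amoeba P v"
    then obtain m m' where m: "m \<noteq> m'" "maximal_at (lattice_points P) v u m" "maximal_at (lattice_points P) v u m'"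
      unfolding iff by blast
    then have mm: "(m, m') \<in> {(m, m'). m \<in> lattice_points P \<and> m' \<in> lattice_points P \<and> m \<noteq> m'}"
      by (simp add: maximal_at_def)
    show "u \<in> ?R" by (rule UN_I[OF mm]) (use m in simp)
  next
    fix u assume "u \<in> ?R"
    then show "u \<in> tropical_amoeba P v" unfolding iff by blast
  qed
qed

lemma polyhedron_maximal_at:
  "polyhedron {u. maximal_at (lattice_points P) v u m}"
proof (cases "m \<in> lattice_points P")
  case True
  then have "{u. maximal_at (lattice_points P) v u m} =
     \<Inter>((\<lambda>m'. {u. (real_vec m' - real_vec m) \<bullet> u \<le> v m' - v m}) ` lattice_points P)"
    by (auto simp: maximal_at_def inner_diff_left algebra_simps)
  also have "polyhedron \<dots>"
    by (intro polyhedron_Inter) (auto simp: finite_lattice_points polyhedron_halfspace_le)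
  finally show ?thesis .
qed (simp add: maximal_at_def)

text \<open>The set of points of \<open>P\<close> is sorted by sets \<open>R\<close> of active facets. Over a fixed \<open>R\<close> a point \<open>y\<close> is the
  maximiser of some \<open>u \<in> S\<close> if its gradient lies in \<open>S\<close> minus the cone generated by the outward
  normals \<open>- \<nu> r\<close> for \<open>r \<in> R\<close>. Only
  \<open>R \<subseteq> active y\<close> is demanded, and not equality, so that each piece is closed; the union does not change, since
  the cone of a subset is contained in the normal cone at \<open>y\<close>.\<close>

lemma maximiser_image_eq:
  "maximiser ` S = (\<Union>R\<in>Pow {1..d}. {y\<in>P. (\<forall>r\<in>R. l r y = 0) \<and>
     gradient \<psi> y \<in> {x. \<exists>t. (\<forall>r\<in>R. 0 \<le> t r) \<and> x + (\<Sum>r\<in>R. t r *\<^sub>R (- real_vec (\<nu> r))) \<in> S}})"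
  (is "_ = (\<Union>R\<in>_. ?Y R)")
proof (intro equalityI subsetI)
  fix y assume "y \<in> maximiser ` S"
  then obtain u where u: "u \<in> S" "y = maximiser u" by blast
  have y: "y \<in> P" "u - gradient \<psi> y \<in> cone_at P y" using maximiser u(2) by auto
  then obtain t where t: "u - gradient \<psi> y = - (\<Sum>r\<in>active d \<nu> lam y. t r *\<^sub>R real_vec (\<nu> r))"
    "\<forall>r\<in>active d \<nu> lam y. 0 \<le> t r"
    unfolding cone_at_eq_normals[OF y(1)] by blast
  have "gradient \<psi> y + (\<Sum>r\<in>active d \<nu> lam y. t r *\<^sub>R (- real_vec (\<nu> r))) = u"
    using t(1) by (simp add: sum_negf algebra_simps)
  then have "y \<in> ?Y (active d \<nu> lam y)"
    using y(1) u(1) t(2) by (auto simp: mem_active intro!: exI[of _ t])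
  moreover have "active d \<nu> lam y \<in> Pow {1..d}" by (auto simp: mem_active)
  ultimately show "y \<in> (\<Union>R\<in>Pow {1..d}. ?Y R)" by blast
next
  fix y assume "y \<in> (\<Union>R\<in>Pow {1..d}. ?Y R)"
  then obtain R t where R: "R \<subseteq> {1..d}" "y \<in> P" "\<forall>r\<in>R. l r y = 0" "\<forall>r\<in>R. 0 \<le> t r"
    and t: "gradient \<psi> y + (\<Sum>r\<in>R. t r *\<^sub>R (- real_vec (\<nu> r))) \<in> S"
    by auto
  define u where "u = gradient \<psi> y + (\<Sum>r\<in>R. t r *\<^sub>R (- real_vec (\<nu> r)))"
  have "0 \<le> (u - gradient \<psi> y) \<bullet> (y - z)" if "z \<in> P" for z
  proof -
    have "(u - gradient \<psi> y) \<bullet> (y - z) = (\<Sum>r\<in>R. t r * (l r z - l r y))"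
      by (simp add: u_def inner_sum_left ell_def inner_diff_right right_diff_distrib sum_subtractf sum_negf)
    also have "0 \<le> \<dots>"
      using R that by (intro sum_nonneg) (auto simp: mem_P subset_iff)
    finally show ?thesis .
  qed
  then have "maximiser u = y"
    using R(2) by (intro maximiser_unique) (auto simp: cone_at_def)
  then show "y \<in> maximiser ` S" using t unfolding u_def[symmetric] by blast
qed

lemma closed_maximiser_image:
  assumes "polyhedron S"
  shows "closed (maximiser ` S)"
  unfolding maximiser_image_eq
proof (intro closed_UN finite_Pow_iff[THEN iffD2] finite_atLeastAtMost ballI)
  fix R :: "nat set" assume R: "R \<in> Pow {1..d}"
  define Q where "Q = {x. \<exists>t. (\<forall>r\<in>R. 0 \<le> t r) \<and> x + (\<Sum>r\<in>R. t r *\<^sub>R (- real_vec (\<nu> r))) \<in> S}"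
  have "finite R" using R by (simp add: finite_subset)
  then have "closed Q"
    unfolding Q_def by (rule polyhedron_imp_closed[OF polyhedron_Minkowski_cone[OF _ assms]])
  then have "closed (P \<inter> gradient \<psi> -` Q)"
    by (rule continuous_closed_preimage[OF continuous_gradient_\<psi> compact_imp_closed[OF compact_P]])
  moreover have "closed (\<Inter>r\<in>R. {y. l r y = 0})"
    by (intro closed_INT ballI closed_Collect_eq continuous_intros)
  moreover have "{y\<in>P. (\<forall>r\<in>R. l r y = 0) \<and> gradient \<psi> y \<in> Q} =
      (P \<inter> gradient \<psi> -` Q) \<inter> (\<Inter>r\<in>R. {y. l r y = 0})" by auto
  ultimately show "closed {y\<in>P. (\<forall>r\<in>R. l r y = 0) \<and> gradient \<psi> y \<in> Q}" by (simp add: closed_Int)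
qed

lemma compact_maximiser_tropical_amoeba: "compact (maximiser ` tropical_amoeba P v)"
proof -
  define D where "D = {(m, m'). m \<in> lattice_points P \<and> m' \<in> lattice_points P \<and> m \<noteq> m'}"
  have "finite D"
    by (rule finite_subset[of _ "lattice_points P \<times> lattice_points P"])
       (auto simp: D_def finite_lattice_points)
  have "maximiser ` tropical_amoeba P v = (\<Union>z\<in>D. maximiser `
       ({u. maximal_at (lattice_points P) v u (fst z)} \<inter> {u. maximal_at (lattice_points P) v u (snd z)}))"
    unfolding tropical_amoeba_eq_Union D_def[symmetric] by (auto simp: case_prod_beta)
  moreover have "closed \<dots>"
    by (intro closed_UN \<open>finite D\<close> ballI closed_maximiser_image polyhedron_Int polyhedron_maximal_at)
  moreover have "maximiser ` tropical_amoeba P v \<subseteq> P" using maximiser(1) by auto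
  ultimately have "closed (maximiser ` tropical_amoeba P v)" "bounded (maximiser ` tropical_amoeba P v)"
    using bounded_subset[OF compact_imp_bounded[OF compact_P]] by simp_all
  then show ?thesis by (simp add: compact_eq_bounded_closed)
qed

section \<open>Symplectic potentials\<close>

abbreviation g :: "real^'n \<Rightarrow> real" where "g x \<equiv> g_P d \<nu> lam x + \<phi> x"

lemma smooth_\<phi>: "smooth_on_closed P \<phi>"
  and positive_definite_g: "x \<in> interior P \<Longrightarrow> positive_definite (hessian g x)"
  using \<phi> unfolding C_inf_gP_def Let_def mem_Collect_eq by blast+

lemma differentiable_\<phi>: "x \<in> P \<Longrightarrow> \<phi> differentiable (at x)"
  by (rule smooth_on_closedD(1)[OF smooth_\<phi>])

lemma has_derivative_l [derivative_intros]:
  "(l r has_derivative (\<lambda>w. real_vec (\<nu> r) \<bullet> w)) (at x within S)"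
  unfolding ell_def[abs_def] by (auto intro!: derivative_eq_intros)

lemma has_derivative_l_ln_l:
  assumes "0 < l r x"
  shows "((\<lambda>x. l r x * ln (l r x)) has_derivative (\<lambda>w. (ln (l r x) + 1) * (real_vec (\<nu> r) \<bullet> w))) (at x)"
  using assms by (auto intro!: derivative_eq_intros simp: algebra_simps)

definition grad_gP :: "real^'n \<Rightarrow> real^'n" where
  "grad_gP x = (\<Sum>r=1..d. ((ln (l r x) + 1) / 2) *\<^sub>R real_vec (\<nu> r))"

lemma has_derivative_g_P:
  assumes "x \<in> interior P"
  shows "(g_P d \<nu> lam has_derivative (\<lambda>w. grad_gP x \<bullet> w)) (at x)"
proof -
  have "((\<lambda>x. 1/2 * (\<Sum>r=1..d. l r x * ln (l r x))) has_derivative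
      (\<lambda>w. 1/2 * (\<Sum>r=1..d. (ln (l r x) + 1) * (real_vec (\<nu> r) \<bullet> w)))) (at x)"
    using assms unfolding interior_P
    by (intro has_derivative_mult_right has_derivative_sum has_derivative_l_ln_l) auto
  moreover have "(\<lambda>w. 1/2 * (\<Sum>r=1..d. (ln (l r x) + 1) * (real_vec (\<nu> r) \<bullet> w))) = (\<lambda>w. grad_gP x \<bullet> w)"
    by (simp add: grad_gP_def inner_sum_left sum_divide_distrib)
  ultimately show ?thesis unfolding g_P_def[abs_def] by simp
qed

lemma has_derivative_g:
  assumes "x \<in> interior P"
  shows "(g has_derivative (\<lambda>w. (grad_gP x + gradient \<phi> x) \<bullet> w)) (at x)"
  unfolding inner_add_left
  using assms interior_subset
  by (intro has_derivative_add has_derivative_g_P has_derivative_gradient differentiable_\<phi>) auto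

lemma gradient_g: "x \<in> interior P \<Longrightarrow> gradient g x = grad_gP x + gradient \<phi> x"
  by (rule gradient_unique[OF has_derivative_g])

lemma has_derivative_g_s:
  assumes "x \<in> interior P"
  shows "(g_s d \<nu> lam \<phi> \<psi> s has_derivative (\<lambda>w. (gradient g x + s *\<^sub>R gradient \<psi> x) \<bullet> w)) (at x)"
proof -
  have "x \<in> P" using assms interior_subset by blast
  have "((\<lambda>x. g x + s * \<psi> x) has_derivative (\<lambda>w. gradient g x \<bullet> w + s * (gradient \<psi> x \<bullet> w))) (at x)"
    unfolding gradient_g[OF assms]
    by (intro has_derivative_add[OF has_derivative_g[OF assms]] has_derivative_mult_right
        has_derivative_gradient differentiable_\<psi> \<open>x \<in> P\<close>)
  then show ?thesis by (simp add: g_s_def[abs_def] inner_add_left)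
qed

lemma partial_g_differentiable:
  assumes "x \<in> interior P"
  shows "partial j g differentiable (at x)"
proof -
  have "x \<in> P" using assms interior_subset by blast
  have "partial j \<phi> differentiable (at x)"
    by (rule smooth_on_closedD(2)[OF smooth_\<phi> \<open>x \<in> P\<close>])
  moreover have "(\<lambda>x. \<Sum>r=1..d. ((ln (l r x) + 1) / 2) * real_vec (\<nu> r) $ j) differentiable (at x)"
  proof (intro differentiable_sum finite_atLeastAtMost ballI differentiable_mult differentiable_const)
    fix r assume "r \<in> {1..d}"
    then have "0 < l r x" using assms by (simp add: interior_P)
    then show "(\<lambda>x. (ln (l r x) + 1) / 2) differentiable (at x)"
      by (intro differentiableI[OF has_derivative_divide'[OF has_derivative_add
          [OF has_derivative_ln[OF _ has_derivative_l] has_derivative_const] has_derivative_const]]) auto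
  qed
  ultimately have "(\<lambda>x. (\<Sum>r=1..d. ((ln (l r x) + 1) / 2) * real_vec (\<nu> r) $ j) + partial j \<phi> x) differentiable (at x)"
    by (rule differentiable_add[rotated])
  then obtain D where D: "((\<lambda>x. (\<Sum>r=1..d. ((ln (l r x) + 1) / 2) * real_vec (\<nu> r) $ j) + partial j \<phi> x) has_derivative D) (at x)"
    by (auto simp: differentiable_def)
  have "(partial j g has_derivative D) (at x)"
  proof (rule has_derivative_transform_within_open[OF D open_interior assms])
    fix y assume "y \<in> interior P"
    from gradient_g[OF this]
    have "gradient g y $ j = (grad_gP y + gradient \<phi> y) $ j" by simp
    then show "(\<Sum>r=1..d. ((ln (l r y) + 1) / 2) * real_vec (\<nu> r) $ j) + partial j \<phi> y = partial j g y"
      by (simp add: gradient_def grad_gP_def)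
  qed
  then show ?thesis by (auto simp: differentiable_def)
qed

lemma continuous_g_P: "continuous_on P (g_P d \<nu> lam)"
  unfolding g_P_def[abs_def]
proof (intro continuous_on_mult_left continuous_on_sum)
  fix r assume "r \<in> {1..d}"
  then show "continuous_on P (\<lambda>x. l r x * ln (l r x))"
    by (intro continuous_on_compose2[OF continuous_on_x_ln_x]) (auto intro: continuous_l simp: mem_P)
qed

lemma continuous_on_P: "(\<And>x. x \<in> P \<Longrightarrow> f differentiable (at x)) \<Longrightarrow> continuous_on P f"
  for f :: "real^'n \<Rightarrow> 'b::real_normed_vector"
  by (rule differentiable_imp_continuous_on) (simp add: differentiable_at_imp_differentiable_on)

lemma continuous_g: "continuous_on P g"
  by (intro continuous_on_add continuous_g_P continuous_on_P differentiable_\<phi>)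

text \<open>In the interior this is positivity of the Hessian. For \<open>y\<close> on the boundary, where \<open>g\<close> is only
  continuous, it follows by density of the interior.\<close>

lemma convexity_g:
  assumes x: "x \<in> interior P" and y: "y \<in> P"
  shows "g x + gradient g x \<bullet> (y - x) \<le> g y"
proof -
  have int: "g x + gradient g x \<bullet> (y - x) \<le> g y" if "y \<in> interior P" for y
  proof -
    have "g x + gradient g x \<bullet> (y - x) + 0 / 2 * ((y - x) \<bullet> (y - x)) \<le> g y"
    proof (rule second_order_lower_bound[OF convex_interior[OF convex_P] x that])
      fix z assume z: "z \<in> interior P"
      show "g differentiable (at z)" using has_derivative_g[OF z] by (rule differentiableI)
      show "partial j g differentiable (at z)" for j by (rule partial_g_differentiable[OF z])
      show "0 * (w \<bullet> w) \<le> w \<bullet> (hessian g z *v w)" for w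
        using positive_definite_g[OF z] unfolding positive_definite_def
        by (cases "w = 0") (auto intro: less_imp_le)
    qed
    then show ?thesis by simp
  qed
  have "closed {y\<in>P. g x + gradient g x \<bullet> (y - x) \<le> g y}"
    by (intro continuous_on_closed_Collect_le continuous_g compact_imp_closed[OF compact_P] continuous_intros)
  moreover have "interior P \<subseteq> {y\<in>P. g x + gradient g x \<bullet> (y - x) \<le> g y}"
    using int interior_subset by blast
  ultimately have "closure (interior P) \<subseteq> {y\<in>P. g x + gradient g x \<bullet> (y - x) \<le> g y}"
    by (rule closure_minimal[rotated])
  then show ?thesis using y P_subset_closure_interior by blast
qed

section \<open>The rescaled logarithmic map\<close>

text \<open>Let \<open>x\<close> be a minimiser of \<open>g\<^sub>P + f\<close> on \<open>P\<close> and suppose that some facets are active at \<open>x\<close>. Moving from \<open>x\<close> a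
  distance \<open>t\<close> towards an interior point changes the terms of these facets by \<open>t (K + N ln t)\<close> with
  \<open>N > 0\<close>, and everything else by \<open>O(t)\<close>. For small \<open>t\<close> the sum is negative, contradicting minimality.\<close>

lemma exists_interior_critical_point:
  assumes f: "\<And>x. x \<in> P \<Longrightarrow> f differentiable (at x)"
  obtains x where "x \<in> interior P" "grad_gP x + gradient f x = 0"
proof -
  define G where "G x = g_P d \<nu> lam x + f x" for x
  have "continuous_on P G"
    unfolding G_def[abs_def] by (intro continuous_on_add continuous_g_P continuous_on_P f)
  then obtain x where x: "x \<in> P" "\<And>y. y \<in> P \<Longrightarrow> G x \<le> G y"
    using continuous_attains_inf[OF compact_P P_nonempty] by blast
  have "x \<in> interior P"
  proof (rule ccontr)
    assume "x \<notin> interior P"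
    define A where "A = active d \<nu> lam x"
    have A: "A \<subseteq> {1..d}" "A \<noteq> {}" "finite A"
    proof -
      obtain r where "r \<in> {1..d}" "\<not> 0 < l r x" using \<open>x \<notin> interior P\<close> by (auto simp: interior_P)
      then have "r \<in> A" using x(1) by (force simp: A_def mem_active mem_P)
      then show "A \<noteq> {}" by blast
    qed (auto simp: A_def active_def)
    have not_A: "0 < l r x" if "r \<in> {1..d} - A" for r
      using that x(1) by (force simp: A_def mem_active mem_P)
    obtain z where z: "z \<in> interior P" using interior_P_nonempty by blast
    define w where "w = z - x"
    \<comment> \<open>The part of the function that is differentiable at \<open>x\<close>.\<close>
    define F where "F y = f y + 1/2 * (\<Sum>r\<in>{1..d} - A. l r y * ln (l r y))" for y
    define N where "N = 1/2 * (\<Sum>r\<in>A. l r z)"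
    define K where "K = 1/2 * (\<Sum>r\<in>A. l r z * ln (l r z))"
    have "N > 0" using z A by (auto simp: N_def interior_P intro!: sum_pos)
    have seg: "x + t *\<^sub>R w \<in> P" if "0 \<le> t" "t \<le> 1" for t
    proof -
      have "x + t *\<^sub>R w = (1 - t) *\<^sub>R x + t *\<^sub>R z" by (simp add: w_def algebra_simps)
      moreover have "z \<in> P" using z interior_subset by blast
      ultimately show ?thesis using convex_P x(1) that by (simp add: convexD_alt)
    qed
    have split: "(\<Sum>r=1..d. h r) = (\<Sum>r\<in>A. h r) + (\<Sum>r\<in>{1..d} - A. h r)" for h :: "nat \<Rightarrow> real"
      using sum.subset_diff[OF A(1), of h] by simp
    have G_line: "G (x + t *\<^sub>R w) - G x = F (x + t *\<^sub>R w) - F x + t * (K + N * ln t)" if "0 < t" for t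
    proof -
      have "(\<Sum>r\<in>A. l r (x + t *\<^sub>R w) * ln (l r (x + t *\<^sub>R w))) = (\<Sum>r\<in>A. t * (l r z * ln (l r z) + l r z * ln t))"
      proof (rule sum.cong[OF refl])
        fix r assume r: "r \<in> A"
        then have "l r x = 0" by (simp add: A_def mem_active)
        moreover have "x + t *\<^sub>R w = (1 - t) *\<^sub>R x + t *\<^sub>R z" by (simp add: w_def algebra_simps)
        ultimately have "l r (x + t *\<^sub>R w) = t * l r z" by (simp add: l_convex_combination)
        moreover have "0 < l r z" using r A z by (auto simp: interior_P)
        ultimately show "l r (x + t *\<^sub>R w) * ln (l r (x + t *\<^sub>R w)) = t * (l r z * ln (l r z) + l r z * ln t)"
          using \<open>0 < t\<close> by (simp add: ln_mult algebra_simps)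
      qed
      also have "\<dots> = t * ((\<Sum>r\<in>A. l r z * ln (l r z)) + (\<Sum>r\<in>A. l r z) * ln t)"
        by (simp add: sum_distrib_left[symmetric] sum.distrib sum_distrib_right)
      finally have 1: "(\<Sum>r\<in>A. l r (x + t *\<^sub>R w) * ln (l r (x + t *\<^sub>R w))) = t * (2 * K + 2 * N * ln t)"
        by (simp add: K_def N_def)
      have 2: "(\<Sum>r\<in>A. l r x * ln (l r x)) = 0"
        by (rule sum.neutral) (simp add: A_def mem_active)
      show ?thesis
        unfolding G_def F_def g_P_def split 1 2 by (simp add: algebra_simps)
    qed
    have "((\<lambda>y. 1/2 * (\<Sum>r\<in>{1..d} - A. l r y * ln (l r y))) has_derivative
        (\<lambda>w. 1/2 * (\<Sum>r\<in>{1..d} - A. (ln (l r x) + 1) * (real_vec (\<nu> r) \<bullet> w)))) (at x)"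
      by (intro has_derivative_mult_right has_derivative_sum has_derivative_l_ln_l not_A)
    then have "F differentiable (at x)"
      unfolding F_def by (intro differentiable_add f x(1)) (rule differentiableI)
    then have "((\<lambda>t. F (x + t *\<^sub>R w)) has_real_derivative gradient F (x + 0 *\<^sub>R w) \<bullet> w) (at 0)"
      by (intro has_real_derivative_along_line) simp
    then obtain D where "((\<lambda>t. F (x + t *\<^sub>R w)) has_real_derivative D) (at 0)" by blast
    then have "((\<lambda>t. (F (x + t *\<^sub>R w) - F x) / t) \<longlongrightarrow> D) (at 0)"
      by (simp add: has_field_derivative_iff)
    then have "((\<lambda>t. (F (x + t *\<^sub>R w) - F x) / t) \<longlongrightarrow> D) (at_right 0)"
      by (rule tendsto_within_subset[OF _ subset_UNIV])
    then have "\<forall>\<^sub>F t in at_right 0. (F (x + t *\<^sub>R w) - F x) / t < D + 1"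
      by (rule order_tendstoD) simp
    moreover have "\<forall>\<^sub>F t in at_right 0. ln t < - (D + 1 + K) / N"
      using ln_at_0 unfolding filterlim_at_bot_dense by blast
    moreover have "\<forall>\<^sub>F t in at_right 0. t \<in> {0<..<1::real}"
      using eventually_at_right_real[OF zero_less_one] by simp
    ultimately have "\<forall>\<^sub>F t in at_right (0::real). False"
    proof eventually_elim
      case (elim t)
      then have t: "0 < t" "t < 1" by auto
      have "F (x + t *\<^sub>R w) - F x < t * (D + 1)"
        using elim(1) t by (simp add: divide_less_eq mult.commute)
      have "N * ln t < - (D + 1 + K)"
        using elim(2) \<open>N > 0\<close> by (simp add: less_divide_eq mult.commute)
      then have "t * (K + N * ln t) < t * (- (D + 1))"
        using t by (intro mult_strict_left_mono) auto
      also have "\<dots> = - (t * (D + 1))" by (simp add: algebra_simps)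
      finally have "G (x + t *\<^sub>R w) - G x < 0"
        using G_line[OF t(1)] \<open>F (x + t *\<^sub>R w) - F x < t * (D + 1)\<close> by linarith
      moreover have "G x \<le> G (x + t *\<^sub>R w)" using x(2)[OF seg] t by simp
      ultimately show False by linarith
    qed
    then show False by simp
  qed
  moreover have "grad_gP x + gradient f x = 0"
  proof -
    have "(G has_derivative (\<lambda>w. (grad_gP x + gradient f x) \<bullet> w)) (at x)"
      unfolding G_def[abs_def] inner_add_left
      by (intro has_derivative_add has_derivative_g_P has_derivative_gradient f x(1) \<open>x \<in> interior P\<close>)
    then have "(\<lambda>w. (grad_gP x + gradient f x) \<bullet> w) = (\<lambda>w. 0)"
      by (rule differential_zero_maxmin[OF \<open>x \<in> interior P\<close> open_interior])
         (use x(2) interior_subset in blast)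
    then show ?thesis by (metis inner_eq_zero_iff)
  qed
  ultimately show thesis by (rule that)
qed

text \<open>This is the gradient of \<open>g\<^sub>s\<close> divided by \<open>s\<close>, that is, \<open>1/s\<close> times the vector of the logarithms of \<open>|w|\<close> on the
  open orbit.\<close>

definition rescaled_log :: "real \<Rightarrow> real^'n \<Rightarrow> real^'n" where
  "rescaled_log s x = gradient \<psi> x + (1 / s) *\<^sub>R gradient g x"

text \<open>The point sought is a critical point of \<open>g\<^sub>s x - s (u \<bullet> x)\<close>.\<close>

lemma rescaled_log_surj:
  assumes "s > 0"
  obtains x where "x \<in> interior P" "rescaled_log s x = u"
proof -
  have D: "((\<lambda>x. \<phi> x + s * \<psi> x - s * (u \<bullet> x)) has_derivative
      (\<lambda>w. (gradient \<phi> x + s *\<^sub>R gradient \<psi> x - s *\<^sub>R u) \<bullet> w)) (at x)" if "x \<in> P" for x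
    unfolding inner_add_left inner_diff_left inner_scaleR_left
    by (intro derivative_intros has_derivative_gradient differentiable_\<phi> differentiable_\<psi> that)
  obtain x where x: "x \<in> interior P" "grad_gP x + gradient (\<lambda>x. \<phi> x + s * \<psi> x - s * (u \<bullet> x)) x = 0"
    using exists_interior_critical_point[of "\<lambda>x. \<phi> x + s * \<psi> x - s * (u \<bullet> x)"] D differentiableI by blast
  have "x \<in> P" using x(1) interior_subset by blast
  from x(2) have "gradient g x + s *\<^sub>R gradient \<psi> x = s *\<^sub>R u"
    unfolding gradient_unique[OF D[OF \<open>x \<in> P\<close>]] gradient_g[OF x(1)] by (simp add: algebra_simps)
  then have "(1 / s) *\<^sub>R (gradient g x + s *\<^sub>R gradient \<psi> x) = (1 / s) *\<^sub>R (s *\<^sub>R u)"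
    by simp
  then have "rescaled_log s x = u"
    using assms by (simp add: rescaled_log_def scaleR_right_distrib add.commute)
  with x(1) show thesis by (rule that)
qed

text \<open>By convexity of \<open>g\<close>, the point \<open>x\<close> maximises \<open>u \<bullet> y - (\<psi> y + g y / s)\<close> for \<open>u = rescaled_log s x\<close>, and
  \<open>g\<close> is bounded on \<open>P\<close>.\<close>

lemma maximiser_rescaled_log:
  "\<exists>K. \<forall>s>0. \<forall>x\<in>interior P. (dist x (maximiser (rescaled_log s x)))\<^sup>2 \<le> K / s"
proof -
  have "bounded (g ` P)"
    by (intro compact_imp_bounded compact_continuous_image continuous_g compact_P)
  then obtain K where K: "\<And>y. y \<in> P \<Longrightarrow> \<bar>g y\<bar> \<le> K"
    by (auto simp: bounded_iff)
  have "(dist x (maximiser (rescaled_log s x)))\<^sup>2 \<le> (4 * K / c) / s"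
    if s: "s > 0" and x: "x \<in> interior P" for s x
  proof -
    have xP: "x \<in> P" using x interior_subset by blast
    have "(dist x (maximiser (rescaled_log s x)))\<^sup>2 \<le> 4 * K / (c * s)"
    proof (rule dist_maximiser_perturbed[OF xP K s])
      fix y assume y: "y \<in> P"
      have "\<psi> x + gradient \<psi> x \<bullet> (y - x) \<le> \<psi> y"
        using strong_convexity[OF xP y] c_pos
        by (smt (verit) divide_nonneg_pos mult_nonneg_nonneg zero_le_power2)
      moreover have "(g x + gradient g x \<bullet> (y - x)) / s \<le> g y / s"
        using convexity_g[OF x y] s by (intro divide_right_mono) auto
      ultimately show "\<psi> x + g x / s + rescaled_log s x \<bullet> (y - x) \<le> \<psi> y + g y / s"
        by (simp add: rescaled_log_def inner_add_left add_divide_distrib)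
    qed
    then show ?thesis by simp
  qed
  then show ?thesis by blast
qed

end

section \<open>Vertex charts and monomial sections\<close>

lemma power_int_sum:
  fixes x :: "'a::field"
  assumes "x \<noteq> 0"
  shows "(\<Prod>i\<in>I. x powi f i) = x powi (\<Sum>i\<in>I. f i)"
  by (induction I rule: infinite_finite_induct) (simp_all add: power_int_add assms)

lemma sqrt_powi_eq_exp:
  assumes "0 < x"
  shows "sqrt x powi n = exp (of_int n * (ln x / 2))"
proof -
  have "sqrt x = exp (ln x / 2)"
    using assms by (simp add: ln_sqrt[symmetric])
  then show ?thesis by (simp add: exp_power_int)
qed

lemma exp_plus_int_2pi_i: "exp (z + of_real (2 * of_int n * pi) * \<i>) = exp z"
  unfolding exp_eq by (intro exI[of _ n]) simp

context toric_degeneration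
begin

lemma of_int_ell_int: "of_int (ell_int \<nu> lam r m) = l r (real_vec m)"
  by (simp add: ell_int_def ell_def of_int_pairing[symmetric] pairing_def)

lemma ell_int_nonneg: "m \<in> lattice_points P \<Longrightarrow> r \<in> {1..d} \<Longrightarrow> 0 \<le> ell_int \<nu> lam r m"
  using of_int_ell_int[of r m] by (simp add: lattice_points_def mem_P flip: of_int_0_le_iff[where 'a = real])

text \<open>The gradient of \<open>g\<^sub>s\<close> without its logarithmic terms; it is continuous up to the boundary of \<open>P\<close>.\<close>

definition regular_part :: "real \<Rightarrow> real^'n \<Rightarrow> real^'n" where
  "regular_part s x = (1/2) *\<^sub>R (\<Sum>r=1..d. real_vec (\<nu> r)) + gradient \<phi> x + s *\<^sub>R gradient \<psi> x"

lemma continuous_gradient_\<phi>: "continuous_on P (gradient \<phi>)"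
  unfolding gradient_def[abs_def]
  by (intro continuous_on_vec_lambda continuous_on_P smooth_on_closedD(2)[OF smooth_\<phi>])

lemma continuous_regular_part: "continuous_on P (regular_part s)"
  unfolding regular_part_def
  by (intro continuous_intros continuous_gradient_\<phi> continuous_gradient_\<psi>)

text \<open>With \<open>e r = \<nu>\<^sub>r \<bullet> k\<close> this is the extension to the boundary of the function \<open>w\<close> to the power \<open>k\<close> on the open orbit: in
  \<open>exp (k \<bullet> \<partial>g\<^sub>s/\<partial>x)\<close> the logarithm of \<open>\<ell>\<^sub>r\<close> has the coefficient \<open>e r / 2\<close>. The exponents \<open>e\<close> are kept separate from
  \<open>k\<close> so that sections, whose exponents are shifted by \<open>\<lambda>\<^sub>r\<close>, have the same form. At the boundary
  the values rely on \<open>0 powi 0 = 1\<close>.\<close>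

definition toric_monomial :: "real \<Rightarrow> (nat \<Rightarrow> int) \<Rightarrow> real^'n \<Rightarrow> (real^'n) \<times> (real^'n) \<Rightarrow> complex" where
  "toric_monomial s e k z =
     of_real (\<Prod>r=1..d. sqrt (l r (fst z)) powi e r) *
     exp (of_real (k \<bullet> regular_part s (fst z)) + \<i> * of_real (k \<bullet> snd z))"

lemma toric_monomial_open_orbit:
  assumes x: "x \<in> interior P"
  shows "toric_monomial s (\<lambda>r. pairing (\<nu> r) k) (real_vec k) (x, \<theta>) =
    exp (of_real (real_vec k \<bullet> (gradient g x + s *\<^sub>R gradient \<psi> x)) + \<i> * of_real (real_vec k \<bullet> \<theta>))"
proof -
  have "(\<Prod>r=1..d. sqrt (l r x) powi pairing (\<nu> r) k) =
      (\<Prod>r=1..d. exp (real_vec k \<bullet> real_vec (\<nu> r) * (ln (l r x) / 2)))"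
    using x by (intro prod.cong) (auto simp: interior_P sqrt_powi_eq_exp of_int_pairing inner_commute)
  also have "\<dots> = exp (\<Sum>r=1..d. real_vec k \<bullet> real_vec (\<nu> r) * (ln (l r x) / 2))"
    by (simp add: exp_sum)
  finally have "(\<Prod>r=1..d. sqrt (l r x) powi pairing (\<nu> r) k) = \<dots>" .
  moreover have "(\<Sum>r=1..d. real_vec k \<bullet> real_vec (\<nu> r) * (ln (l r x) / 2)) + real_vec k \<bullet> regular_part s x =
      real_vec k \<bullet> (gradient g x + s *\<^sub>R gradient \<psi> x)"
    unfolding gradient_g[OF x] grad_gP_def regular_part_def
    by (simp add: inner_add_right inner_sum_right add_divide_distrib distrib_left sum.distrib sum_divide_distrib mult.commute)
  moreover have "complex_of_real (exp E) * exp (of_real R + X) = exp (of_real (E + R) + X)" for E R X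
    by (simp add: exp_of_real[symmetric] exp_add[symmetric] add.assoc)
  ultimately show ?thesis
    by (simp only: toric_monomial_def fst_conv snd_conv)
qed

lemma continuous_toric_monomial:
  assumes "D \<subseteq> P" "\<And>x r. x \<in> D \<Longrightarrow> r \<in> {1..d} \<Longrightarrow> l r x = 0 \<Longrightarrow> 0 \<le> e r"
  shows "continuous_on (D \<times> UNIV) (toric_monomial s e k)"
proof -
  have "continuous_on (D \<times> UNIV) (\<lambda>z. sqrt (l r (fst z)) powi e r)" if r: "r \<in> {1..d}" for r
  proof (rule continuous_on_power_int)
    show "continuous_on (D \<times> UNIV) (\<lambda>z. sqrt (l r (fst z)))"
      unfolding ell_def by (intro continuous_intros)
    show "0 \<le> e r \<or> (\<forall>z\<in>D \<times> UNIV. sqrt (l r (fst z)) \<noteq> 0)"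
      using assms(2) r by fastforce
  qed
  moreover have "continuous_on (D \<times> (UNIV :: (real^'n) set)) (\<lambda>z. regular_part s (fst z))"
    by (rule continuous_on_compose2[OF continuous_regular_part]) (use assms(1) in \<open>auto intro: continuous_intros\<close>)
  ultimately show ?thesis
    unfolding toric_monomial_def
    by (intro continuous_on_mult continuous_on_of_real continuous_on_prod continuous_on_exp
        continuous_on_add continuous_on_const continuous_on_inner continuous_on_snd continuous_on_id)
qed

lemma at_within_open_orbit_nontrivial:
  fixes \<theta> :: "real^'n"
  assumes "x \<in> P"
  shows "at (x, \<theta>) within interior P \<times> UNIV \<noteq> bot"
proof -
  have "(x, \<theta>) \<in> closure (interior P \<times> UNIV)"
    using assms P_subset_closure_interior by (auto simp: closure_Times)
  moreover have "(x, \<theta>) islimpt (interior P \<times> UNIV)" if "(x, \<theta>) \<in> interior P \<times> UNIV"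
    using that by (intro interior_limit_point) (simp add: interior_open open_Times)
  ultimately show ?thesis
    unfolding trivial_limit_within closure_def by blast
qed

text \<open>A global version of the section of \<open>m\<close>. It is the representative in the chart of a vertex \<open>q\<close> times the
  function belonging to \<open>q\<close> itself (\<open>section_monomial_eq_sigma\<close>). The exponents \<open>\<ell>\<^sub>r(m)\<close> are nonnegative, so it is
  continuous on all of \<open>P \<times> \<real>\<^sup>n\<close>, and zeros in different charts can be compared.\<close>

definition section_monomial :: "real \<Rightarrow> int^'n \<Rightarrow> (real^'n) \<times> (real^'n) \<Rightarrow> complex" where
  "section_monomial s m = toric_monomial s (\<lambda>r. ell_int \<nu> lam r m) (real_vec m)"

lemma continuous_section_monomial:
  assumes "m \<in> lattice_points P"
  shows "continuous_on (P \<times> UNIV) (section_monomial s m)"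
  unfolding section_monomial_def
  by (rule continuous_toric_monomial) (auto intro: ell_int_nonneg[OF assms])

text \<open>The common factor by which all sections differ from plain exponentials on the open orbit.\<close>

definition orbit_factor :: "real^'n \<Rightarrow> real" where
  "orbit_factor x = (\<Prod>r=1..d. sqrt (l r x) powi (- lam r))"

lemma section_monomial_open_orbit:
  assumes x: "x \<in> interior P"
  shows "section_monomial s m (x, \<theta>) = of_real (orbit_factor x) *
    exp (of_real (real_vec m \<bullet> (gradient g x + s *\<^sub>R gradient \<psi> x)) + \<i> * of_real (real_vec m \<bullet> \<theta>))"
    and "orbit_factor x > 0"
proof -
  have "(\<Prod>r=1..d. sqrt (l r x) powi ell_int \<nu> lam r m) =
     (\<Prod>r=1..d. sqrt (l r x) powi (- lam r) * sqrt (l r x) powi pairing (\<nu> r) m)"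
  proof (rule prod.cong[OF refl])
    fix r assume "r \<in> {1..d}"
    then have "0 < l r x" using x by (simp add: interior_P)
    then have "sqrt (l r x) \<noteq> 0" by simp
    then show "sqrt (l r x) powi ell_int \<nu> lam r m = sqrt (l r x) powi (- lam r) * sqrt (l r x) powi pairing (\<nu> r) m"
      by (simp add: power_int_add[symmetric] ell_int_def pairing_def del: power_int_minus)
  qed
  then have "section_monomial s m (x, \<theta>) =
      of_real (orbit_factor x) * toric_monomial s (\<lambda>r. pairing (\<nu> r) m) (real_vec m) (x, \<theta>)"
    by (simp add: section_monomial_def toric_monomial_def orbit_factor_def prod.distrib)
  then show "section_monomial s m (x, \<theta>) = of_real (orbit_factor x) *
    exp (of_real (real_vec m \<bullet> (gradient g x + s *\<^sub>R gradient \<psi> x)) + \<i> * of_real (real_vec m \<bullet> \<theta>))"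
    unfolding toric_monomial_open_orbit[OF x] .
  show "orbit_factor x > 0"
    unfolding orbit_factor_def using x by (intro prod_pos zero_less_power_int) (auto simp: interior_P)
qed

lemma section_monomial_periodic:
  "section_monomial s m (x, \<theta> + (2 * pi) *\<^sub>R real_vec k) = section_monomial s m (x, \<theta>)"
proof -
  have "exp (of_real (real_vec m \<bullet> regular_part s x) + \<i> * of_real (real_vec m \<bullet> (\<theta> + (2 * pi) *\<^sub>R real_vec k))) =
     exp (of_real (real_vec m \<bullet> regular_part s x) + \<i> * of_real (real_vec m \<bullet> \<theta>) +
       of_real (2 * of_int (pairing m k) * pi) * \<i>)"
    by (simp add: inner_add_right of_int_pairing[symmetric] algebra_simps)
  also have "\<dots> = exp (of_real (real_vec m \<bullet> regular_part s x) + \<i> * of_real (real_vec m \<bullet> \<theta>))"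
    by (rule exp_plus_int_2pi_i)
  finally show ?thesis
    by (simp add: section_monomial_def toric_monomial_def)
qed

lemma toric_fibre:
  assumes x: "x \<in> P" and p: "p = toric_rel d \<nu> lam `` {(x, \<theta>)}"
  shows "(x, \<theta>) \<in> p" "moment_map p = x"
    "\<forall>z\<in>p. fst z = x \<and> (\<exists>k. snd z - \<theta> - (2 * pi) *\<^sub>R real_vec k \<in> span ((\<lambda>r. real_vec (\<nu> r)) ` active d \<nu> lam x))"
proof -
  have "\<theta> - \<theta> - (2 * pi) *\<^sub>R real_vec 0 = 0"
    by (simp add: real_vec_def vec_eq_iff)
  then show mem: "(x, \<theta>) \<in> p"
    using x unfolding p toric_rel_def by (auto intro!: exI[of _ 0] simp: span_zero)
  show all: "\<forall>z\<in>p. fst z = x \<and> (\<exists>k. snd z - \<theta> - (2 * pi) *\<^sub>R real_vec k \<in> span ((\<lambda>r. real_vec (\<nu> r)) ` active d \<nu> lam x))"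
    unfolding p toric_rel_def by auto
  show "moment_map p = x"
    unfolding moment_map_def using mem all by (intro the_equality) auto
qed

text \<open>On the open orbit the \<open>w\<^sub>j\<close> are toric monomials with direction \<open>k j\<close>. These are continuous wherever the
  facets with a negative exponent are inactive, in particular on the domain of the chart of \<open>q\<close>, since at \<open>q\<close> the
  exponents are \<open>0\<close> and \<open>1\<close>. All representatives of \<open>p\<close> give the same limit: if the facet \<open>\<rho> j\<close> is active at
  \<open>x\<close>, the monomial vanishes there; otherwise \<open>k j\<close> is orthogonal to all normals active at \<open>x\<close>, and
  the angle changes by a multiple of \<open>2\<pi>\<close>.\<close>

lemma w_chart_eq:
  assumes \<rho>: "vertex_ordering d \<nu> lam q \<rho>"
    and dual: "\<forall>i j. real_vec (\<nu> (\<rho> i)) \<bullet> real_vec (k j) = (if i = j then 1 else 0)"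
    and inv: "\<forall>j. matrix_inv (normal_matrix \<nu> \<rho>) *v axis j 1 = real_vec (k j)"
    and x: "x \<in> P_q P q"
    and p: "(x, \<theta>) \<in> p"
      "\<forall>z\<in>p. fst z = x \<and> (\<exists>k. snd z - \<theta> - (2 * pi) *\<^sub>R real_vec k \<in> span ((\<lambda>r. real_vec (\<nu> r)) ` active d \<nu> lam x))"
  shows "w_chart d \<nu> lam (g_s d \<nu> lam \<phi> \<psi> s) \<rho> p =
    (\<chi> j. toric_monomial s (\<lambda>r. pairing (\<nu> r) (k j)) (real_vec (k j)) (x, \<theta>))"
proof -
  define W where "W z = (\<chi> j. toric_monomial s (\<lambda>r. pairing (\<nu> r) (k j)) (real_vec (k j)) z)" for z
  have xP: "x \<in> P" and sub: "active d \<nu> lam x \<subseteq> active d \<nu> lam q"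
    using mem_P_q_imp[OF x] by auto
  have nonneg: "0 \<le> pairing (\<nu> r) (k j)" if r: "r \<in> active d \<nu> lam q" for r j
  proof -
    obtain i where "r = \<rho> i" using \<rho> r by (rule vertex_ordering_surj)
    then have "0 \<le> (of_int (pairing (\<nu> r) (k j)) :: real)" unfolding of_int_pairing by (simp add: dual)
    then show ?thesis by simp
  qed
  have w_open: "w_open (normal_matrix \<nu> \<rho>) (g_s d \<nu> lam \<phi> \<psi> s) (y, \<eta>) = W (y, \<eta>)" if y: "y \<in> interior P" for y \<eta>
  proof -
    have "frechet_derivative (g_s d \<nu> lam \<phi> \<psi> s) (at y) w = (gradient g y + s *\<^sub>R gradient \<psi> y) \<bullet> w" for w
      using frechet_derivative_at[OF has_derivative_g_s[OF y]] by metis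
    moreover have "(transpose (matrix_inv (normal_matrix \<nu> \<rho>)) *v \<eta>) $ j = real_vec (k j) \<bullet> \<eta>" for j
    proof -
      have "(transpose (matrix_inv (normal_matrix \<nu> \<rho>)) *v \<eta>) $ j =
          (transpose (matrix_inv (normal_matrix \<nu> \<rho>)) *v \<eta>) \<bullet> axis j 1" by (simp add: inner_axis)
      also have "\<dots> = \<eta> \<bullet> (matrix_inv (normal_matrix \<nu> \<rho>) *v axis j 1)"
        by (simp add: dot_lmul_matrix)
      finally show ?thesis using inv by (simp add: inner_commute)
    qed
    ultimately show ?thesis
      by (simp add: w_open_def W_def inv toric_monomial_open_orbit[OF y] vec_eq_iff inner_commute)
  qed
  have lim: "(w_open (normal_matrix \<nu> \<rho>) (g_s d \<nu> lam \<phi> \<psi> s) \<longlongrightarrow> W (x, \<eta>))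
      (at (x, \<eta>) within interior P \<times> UNIV)" for \<eta>
  proof -
    define D where "D = {y \<in> P. active d \<nu> lam y \<subseteq> active d \<nu> lam q}"
    have "continuous_on (D \<times> UNIV) W"
      unfolding W_def
    proof (intro continuous_on_vec_lambda continuous_toric_monomial)
      fix j y r assume "y \<in> D" "r \<in> {1..d}" "l r y = 0"
      then have "r \<in> active d \<nu> lam q" by (auto simp: D_def mem_active)
      then show "0 \<le> pairing (\<nu> r) (k j)" by (rule nonneg)
    qed (auto simp: D_def)
    moreover have "(x, \<eta>) \<in> D \<times> UNIV" using xP sub by (simp add: D_def)
    ultimately have "(W \<longlongrightarrow> W (x, \<eta>)) (at (x, \<eta>) within D \<times> UNIV)"
      unfolding continuous_on_def by blast
    moreover have "interior P \<subseteq> D"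
    proof
      fix y assume y: "y \<in> interior P"
      then have "active d \<nu> lam y = {}" by (force simp: interior_P active_def)
      moreover have "y \<in> P" using y interior_subset by blast
      ultimately show "y \<in> D" by (simp add: D_def)
    qed
    ultimately have "(W \<longlongrightarrow> W (x, \<eta>)) (at (x, \<eta>) within interior P \<times> UNIV)"
      by (elim tendsto_within_subset) auto
    then show ?thesis
      by (rule tendsto_cong[THEN iffD1, rotated])
         (simp add: eventually_at_filter, rule always_eventually, auto simp: w_open)
  qed
  have W_const: "W z = W (x, \<theta>)" if z: "z \<in> p" for z
  proof -
    obtain \<eta> where \<eta>: "z = (x, \<eta>)" using p(2) z by (metis prod.collapse)
    obtain k0 where k0: "\<eta> - \<theta> - (2 * pi) *\<^sub>R real_vec k0 \<in> span ((\<lambda>r. real_vec (\<nu> r)) ` active d \<nu> lam x)"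
      using p(2) z \<eta> by auto
    have "toric_monomial s (\<lambda>r. pairing (\<nu> r) (k j)) (real_vec (k j)) (x, \<eta>) =
        toric_monomial s (\<lambda>r. pairing (\<nu> r) (k j)) (real_vec (k j)) (x, \<theta>)" for j
    proof (cases "\<rho> j \<in> active d \<nu> lam x")
      case True
      have "(of_int (pairing (\<nu> (\<rho> j)) (k j)) :: real) = 1" unfolding of_int_pairing by (simp add: dual)
      then have "sqrt (l (\<rho> j) x) powi pairing (\<nu> (\<rho> j)) (k j) = 0"
        using True by (simp add: mem_active)
      then have "(\<Prod>r=1..d. sqrt (l r x) powi pairing (\<nu> r) (k j)) = 0"
        using True by (intro prod_zero) (auto simp: mem_active)
      then show ?thesis by (simp add: toric_monomial_def)
    next
      case False
      have "orthogonal (real_vec (k j)) (\<eta> - \<theta> - (2 * pi) *\<^sub>R real_vec k0)"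
      proof (rule orthogonal_to_span[OF k0])
        fix y assume "y \<in> (\<lambda>r. real_vec (\<nu> r)) ` active d \<nu> lam x"
        then obtain r where r: "r \<in> active d \<nu> lam x" "y = real_vec (\<nu> r)" by blast
        obtain i where i: "r = \<rho> i" using \<rho> subsetD[OF sub r(1)] by (rule vertex_ordering_surj)
        then have "i \<noteq> j" using r(1) False by auto
        then show "orthogonal (real_vec (k j)) y"
          by (simp add: orthogonal_def r(2) i dual inner_commute[of "real_vec (k j)"])
      qed
      then have "real_vec (k j) \<bullet> \<eta> = real_vec (k j) \<bullet> \<theta> + 2 * pi * of_int (pairing (k j) k0)"
        by (simp add: orthogonal_def inner_diff_right of_int_pairing)
      then have "of_real (real_vec (k j) \<bullet> regular_part s x) + \<i> * of_real (real_vec (k j) \<bullet> \<eta>) =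
         of_real (real_vec (k j) \<bullet> regular_part s x) + \<i> * of_real (real_vec (k j) \<bullet> \<theta>) +
         of_real (2 * of_int (pairing (k j) k0) * pi) * \<i>"
        by (simp add: algebra_simps)
      then show ?thesis
        unfolding toric_monomial_def by (simp only: fst_conv snd_conv exp_plus_int_2pi_i)
    qed
    then show ?thesis by (simp add: W_def \<eta>)
  qed
  have "w_chart d \<nu> lam (g_s d \<nu> lam \<phi> \<psi> s) \<rho> p = W (x, \<theta>)"
    unfolding w_chart_def
  proof (rule the_equality)
    show "\<forall>z\<in>p. (w_open (normal_matrix \<nu> \<rho>) (g_s d \<nu> lam \<phi> \<psi> s) \<longlongrightarrow> W (x, \<theta>))
        (at z within interior P \<times> UNIV)"
    proof
      fix z assume z: "z \<in> p"
      then obtain \<eta> where \<eta>: "z = (x, \<eta>)" using p(2) by (metis prod.collapse)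
      show "(w_open (normal_matrix \<nu> \<rho>) (g_s d \<nu> lam \<phi> \<psi> s) \<longlongrightarrow> W (x, \<theta>)) (at z within interior P \<times> UNIV)"
        using lim[of \<eta>] W_const[OF z] by (simp add: \<eta>)
    qed
    fix c assume "\<forall>z\<in>p. (w_open (normal_matrix \<nu> \<rho>) (g_s d \<nu> lam \<phi> \<psi> s) \<longlongrightarrow> c)
        (at z within interior P \<times> UNIV)"
    then have "(w_open (normal_matrix \<nu> \<rho>) (g_s d \<nu> lam \<phi> \<psi> s) \<longlongrightarrow> c) (at (x, \<theta>) within interior P \<times> UNIV)"
      using p(1) by blast
    then show "c = W (x, \<theta>)"
      by (rule tendsto_unique[OF at_within_open_orbit_nontrivial[OF xP] _ lim])
  qed
  then show ?thesis by (simp add: W_def)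
qed

text \<open>The exponents of \<open>\<sigma>\<^sup>m\<close> in the chart are the coordinates of \<open>m - q\<close> in the basis \<open>k j\<close>. For facets
  not containing \<open>x\<close> the base is positive and the powers combine by the usual rules. For a facet containing \<open>x\<close>
  the base is zero; but such a facet also contains \<open>q\<close>, so the exponents are \<open>0\<close> except in one factor.\<close>

lemma section_monomial_eq_sigma:
  assumes \<rho>: "vertex_ordering d \<nu> lam q \<rho>" and q: "q = real_vec mq"
    and x: "x \<in> P_q P q" and m: "m \<in> lattice_points P"
    and p: "(x, \<theta>) \<in> p"
      "\<forall>z\<in>p. fst z = x \<and> (\<exists>k. snd z - \<theta> - (2 * pi) *\<^sub>R real_vec k \<in> span ((\<lambda>r. real_vec (\<nu> r)) ` active d \<nu> lam x))"
  shows "section_monomial s m (x, \<theta>) =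
    section_monomial s mq (x, \<theta>) * sigma d \<nu> lam (g_s d \<nu> lam \<phi> \<psi> s) m \<rho> p"
proof -
  obtain k where k: "\<forall>i j. real_vec (\<nu> (\<rho> i)) \<bullet> real_vec (k j) = (if i = j then 1 else 0)"
    "\<forall>x. x = (\<Sum>j\<in>UNIV. (real_vec (\<nu> (\<rho> j)) \<bullet> x) *\<^sub>R real_vec (k j))"
    "\<forall>j. matrix_inv (normal_matrix \<nu> \<rho>) *v axis j 1 = real_vec (k j)"
    using \<rho> by (rule dual_vectors)
  have range\<rho>: "\<rho> j \<in> active d \<nu> lam q" for j
    using \<rho> by (auto simp: vertex_ordering_def bij_betw_def)
  define N where "N j = nat (ell_int \<nu> lam (\<rho> j) m)" for j
  have N: "int (N j) = ell_int \<nu> lam (\<rho> j) m" for j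
    using ell_int_nonneg[OF m, of "\<rho> j"] range\<rho>[of j] by (simp add: N_def mem_active)
  have N_real: "real (N j) = real_vec (\<nu> (\<rho> j)) \<bullet> (real_vec m - real_vec mq)" for j
  proof -
    have "real (N j) = of_int (int (N j))" by simp
    also have "\<dots> = l (\<rho> j) (real_vec m) - l (\<rho> j) q"
      unfolding N of_int_ell_int using range\<rho>[of j] by (simp add: mem_active)
    finally show ?thesis by (simp add: ell_def q inner_diff_right)
  qed
  have expand: "real_vec m = real_vec mq + (\<Sum>j\<in>UNIV. real (N j) *\<^sub>R real_vec (k j))"
  proof -
    have "real_vec m - real_vec mq = (\<Sum>j\<in>UNIV. real (N j) *\<^sub>R real_vec (k j))"
      unfolding N_real using k(2) by blast
    then show ?thesis by (simp add: algebra_simps)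
  qed
  have ell_m: "ell_int \<nu> lam r m = ell_int \<nu> lam r mq + (\<Sum>j\<in>UNIV. pairing (\<nu> r) (k j) * int (N j))" for r
  proof -
    have "(of_int (ell_int \<nu> lam r m) :: real) =
        of_int (ell_int \<nu> lam r mq + (\<Sum>j\<in>UNIV. pairing (\<nu> r) (k j) * int (N j)))"
      by (simp add: of_int_ell_int of_int_pairing ell_def expand inner_add_right inner_sum_right mult.commute)
    then show ?thesis by linarith
  qed
  define S where "S r = sqrt (l r x)" for r
  have radial: "S r powi ell_int \<nu> lam r m =
      S r powi ell_int \<nu> lam r mq * (\<Prod>j\<in>UNIV. (S r powi pairing (\<nu> r) (k j)) ^ N j)" if r: "r \<in> {1..d}" for r
  proof (cases "l r x = 0")
    case False
    then have "S r \<noteq> 0" by (simp add: S_def)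
    moreover have "(\<Prod>j\<in>UNIV. (S r powi pairing (\<nu> r) (k j)) ^ N j) = (\<Prod>j\<in>UNIV. S r powi (pairing (\<nu> r) (k j) * int (N j)))"
      by (simp add: power_int_mult)
    ultimately show ?thesis
      unfolding ell_m by (simp add: power_int_sum power_int_add)
  next
    case True
    then have "r \<in> active d \<nu> lam q" using r mem_P_q_imp(2)[OF x] by (auto simp: mem_active)
    with \<rho> obtain i where i: "r = \<rho> i" by (rule vertex_ordering_surj)
    have "(of_int (ell_int \<nu> lam r mq) :: real) = 0"
      using \<open>r \<in> active d \<nu> lam q\<close> by (simp add: of_int_ell_int q mem_active)
    then have mq: "ell_int \<nu> lam r mq = 0" by simp
    have "(of_int (pairing (\<nu> r) (k j)) :: real) = of_int (if i = j then 1 else 0)" for j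
      unfolding of_int_pairing by (simp add: i k(1))
    then have pair: "pairing (\<nu> r) (k j) = (if i = j then 1 else 0)" for j
      using of_int_eq_iff by blast
    have "(\<Prod>j\<in>UNIV. (S r powi pairing (\<nu> r) (k j)) ^ N j) = (\<Prod>j\<in>UNIV. if i = j then S r ^ N j else 1)"
      unfolding pair by (intro prod.cong) auto
    also have "\<dots> = S r ^ N i" by simp
    also have "\<dots> = S r powi ell_int \<nu> lam r m" unfolding i N[symmetric] by simp
    finally show ?thesis by (simp add: mq)
  qed
  have "(\<Prod>r=1..d. S r powi ell_int \<nu> lam r m) =
      (\<Prod>r=1..d. S r powi ell_int \<nu> lam r mq) * (\<Prod>r=1..d. \<Prod>j\<in>UNIV. (S r powi pairing (\<nu> r) (k j)) ^ N j)"
    unfolding prod.distrib[symmetric] by (intro prod.cong radial refl)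
  also have "(\<Prod>r=1..d. \<Prod>j\<in>UNIV. (S r powi pairing (\<nu> r) (k j)) ^ N j) =
      (\<Prod>j\<in>UNIV. (\<Prod>r=1..d. S r powi pairing (\<nu> r) (k j)) ^ N j)"
    by (subst prod.swap) (simp add: prod_power_distrib)
  finally have 1: "(\<Prod>r=1..d. S r powi ell_int \<nu> lam r m) = (\<Prod>r=1..d. S r powi ell_int \<nu> lam r mq) *
      (\<Prod>j\<in>UNIV. (\<Prod>r=1..d. S r powi pairing (\<nu> r) (k j)) ^ N j)" .
  define \<zeta> where "\<zeta> w = of_real (w \<bullet> regular_part s x) + \<i> * of_real (w \<bullet> \<theta>)" for w
  have "\<zeta> (real_vec m) = \<zeta> (real_vec mq) + (\<Sum>j\<in>UNIV. of_nat (N j) * \<zeta> (real_vec (k j)))"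
    unfolding \<zeta>_def expand
    by (simp add: inner_add_left inner_sum_left sum.distrib distrib_left sum_distrib_left mult.left_commute)
  then have 2: "exp (\<zeta> (real_vec m)) = exp (\<zeta> (real_vec mq)) * (\<Prod>j\<in>UNIV. exp (\<zeta> (real_vec (k j))) ^ N j)"
    by (simp add: exp_add exp_sum exp_of_nat_mult)
  have sigma: "sigma d \<nu> lam (g_s d \<nu> lam \<phi> \<psi> s) m \<rho> p =
      (\<Prod>j\<in>UNIV. toric_monomial s (\<lambda>r. pairing (\<nu> r) (k j)) (real_vec (k j)) (x, \<theta>) ^ N j)"
    unfolding sigma_def w_chart_eq[OF \<rho> k(1,3) x p] by (simp flip: N)
  show ?thesis
    unfolding sigma section_monomial_def toric_monomial_def fst_conv snd_conv S_def[symmetric] \<zeta>_def[symmetric] 1 2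
    by (simp add: power_mult_distrib prod.distrib)
qed

text \<open>Facets active at \<open>x\<close> are active at \<open>q\<close>, so they enter with exponent \<open>0\<close>.\<close>

lemma section_monomial_vertex_nonzero:
  assumes "x \<in> P_q P q" "q = real_vec mq"
  shows "section_monomial s mq (x, \<theta>) \<noteq> 0"
proof -
  have "sqrt (l r x) powi ell_int \<nu> lam r mq \<noteq> 0" if r: "r \<in> {1..d}" for r
  proof (cases "l r x = 0")
    case True
    then have "r \<in> active d \<nu> lam q" using r mem_P_q_imp(2)[OF assms(1)] by (auto simp: mem_active)
    then have "(of_int (ell_int \<nu> lam r mq) :: real) = 0"
      by (simp add: of_int_ell_int assms(2) mem_active)
    then show ?thesis by simp
  qed simp
  then show ?thesis by (simp add: section_monomial_def toric_monomial_def)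
qed

definition defining_section :: "(int^'n \<Rightarrow> complex) \<Rightarrow> (int^'n \<Rightarrow> real) \<Rightarrow> real \<Rightarrow> (real^'n) \<times> (real^'n) \<Rightarrow> complex" where
  "defining_section a v s z =
     (\<Sum>m\<in>lattice_points P. a m * of_real (exp (- s * v m)) * section_monomial s m z)"

lemma moment_map_image_Y_s:
  "moment_map ` Y_s d \<nu> lam \<phi> \<psi> a v s = {x\<in>P. \<exists>\<theta>. defining_section a v s (x, \<theta>) = 0}"
proof -
  have key: "defining_section a v s (x, \<theta>) = section_monomial s mq (x, \<theta>) *
      (\<Sum>m\<in>lattice_points P. a m * complex_of_real (exp (- s * v m)) * sigma d \<nu> lam (g_s d \<nu> lam \<phi> \<psi> s) m \<rho> p)"
    if "vertex_ordering d \<nu> lam q \<rho>" "q = real_vec mq" "x \<in> P_q P q" "(x, \<theta>) \<in> p"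
      "\<forall>z\<in>p. fst z = x \<and> (\<exists>k. snd z - \<theta> - (2 * pi) *\<^sub>R real_vec k \<in> span ((\<lambda>r. real_vec (\<nu> r)) ` active d \<nu> lam x))"
    for q \<rho> mq x \<theta> p
    unfolding defining_section_def sum_distrib_left
    using section_monomial_eq_sigma[OF that(1,2,3) _ that(4,5), of _ s]
    by (intro sum.cong refl) simp
  show ?thesis
  proof (intro equalityI subsetI)
    fix x assume "x \<in> moment_map ` Y_s d \<nu> lam \<phi> \<psi> a v s"
    then obtain p q \<rho> where p: "p \<in> X_P d \<nu> lam" "x = moment_map p" "vertex_ordering d \<nu> lam q \<rho>" "p \<in> V_q d \<nu> lam q"
      and zero: "(\<Sum>m\<in>lattice_points P. a m * complex_of_real (exp (- s * v m)) *
            sigma d \<nu> lam (g_s d \<nu> lam \<phi> \<psi> s) m \<rho> p) = 0"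
      unfolding Y_s_def by blast
    obtain y \<theta> where y: "y \<in> P" "p = toric_rel d \<nu> lam `` {(y, \<theta>)}"
      using p(1) unfolding X_P_def quotient_def by blast
    note fibre = toric_fibre[OF y]
    have "q extreme_point_of P" using p(3) by (simp add: vertex_ordering_def)
    then obtain mq where "q = real_vec mq" using vertex_active(1) by blast
    moreover have "y \<in> P_q P q" using p(4) fibre(2) by (simp add: V_q_def)
    ultimately have "defining_section a v s (y, \<theta>) = 0"
      using key[OF p(3) _ _ fibre(1,3)] zero by simp
    then show "x \<in> {x\<in>P. \<exists>\<theta>. defining_section a v s (x, \<theta>) = 0}"
      using p(2) y(1) fibre(2) by auto
  next
    fix x assume "x \<in> {x\<in>P. \<exists>\<theta>. defining_section a v s (x, \<theta>) = 0}"
    then obtain \<theta>0 where x: "x \<in> P" "defining_section a v s (x, \<theta>0) = 0" by blast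
    define p where "p = toric_rel d \<nu> lam `` {(x, \<theta>0)}"
    have p: "p \<in> X_P d \<nu> lam" using x(1) by (auto simp: p_def X_P_def quotient_def)
    note fibre = toric_fibre[OF x(1) p_def]
    obtain q where q: "q extreme_point_of P" "x \<in> P_q P q" using exists_chart_vertex[OF x(1)] .
    obtain mq where mq: "q = real_vec mq" using vertex_active(1)[OF q(1)] by blast
    obtain \<rho> where \<rho>: "vertex_ordering d \<nu> lam q \<rho>" using exists_vertex_ordering[OF q(1)] .
    have "(\<Sum>m\<in>lattice_points P. a m * complex_of_real (exp (- s * v m)) *
            sigma d \<nu> lam (g_s d \<nu> lam \<phi> \<psi> s) m \<rho> p) = 0"
      using key[OF \<rho> mq q(2) fibre(1,3)] x(2) section_monomial_vertex_nonzero[OF q(2) mq] by simp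
    moreover have "p \<in> V_q d \<nu> lam q" using p q(2) fibre(2) by (simp add: V_q_def)
    ultimately have "p \<in> Y_s d \<nu> lam \<phi> \<psi> a v s"
      using p \<rho> unfolding Y_s_def by blast
    then show "x \<in> moment_map ` Y_s d \<nu> lam \<phi> \<psi> a v s" using fibre(2) by blast
  qed
qed

lemma continuous_defining_section: "continuous_on (P \<times> UNIV) (defining_section a v s)"
  unfolding defining_section_def by (intro continuous_intros continuous_section_monomial)

text \<open>By periodicity the angles may be taken from a compact box, so the image is the projection of a compact
  set.\<close>

lemma closed_moment_map_image_Y_s: "closed (moment_map ` Y_s d \<nu> lam \<phi> \<psi> a v s)"
proof -
  define Q where "Q = cbox (0 :: real^'n) (\<chi> i. 2 * pi)"
  define Z where "Z = {z \<in> P \<times> Q. defining_section a v s z = 0}"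
  have "compact Q" unfolding Q_def by (rule compact_cbox)
  then have "compact (P \<times> Q)" using compact_P by (intro compact_Times)
  moreover have "closed Z"
    unfolding Z_def using compact_imp_closed[OF \<open>compact (P \<times> Q)\<close>]
    by (intro continuous_closed_preimage_constant continuous_on_subset[OF continuous_defining_section]) auto
  moreover have "Z \<subseteq> P \<times> Q" by (auto simp: Z_def)
  ultimately have "compact Z" by (metis compact_Int_closed inf.absorb2)
  then have "compact (fst ` Z)" by (intro compact_continuous_image continuous_intros)
  moreover have "moment_map ` Y_s d \<nu> lam \<phi> \<psi> a v s = fst ` Z"
    unfolding moment_map_image_Y_s
  proof (intro equalityI subsetI)
    fix x assume "x \<in> {x\<in>P. \<exists>\<theta>. defining_section a v s (x, \<theta>) = 0}"
    then obtain \<theta> where x: "x \<in> P" "defining_section a v s (x, \<theta>) = 0" by blast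
    define k :: "int^'n" where "k = (\<chi> i. - \<lfloor>\<theta> $ i / (2 * pi)\<rfloor>)"
    define \<theta>' where "\<theta>' = \<theta> + (2 * pi) *\<^sub>R real_vec k"
    have "0 \<le> \<theta>' $ i \<and> \<theta>' $ i \<le> 2 * pi" for i
    proof -
      have "\<theta>' $ i = 2 * pi * frac (\<theta> $ i / (2 * pi))"
        by (simp add: \<theta>'_def k_def real_vec_def frac_def right_diff_distrib)
      then show ?thesis
        using frac_ge_0[of "\<theta> $ i / (2 * pi)"] frac_lt_1[of "\<theta> $ i / (2 * pi)"] by simp
    qed
    then have "\<theta>' \<in> Q" by (simp add: Q_def mem_box_cart)
    moreover have "defining_section a v s (x, \<theta>') = 0"
      using x(2) by (simp add: defining_section_def \<theta>'_def section_monomial_periodic)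
    ultimately show "x \<in> fst ` Z" using x(1) by (force simp: Z_def)
  qed (auto simp: Z_def)
  ultimately show ?thesis by (simp add: compact_imp_closed)
qed

end

section \<open>Convergence of the amoebas\<close>

context toric_degeneration
begin

lemma defining_section_open_orbit:
  assumes x: "x \<in> interior P" and s: "s > 0"
  shows "defining_section a v s (x, \<theta>) = of_real (orbit_factor x) *
    (\<Sum>m\<in>lattice_points P. a m *
      exp (of_real (s * (real_vec m \<bullet> rescaled_log s x - v m)) + \<i> * of_real (real_vec m \<bullet> \<theta>)))"
proof -
  have term_eq: "a m * of_real (exp (- s * v m)) * section_monomial s m (x, \<theta>) = of_real (orbit_factor x) * (a m *
      exp (of_real (s * (real_vec m \<bullet> rescaled_log s x - v m)) + \<i> * of_real (real_vec m \<bullet> \<theta>)))" for m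
  proof -
    have "- s * v m + real_vec m \<bullet> (gradient g x + s *\<^sub>R gradient \<psi> x) =
        s * (real_vec m \<bullet> rescaled_log s x - v m)"
      using s by (simp add: rescaled_log_def inner_add_right algebra_simps)
    moreover have "complex_of_real (exp E) * exp (of_real R + X) = exp (of_real (E + R) + X)" for E R X
      by (simp add: exp_of_real[symmetric] exp_add[symmetric] add.assoc)
    ultimately have "complex_of_real (exp (- s * v m)) *
        exp (of_real (real_vec m \<bullet> (gradient g x + s *\<^sub>R gradient \<psi> x)) + \<i> * of_real (real_vec m \<bullet> \<theta>)) =
        exp (of_real (s * (real_vec m \<bullet> rescaled_log s x - v m)) + \<i> * of_real (real_vec m \<bullet> \<theta>))"
      by (simp only:)
    then show ?thesis
      unfolding section_monomial_open_orbit(1)[OF x] by (simp only: mult_ac)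
  qed
  show ?thesis
    unfolding defining_section_def sum_distrib_left by (intro sum.cong refl term_eq)
qed

text \<open>In a chart around the zero, let \<open>q\<close> be the vertex. Its section does not vanish at the zero, so at close interior
  points the whole sum is small compared with the term of \<open>q\<close>, and hence with the largest term. If every other
  term were smaller than the largest by a factor \<open>exp (- C)\<close>, the largest one could not be cancelled.\<close>

lemma zero_imp_near_tie:
  assumes a: "\<And>m. m \<in> lattice_points P \<Longrightarrow> a m \<noteq> 0"
  shows "\<exists>C. \<forall>s x \<theta> \<delta>. s > 0 \<and> x \<in> P \<and> defining_section a v s (x, \<theta>) = 0 \<and> \<delta> > 0 \<longrightarrow>
    (\<exists>x'\<in>interior P. dist x x' < \<delta> \<and> (\<exists>m m'. maximal_at (lattice_points P) v (rescaled_log s x') m \<and>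
      m' \<in> lattice_points P \<and> m' \<noteq> m \<and>
      (real_vec m \<bullet> rescaled_log s x' - v m) - (real_vec m' \<bullet> rescaled_log s x' - v m') \<le> C / s))"
proof -
  define M where "M = lattice_points P"
  have M: "finite M" "M \<noteq> {}"
    using finite_lattice_points by (auto simp: M_def intro: two_lattice_points)
  define \<alpha> where "\<alpha> = Min ((\<lambda>m. norm (a m)) ` M)"
  have \<alpha>_le: "\<alpha> \<le> norm (a m)" if "m \<in> M" for m
    using M that by (simp add: \<alpha>_def)
  have "\<alpha> \<in> (\<lambda>m. norm (a m)) ` M" unfolding \<alpha>_def using M by (intro Min_in) auto
  then have "\<alpha> > 0" using a by (auto simp: M_def)
  define \<beta> where "\<beta> = (\<Sum>m\<in>M. norm (a m))"
  have "\<beta> > 0" unfolding \<beta>_def using M a by (intro sum_pos) (auto simp: M_def)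
  \<comment> \<open>Chosen so that all terms but the largest add up to at most a quarter of it.\<close>
  define C where "C = ln (4 * \<beta> / \<alpha>)"
  have expC: "\<beta> * exp (- C) = \<alpha> / 4"
    using \<open>\<alpha> > 0\<close> \<open>\<beta> > 0\<close> by (simp add: C_def exp_minus field_simps)
  show ?thesis
  proof (rule exI[of _ C], intro allI impI, elim conjE)
    fix s x \<theta> \<delta>
    assume s: "s > 0" and x: "x \<in> P" and zero: "defining_section a v s (x, \<theta>) = 0" and \<delta>: "\<delta> > (0::real)"
    obtain q where q: "q extreme_point_of P" "x \<in> P_q P q" using exists_chart_vertex[OF x] .
    obtain mq where mq: "q = real_vec mq" using vertex_active(1)[OF q(1)] by blast
    have "mq \<in> M" using q(1) mq by (simp add: M_def lattice_points_def extreme_point_of_def)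
    define \<Delta> where "\<Delta> z = \<alpha> / 2 * norm (of_real (exp (- s * v mq)) * section_monomial s mq z) -
        norm (defining_section a v s z)" for z
    have "continuous_on (P \<times> UNIV) \<Delta>"
      unfolding \<Delta>_def using \<open>mq \<in> M\<close>
      by (intro continuous_intros continuous_section_monomial continuous_defining_section) (simp add: M_def)
    then have "(\<Delta> \<longlongrightarrow> \<Delta> (x, \<theta>)) (at (x, \<theta>) within P \<times> UNIV)"
      using x unfolding continuous_on_def by blast
    then have "(\<Delta> \<longlongrightarrow> \<Delta> (x, \<theta>)) (at (x, \<theta>) within interior P \<times> UNIV)"
      by (rule tendsto_within_subset) (use interior_subset in auto)
    moreover have "0 < \<Delta> (x, \<theta>)"
      using section_monomial_vertex_nonzero[OF q(2) mq] \<open>\<alpha> > 0\<close> by (simp add: \<Delta>_def zero norm_mult)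
    ultimately have "\<forall>\<^sub>F z in at (x, \<theta>) within interior P \<times> UNIV. 0 < \<Delta> z"
      by (rule order_tendstoD)
    moreover have "\<forall>\<^sub>F z in at (x, \<theta>) within interior P \<times> UNIV. z \<in> interior P \<times> UNIV"
      by (simp add: eventually_at_filter)
    moreover have "\<forall>\<^sub>F z in at (x, \<theta>) within interior P \<times> UNIV. dist z (x, \<theta>) < \<delta>"
      using \<delta> by (auto simp: eventually_at)
    ultimately have "\<forall>\<^sub>F z in at (x, \<theta>) within interior P \<times> UNIV.
        0 < \<Delta> z \<and> z \<in> interior P \<times> UNIV \<and> dist z (x, \<theta>) < \<delta>"
      by eventually_elim simp
    then obtain x' \<theta>' where z: "0 < \<Delta> (x', \<theta>')" "x' \<in> interior P" "dist (x', \<theta>') (x, \<theta>) < \<delta>"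
      using eventually_happens'[OF at_within_open_orbit_nontrivial[OF x]] by force
    define u where "u = rescaled_log s x'"
    define h where "h m = real_vec m \<bullet> u - v m" for m
    define T where "T m = a m * exp (of_real (s * h m) + \<i> * of_real (real_vec m \<bullet> \<theta>'))" for m
    have normT: "norm (T m) = norm (a m) * exp (s * h m)" for m
      by (simp add: T_def norm_mult)
    have "norm (\<Sum>m\<in>M. T m) < \<alpha> / 2 * exp (s * h mq)"
    proof -
      have \<kappa>: "orbit_factor x' > 0" by (rule section_monomial_open_orbit(2)[OF z(2)])
      have "norm (defining_section a v s (x', \<theta>')) = orbit_factor x' * norm (\<Sum>m\<in>M. T m)"
        unfolding defining_section_open_orbit[OF z(2) s] using \<kappa>
        by (simp add: norm_mult T_def h_def u_def M_def)
      moreover have "norm (of_real (exp (- s * v mq)) * section_monomial s mq (x', \<theta>')) = orbit_factor x' * exp (s * h mq)"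
      proof -
        have "- s * v mq + real_vec mq \<bullet> (gradient g x' + s *\<^sub>R gradient \<psi> x') = s * h mq"
          using s by (simp add: h_def u_def rescaled_log_def inner_add_right algebra_simps)
        then have "exp (s * h mq) = exp (- s * v mq) * exp (real_vec mq \<bullet> (gradient g x' + s *\<^sub>R gradient \<psi> x'))"
          by (simp only: exp_add[symmetric])
        then show ?thesis
          unfolding section_monomial_open_orbit(1)[OF z(2)] using \<kappa> by (simp add: norm_mult)
      qed
      ultimately have "orbit_factor x' * norm (\<Sum>m\<in>M. T m) < orbit_factor x' * (\<alpha> / 2 * exp (s * h mq))"
        using z(1) by (simp add: \<Delta>_def mult_ac)
      then show ?thesis using \<kappa> by simp
    qed
    note small = this
    obtain m where m: "maximal_at M v u m" using exists_maximal_at[OF M] .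
    then have "m \<in> M" and h_le: "h k \<le> h m" if "k \<in> M" for k
      using that by (auto simp: maximal_at_def h_def)
    then have mM: "m \<in> M" using \<open>mq \<in> M\<close> by blast
    have "\<exists>m'\<in>M. m' \<noteq> m \<and> h m - h m' \<le> C / s"
    proof (rule ccontr)
      assume none: "\<not> ?thesis"
      have "(\<Sum>k\<in>M - {m}. norm (T k)) \<le> (\<Sum>k\<in>M - {m}. norm (a k) * exp (s * h m - C))"
      proof (rule sum_mono)
        fix k assume "k \<in> M - {m}"
        then have "C / s \<le> h m - h k" using none by force
        then have "C \<le> (h m - h k) * s" using s by (simp only: pos_divide_le_eq)
        then have "s * h k \<le> s * h m - C" by (simp add: algebra_simps)
        then show "norm (T k) \<le> norm (a k) * exp (s * h m - C)"
          unfolding normT by (intro mult_left_mono) auto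
      qed
      also have "\<dots> \<le> \<beta> * exp (s * h m - C)"
        unfolding \<beta>_def sum_distrib_right using M by (intro sum_mono2) auto
      also have "\<dots> = (\<beta> * exp (- C)) * exp (s * h m)"
        by (simp add: exp_diff exp_minus field_simps)
      finally have rest: "(\<Sum>k\<in>M - {m}. norm (T k)) \<le> \<alpha> / 4 * exp (s * h m)"
        unfolding expC .
      have "\<alpha> * exp (s * h m) \<le> norm (T m)"
        unfolding normT using \<alpha>_le[OF mM] by (intro mult_right_mono) auto
      also have "T m = (\<Sum>k\<in>M. T k) - (\<Sum>k\<in>M - {m}. T k)"
        using M mM by (simp add: sum.remove[of M m])
      also have "norm \<dots> \<le> norm (\<Sum>k\<in>M. T k) + (\<Sum>k\<in>M - {m}. norm (T k))"
        by (rule order_trans[OF norm_triangle_ineq4 add_left_mono[OF norm_sum]])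
      also have "\<dots> < \<alpha> / 2 * exp (s * h mq) + \<alpha> / 4 * exp (s * h m)"
        using small rest by linarith
      also have "\<dots> \<le> \<alpha> / 2 * exp (s * h m) + \<alpha> / 4 * exp (s * h m)"
        using h_le[OF \<open>mq \<in> M\<close>] \<open>\<alpha> > 0\<close> s by simp
      finally have "\<alpha> * exp (s * h m) < (3 / 4) * (\<alpha> * exp (s * h m))" by simp
      moreover have "0 < \<alpha> * exp (s * h m)" using \<open>\<alpha> > 0\<close> by simp
      ultimately show False by linarith
    qed
    then obtain m' where m': "m' \<in> M" "m' \<noteq> m" "h m - h m' \<le> C / s" by blast
    have "dist x x' \<le> dist (x', \<theta>') (x, \<theta>)"
      using dist_fst_le[of "(x', \<theta>')" "(x, \<theta>)"] by (simp add: dist_commute)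
    then have "dist x x' < \<delta>" using z(3) by simp
    then show "\<exists>x'\<in>interior P. dist x x' < \<delta> \<and> (\<exists>m m'. maximal_at (lattice_points P) v (rescaled_log s x') m \<and>
      m' \<in> lattice_points P \<and> m' \<noteq> m \<and>
      (real_vec m \<bullet> rescaled_log s x' - v m) - (real_vec m' \<bullet> rescaled_log s x' - v m') \<le> C / s)"
      using z(2) m m' unfolding M_def u_def h_def by blast
  qed
qed

lemma eventually_const_div_less:
  fixes K e :: real
  assumes "e > 0"
  shows "\<forall>\<^sub>F s in at_top. K / s < e"
proof -
  have "((\<lambda>s. K / s) \<longlongrightarrow> 0) at_top"
    by (rule tendsto_divide_0[OF tendsto_const filterlim_at_top_imp_at_infinity[OF filterlim_ident]])
  then show ?thesis using assms by (rule order_tendstoD)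
qed

lemma mem_tropical_amoeba:
  "u \<in> tropical_amoeba P v \<longleftrightarrow>
     (\<exists>m m'. m \<noteq> m' \<and> maximal_at (lattice_points P) v u m \<and> maximal_at (lattice_points P) v u m')"
  by (rule mem_tropical_amoeba_iff[OF finite_lattice_points]) (auto intro: two_lattice_points)

text \<open>From a zero over \<open>x\<close> one passes to a nearby interior point \<open>x'\<close>, from there to the maximiser of its rescaled
  logarithm \<open>u\<close>, and finally to the maximiser of a point \<open>u'\<close> of the tropical amoeba near \<open>u\<close>. The second step
  costs \<open>O(s\<^sup>-\<^sup>1\<^sup>/\<^sup>2)\<close> and the third \<open>O(1/s)\<close>, uniformly in \<open>x\<close>.\<close>

lemma amoeba_near_limit:
  assumes a: "\<And>m. m \<in> lattice_points P \<Longrightarrow> a m \<noteq> 0" and e: "e > 0"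
  shows "\<forall>\<^sub>F s in at_top. \<forall>x\<in>moment_map ` Y_s d \<nu> lam \<phi> \<psi> a v s.
    infdist x (maximiser ` tropical_amoeba P v) < e"
proof -
  define M where "M = lattice_points P"
  obtain C where C: "\<forall>s x \<theta> \<delta>. s > 0 \<and> x \<in> P \<and> defining_section a v s (x, \<theta>) = 0 \<and> \<delta> > 0 \<longrightarrow>
    (\<exists>x'\<in>interior P. dist x x' < \<delta> \<and> (\<exists>m m'. maximal_at M v (rescaled_log s x') m \<and>
      m' \<in> M \<and> m' \<noteq> m \<and>
      (real_vec m \<bullet> rescaled_log s x' - v m) - (real_vec m' \<bullet> rescaled_log s x' - v m') \<le> C / s))"
    unfolding M_def using zero_imp_near_tie[of a v, OF a] by blast
  obtain K where K: "\<forall>s>0. \<forall>x\<in>interior P. (dist x (maximiser (rescaled_log s x)))\<^sup>2 \<le> K / s"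
    using maximiser_rescaled_log by blast
  define D where "D = (\<Sum>(m, m')\<in>M \<times> M. norm (real_vec m' - real_vec m))"
  have D: "norm (real_vec m' - real_vec m) \<le> D" if "m \<in> M" "m' \<in> M" for m m'
    unfolding D_def using that finite_lattice_points
    by (intro member_le_sum[of "(m, m')" "M \<times> M" "\<lambda>(m, m'). norm (real_vec m' - real_vec m)", simplified])
       (auto simp: M_def)
  have "\<forall>\<^sub>F s in at_top. K / s < (e / 4)\<^sup>2" "\<forall>\<^sub>F s in at_top. (C * D / c) / s < e / 4"
    using e by (intro eventually_const_div_less; simp)+
  then show ?thesis
    using eventually_gt_at_top[of 0]
  proof eventually_elim
    case (elim s)
    show ?case
    proof
      fix x assume "x \<in> moment_map ` Y_s d \<nu> lam \<phi> \<psi> a v s"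
      then obtain \<theta> where x: "x \<in> P" "defining_section a v s (x, \<theta>) = 0"
        unfolding moment_map_image_Y_s by blast
      obtain x' m m' where x': "x' \<in> interior P" "dist x x' < e / 4"
        and m: "maximal_at M v (rescaled_log s x') m" "m' \<in> M" "m' \<noteq> m"
          "(real_vec m \<bullet> rescaled_log s x' - v m) - (real_vec m' \<bullet> rescaled_log s x' - v m') \<le> C / s"
        using C[rule_format, of s x \<theta> "e / 4"] elim(3) x e by auto
      define u where "u = rescaled_log s x'"
      have "finite M" by (simp add: M_def finite_lattice_points)
      from near_tie_imp_near_tropical[OF this m]
      obtain u' m1 m2 where u': "m1 \<noteq> m2" "maximal_at M v u' m1" "maximal_at M v u' m2"
        "dist u u' \<le> C / s * norm (real_vec m' - real_vec m)"
        unfolding u_def by metis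
      have "u' \<in> tropical_amoeba P v" using u' unfolding mem_tropical_amoeba M_def by blast
      have "0 \<le> C / s" using m by (auto simp: maximal_at_def intro: order_trans[rotated])
      have "dist u u' \<le> C / s * D"
        using m(1,2) by (intro order_trans[OF u'(4)] mult_left_mono D \<open>0 \<le> C / s\<close>) (auto simp: maximal_at_def)
      then have "dist u u' / c \<le> C / s * D / c"
        using c_pos by (intro divide_right_mono) auto
      also have "C / s * D / c = (C * D / c) / s" by (simp add: mult.commute)
      finally have "dist (maximiser u) (maximiser u') < e / 4"
        using dist_maximiser[of u u'] elim(2) by linarith
      moreover have "dist x' (maximiser u) < e / 4"
      proof (rule power_less_imp_less_base[where n = 2])
        show "(dist x' (maximiser u))\<^sup>2 < (e / 4)\<^sup>2"
          using K[rule_format, OF elim(3) x'(1)] elim(1) unfolding u_def by linarith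
      qed (use e in simp)
      moreover have "dist x (maximiser u') \<le> dist x x' + (dist x' (maximiser u) + dist (maximiser u) (maximiser u'))"
        by (meson add_left_mono dist_triangle order_trans)
      ultimately have "dist x (maximiser u') < e" using x'(2) e by linarith
      moreover have "infdist x (maximiser ` tropical_amoeba P v) \<le> dist x (maximiser u')"
        using \<open>u' \<in> _\<close> by (intro infdist_le imageI)
      ultimately show "infdist x (maximiser ` tropical_amoeba P v) < e" by linarith
    qed
  qed
qed

text \<open>Restricted to the complex line of points \<open>u0 + (Re \<omega> / s) k\<close> with angles \<open>(Im \<omega>) k\<close>, the exponential sum becomes a
  Laurent polynomial in \<open>z = exp \<omega>\<close>. Normalised by its largest term at \<open>u0\<close>, it converges to the sum over the
  exponents maximal at \<open>u0\<close>, of which there are two or more. Its roots near a fixed nonzero \<open>z0\<close> have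
  bounded \<open>\<omega>\<close>, so the corresponding \<open>u\<close> tend to \<open>u0\<close>.\<close>

lemma limit_near_amoeba:
  assumes a: "\<And>m. m \<in> lattice_points P \<Longrightarrow> a m \<noteq> 0" and e: "e > 0"
    and y: "y \<in> maximiser ` tropical_amoeba P v"
  shows "\<forall>\<^sub>F s in at_top. \<exists>x\<in>moment_map ` Y_s d \<nu> lam \<phi> \<psi> a v s. dist x y < e"
proof -
  define M where "M = lattice_points P"
  have fin: "finite M" by (simp add: M_def finite_lattice_points)
  obtain u0 where u0: "u0 \<in> tropical_amoeba P v" "y = maximiser u0" using y by blast
  then obtain m1 m2 where m12: "m1 \<noteq> m2" "maximal_at M v u0 m1" "maximal_at M v u0 m2"
    unfolding mem_tropical_amoeba M_def by blast
  define h where "h m = real_vec m \<bullet> u0 - v m" for m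
  define F where "F = h m1"
  have h_le: "h m \<le> F" if "m \<in> M" for m
    using m12(2) that by (simp add: maximal_at_def h_def F_def)
  have F2: "h m2 = F" using m12 by (auto simp: maximal_at_def h_def F_def intro: antisym)
  have mM: "m1 \<in> M" "m2 \<in> M" using m12 by (auto simp: maximal_at_def)
  obtain k where k: "inj_on (\<lambda>m. pairing m k) M"
    using fin by (rule exists_separating_direction)
  \<comment> \<open>A shift that makes all exponents of the Laurent polynomial nonnegative.\<close>
  define N where "N = (\<Sum>m\<in>M. \<bar>pairing m k\<bar>)"
  define p where "p m = nat (pairing m k + N)" for m
  have p: "int (p m) = pairing m k + N" if "m \<in> M" for m
  proof -
    have "\<bar>pairing m k\<bar> \<le> N" unfolding N_def using fin that by (intro member_le_sum) auto
    then show ?thesis by (simp add: p_def)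
  qed
  have inj: "inj_on p M"
  proof (rule inj_onI)
    fix m m' assume "m \<in> M" "m' \<in> M" "p m = p m'"
    then have "pairing m k = pairing m' k" using p[of m] p[of m'] by simp
    then show "m = m'" using k \<open>m \<in> M\<close> \<open>m' \<in> M\<close> by (auto dest: inj_onD)
  qed
  define b where "b s m = a m * of_real (exp (s * (h m - F)))" for s m
  define c' where "c' m = (if h m = F then a m else 0)" for m
  have lim: "((\<lambda>s. b s m) \<longlongrightarrow> c' m) at_top" if "m \<in> M" for m
  proof (cases "h m = F")
    case True
    then show ?thesis by (simp add: b_def c'_def)
  next
    case False
    then have "h m - F < 0" using h_le[OF that] by simp
    then have "filterlim (\<lambda>s. s * (h m - F)) at_bot at_top"
      by (subst mult.commute) (rule filterlim_tendsto_neg_mult_at_bot[OF tendsto_const _ filterlim_ident])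
    then have "((\<lambda>s. exp (s * (h m - F))) \<longlongrightarrow> 0) at_top"
      by (rule filterlim_compose[OF exp_at_bot])
    then have "((\<lambda>s. a m * complex_of_real (exp (s * (h m - F)))) \<longlongrightarrow> a m * of_real 0) at_top"
      by (intro tendsto_intros)
    then show ?thesis using False by (simp add: b_def c'_def)
  qed
  have c12: "c' m1 \<noteq> 0" "c' m2 \<noteq> 0" using a mM F2 by (auto simp: c'_def F_def M_def)
  obtain z0 where z0: "z0 \<noteq> 0" "(\<Sum>m\<in>M. c' m * z0 ^ p m) = 0"
    using fewnomial_nonzero_root[OF fin inj mM m12(1) c12] .
  define L where "L = \<bar>ln (norm z0)\<bar> + ln 2"
  obtain K where K: "\<forall>s>0. \<forall>x\<in>interior P. (dist x (maximiser (rescaled_log s x)))\<^sup>2 \<le> K / s"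
    using maximiser_rescaled_log by blast
  have "\<forall>\<^sub>F s in at_top. \<exists>z. dist z0 z < norm z0 / 2 \<and> (\<Sum>m\<in>M. b s m * z ^ p m) = 0"
    using z0 by (intro root_persists[OF fin inj mM(1) c12(1) z0(2) lim]) auto
  moreover have "\<forall>\<^sub>F s in at_top. K / s < (e / 2)\<^sup>2" "\<forall>\<^sub>F s in at_top. (L * norm (real_vec k) / c) / s < e / 2"
    using e by (intro eventually_const_div_less; simp)+
  ultimately show ?thesis
    using eventually_gt_at_top[of 0]
  proof eventually_elim
    case (elim s)
    from elim(1) obtain z where z: "dist z0 z < norm z0 / 2" "(\<Sum>m\<in>M. b s m * z ^ p m) = 0" by blast
    have norm_z: "norm z0 / 2 < norm z" "norm z < 2 * norm z0"
    proof -
      have "norm z0 \<le> norm z + dist z0 z" "norm z \<le> norm z0 + dist z0 z"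
        unfolding dist_norm using norm_triangle_sub[of z0 z] norm_triangle_sub[of z z0]
        by (simp_all add: norm_minus_commute)
      then show "norm z0 / 2 < norm z" "norm z < 2 * norm z0" using z(1) z0(1) by simp_all
    qed
    then have "z \<noteq> 0" using z0(1) by auto
    define w where "w = Ln z"
    have w: "exp w = z" "Re w = ln (norm z)" using \<open>z \<noteq> 0\<close> by (simp_all add: w_def)
    have Re_w: "\<bar>Re w\<bar> \<le> L"
    proof -
      have "ln (norm z0 / 2) \<le> ln (norm z)" "ln (norm z) \<le> ln (2 * norm z0)"
        using norm_z z0(1) \<open>z \<noteq> 0\<close> by auto
      then have "\<bar>ln (norm z) - ln (norm z0)\<bar> \<le> ln 2"
        using z0(1) by (simp add: ln_div ln_mult abs_le_iff)
      then show ?thesis unfolding w(2) L_def by linarith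
    qed
    define u where "u = u0 + (Re w / s) *\<^sub>R real_vec k"
    define \<theta> where "\<theta> = Im w *\<^sub>R real_vec k"
    obtain x where x: "x \<in> interior P" "rescaled_log s x = u" using rescaled_log_surj[OF elim(4)] .
    have term_eq: "b s m * z ^ p m = exp (of_int N * w - of_real (s * F)) *
        (a m * exp (of_real (s * (real_vec m \<bullet> u - v m)) + \<i> * of_real (real_vec m \<bullet> \<theta>)))"
      if "m \<in> M" for m
    proof -
      have "z ^ p m = exp (of_int (pairing m k + N) * w)"
        unfolding w(1)[symmetric] p[OF that, symmetric] by (simp add: exp_of_nat_mult)
      then have "b s m * z ^ p m = a m * exp (of_real (s * (h m - F)) + of_int (pairing m k + N) * w)"
        by (simp add: b_def exp_of_real[symmetric] exp_add)
      moreover have "of_real (s * (h m - F)) + of_int (pairing m k + N) * w =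
          (of_int N * w - of_real (s * F)) +
          (of_real (s * (real_vec m \<bullet> u - v m)) + \<i> * of_real (real_vec m \<bullet> \<theta>))"
      proof -
        have "s * (real_vec m \<bullet> u - v m) = s * h m + of_int (pairing m k) * Re w"
          using elim(4) by (simp add: u_def h_def inner_add_right of_int_pairing field_simps)
        moreover have "real_vec m \<bullet> \<theta> = of_int (pairing m k) * Im w"
          by (simp add: \<theta>_def of_int_pairing)
        ultimately show ?thesis
          by (simp add: complex_eq_iff algebra_simps)
      qed
      ultimately have "b s m * z ^ p m = a m * exp ((of_int N * w - of_real (s * F)) +
          (of_real (s * (real_vec m \<bullet> u - v m)) + \<i> * of_real (real_vec m \<bullet> \<theta>)))"
        by (simp only:)
      then show ?thesis by (simp only: exp_add mult.left_commute)
    qed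
    have "exp (of_int N * w - of_real (s * F)) *
        (\<Sum>m\<in>M. a m * exp (of_real (s * (real_vec m \<bullet> u - v m)) + \<i> * of_real (real_vec m \<bullet> \<theta>))) = 0"
      unfolding sum_distrib_left z(2)[symmetric] by (intro sum.cong refl term_eq[symmetric])
    then have "defining_section a v s (x, \<theta>) = 0"
      unfolding defining_section_open_orbit[OF x(1) elim(4)] x(2) M_def by simp
    then have mem: "x \<in> moment_map ` Y_s d \<nu> lam \<phi> \<psi> a v s"
      unfolding moment_map_image_Y_s using x(1) interior_subset by blast
    have "dist u u0 \<le> L / s * norm (real_vec k)"
    proof -
      have "dist u u0 = \<bar>Re w\<bar> / s * norm (real_vec k)" using elim(4) by (simp add: u_def dist_norm)
      also have "\<dots> \<le> L / s * norm (real_vec k)"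
        using Re_w elim(4) by (intro mult_right_mono divide_right_mono) auto
      finally show ?thesis .
    qed
    then have "dist u u0 / c \<le> L / s * norm (real_vec k) / c"
      using c_pos by (intro divide_right_mono) auto
    also have "L / s * norm (real_vec k) / c = (L * norm (real_vec k) / c) / s" by (simp add: mult.commute)
    finally have "dist (maximiser u) y < e / 2"
      using dist_maximiser[of u u0] elim(3) unfolding u0(2) by linarith
    moreover have "dist x (maximiser u) < e / 2"
    proof (rule power_less_imp_less_base[where n = 2])
      show "(dist x (maximiser u))\<^sup>2 < (e / 2)\<^sup>2"
        using K[rule_format, OF elim(4) x(1)] elim(2) unfolding x(2) by linarith
    qed (use e in simp)
    ultimately have "dist x y < e"
      using dist_triangle[of x y "maximiser u"] by linarith
    then show ?case using mem by blast
  qed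
qed

lemma tropical_limit:
  assumes "\<And>m. m \<in> lattice_points P \<Longrightarrow> a m \<noteq> 0"
  shows "hausdorff_limit P (\<lambda>s. moment_map ` Y_s d \<nu> lam \<phi> \<psi> a v s) (maximiser ` tropical_amoeba P v)"
proof (rule hausdorff_limitI)
  show "maximiser ` tropical_amoeba P v \<noteq> {}"
    by (rule two_lattice_points) (use tropical_amoeba_nonempty[OF finite_lattice_points] in blast)
  show "moment_map ` Y_s d \<nu> lam \<phi> \<psi> a v s \<subseteq> P" for s
    unfolding moment_map_image_Y_s by blast
  show "compact (maximiser ` tropical_amoeba P v)" by (rule compact_maximiser_tropical_amoeba)
  show "maximiser ` tropical_amoeba P v \<subseteq> P" using maximiser(1) by blast
  show "closed (moment_map ` Y_s d \<nu> lam \<phi> \<psi> a v s)" for s by (rule closed_moment_map_image_Y_s)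
qed (intro amoeba_near_limit limit_near_amoeba assms; assumption)+

end

theorem theorem1p7:
  fixes d :: nat
    and \<nu> :: "nat \<Rightarrow> int^'n::finite"
    and lam :: "nat \<Rightarrow> int"
    and \<phi> \<psi> :: "real^'n \<Rightarrow> real"
    and a :: "int^'n \<Rightarrow> complex"
    and v :: "int^'n \<Rightarrow> real"
    and P :: "(real^'n) set"
  assumes "delzant d \<nu> lam"
    and "P = polytope_of d \<nu> lam"
    and "\<phi> \<in> C_inf_gP d \<nu> lam"
    and "smooth_on_closed P \<psi>"
    and "\<And>x. x \<in> P \<Longrightarrow> positive_definite (hessian \<psi> x)"
    and "\<And>m. m \<in> lattice_points P \<Longrightarrow> a m \<noteq> 0"
  shows "\<exists>A_lim. hausdorff_limit P (\<lambda>s. moment_map ` Y_s d \<nu> lam \<phi> \<psi> a v s) A_lim \<and>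
           legendre \<psi> ` A_lim = proj P \<psi> ` tropical_amoeba P v"
proof -
  interpret D: delzant_polytope d \<nu> lam by unfold_locales (rule assms(1))
  have compact: "compact P" unfolding assms(2) by (rule D.compact_P)
  obtain c where c: "c > 0" "\<And>x w. x \<in> P \<Longrightarrow> c * (w \<bullet> w) \<le> w \<bullet> (hessian \<psi> x *v w)"
    using hessian_uniformly_positive[OF compact assms(4,5)] by blast
  interpret toric_degeneration d \<nu> lam \<psi> c \<phi>
  proof
    show "compact (polytope_of d \<nu> lam)" "convex (polytope_of d \<nu> lam)" "polytope_of d \<nu> lam \<noteq> {}"
      by (fact D.compact_P D.convex_P D.P_nonempty)+
    show "\<psi> differentiable (at x)" if "x \<in> polytope_of d \<nu> lam" for x
      using that assms(2) by (intro smooth_on_closedD(1)[OF assms(4)]) simp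
    show "continuous_on (polytope_of d \<nu> lam) (gradient \<psi>)"
      unfolding gradient_def[abs_def]
      by (intro continuous_on_vec_lambda differentiable_imp_continuous_on)
         (simp add: differentiable_at_imp_differentiable_on smooth_on_closedD(2)[OF assms(4)] assms(2))
    show "\<psi> x + gradient \<psi> x \<bullet> (y - x) + c / 2 * (norm (y - x))\<^sup>2 \<le> \<psi> y"
      if "x \<in> polytope_of d \<nu> lam" "y \<in> polytope_of d \<nu> lam" for x y
      using second_order_lower_bound[OF D.convex_P that, of \<psi> c] c(2) smooth_on_closedD[OF assms(4)]
      by (simp add: power2_norm_eq_inner assms(2))
  qed (use c(1) assms(3) in auto)
  have "gradient \<psi> ` maximiser ` tropical_amoeba P v = proj P \<psi> ` tropical_amoeba P v"
    by (simp add: image_image proj_eq assms(2))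
  then show ?thesis
    using tropical_limit[of a v] assms(6) unfolding assms(2) by blast
qed

end
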